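(* Let $Y=X\beta^*+\varepsilon$, where $\varepsilon$ has i.i.d. $N(0,\sigma^2)$ entries and is independent of $X$. Suppose $\beta^*\in\mathbb{R}^p$ is $(s,s_g)$-sparse with support $T=\{i:\beta^*_i\ne0\}$, $X\in\mathbb{R}^{n\times p}$ satisfies the sub-Gaussian design assumption with covariance $\Sigma$ (see context), and $\max_{i\in T^c}\|\Sigma_{i,T}\Sigma_{T,T}^{-1}\|_2\le c/\sqrt{s}$. Set $$\lambda=C\sigma\sqrt{\frac{(s\log(es_gb)+s_g\log(d/s_g))n}{s}},\quad\lambda_g=\sqrt{\frac{s}{s_g}}\lambda$$ in the sparse group Lasso, and $$\alpha=\frac{\lambda}{n\sigma},\quad\gamma=\sqrt{\frac{s}{s_g}}\frac{\lambda}{n\sigma}$$ in the convex program defining $\hat M$ (see context). Then with probability at least $1-C\exp\left(-C\frac{s\log(es_gb)+s_g\log(d/s_g)}{s}\right)$, the debiased sparse group Lasso estimator $\hat\beta^u$ can be decomposed as $\sqrt{n}(\hat\beta^u-\beta^* )=\Delta+w$, where $$\|\Delta\|_\infty\le\frac{C\left(s\log(es_gb)+s_g\log(ed/s_g)\right)}{\sqrt{n}}\,\sigma,\qquad w\,|\,X\sim N\left(0,\sigma^2\hat M\hat\Sigma\hat M^\top\right).$$ In particular, if $\sqrt{n}\gg s\log(es_gb)+s_g\log(ed/s_g)$ (the ratio of the left to the right side tends to infinity), then for any $1\le i\le p$, $$\frac{\sqrt{n}\left(\hat\beta^u_i-\beta^*_i\right)}{\sqrt{\hat m_i^\top\hat\Sigma\hat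 m_i}}\to N(0,\sigma^2)\quad\text{in distribution.}$$ Here $C$ and $c$ denote large and small positive constants, respectively, whose actual values may differ from one occurrence to the next.
   Context: Groups and norms: $\{1,\dots,p\}$ is partitioned into $d$ known groups $(1),\dots,(d)$ with $|(j)|=b_j$, and $b=\max_j b_j$. For $\gamma\in\mathbb{R}^p$, $\gamma_{(j)}$ is the subvector on group $j$; $\|\gamma\|_0$ is the number of nonzero entries, $\|\gamma\|_{0,2}=\sum_{j=1}^d 1_{\{\gamma_{(j)}\ne0\}}$, $\|\gamma\|_1=\sum_i|\gamma_i|$, $\|\gamma\|_{1,2}=\sum_{j=1}^d\|\gamma_{(j)}\|_2$, $\|\gamma\|_{\infty,2}=\max_j\|\gamma_{(j)}\|_2$, and $\|\gamma\|_\infty=\max_i|\gamma_i|$. $H_\alpha(x)=\mathrm{sgn}(x)\max\{|x|-\alpha,0\}$ is the soft-thresholding function, applied entrywise to vectors. Sparsity: $s,s_g$ are positive integers with $s_g\le d$ and $s_g\le s\le\max_{\Omega\subseteq\{1,\dots,d\},|\Omega|=s_g}\sum_{i\in\Omega}b_i$; $\beta$ is $(s,s_g)$-sparse if $\|\beta\|_{0,2}\le s_g$ and $\|\beta\|_0\le s$. Sub-Gaussian design assumption: the rows $X_{i\cdot}$ of $X$ are i.i.d., $\mathbb{E}X_{i\cdot}=0$, $\mathrm{Var}(X_{i\cdot}^\top)=\Sigma$, $\mathbb{E}\exp(v^\top\Sigma^{-1/2}X_{i\cdot}^\top)\le\exp(\kappa^2\|v\|_2^2/2)$ for all $v\in\mathbb{R}^p$,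 with $\kappa>0$ a constant, and $c_{\min}\le\sigma_{\min}(\Sigma)\le\sigma_{\max}(\Sigma)\le C_{\max}$ for constants $C_{\max}\ge c_{\min}>0$, where $\sigma_{\min}(\Sigma),\sigma_{\max}(\Sigma)$ are the smallest and largest eigenvalues of $\Sigma$. $\Sigma_{i,T}$ is the row vector $(\Sigma_{ij})_{j\in T}$ and $\Sigma_{T,T}$ the principal submatrix. Estimators: the sparse group Lasso estimator is $\hat\beta=\arg\min_\beta\|Y-X\beta\|_2^2+\lambda\|\beta\|_1+\lambda_g\|\beta\|_{1,2}$. Let $\hat\Sigma=\frac1nX^\top X$ be the sample covariance matrix. For $1\le i\le p$ let $\hat m_i$ be the solution of the convex program: minimize $m^\top\hat\Sigma m$ subject to $\|H_\alpha(\hat\Sigma m-e_i)\|_{\infty,2}\le\gamma$, where $e_i$ is the $i$-th canonical basis vector of $\mathbb{R}^p$, and let $\hat M=[\hat m_1\ \cdots\ \hat m_p]^\top$. The debiased sparse group Lasso estimator is $\hat\beta^u=\hat\beta+\frac1n\hat MX^\top(Y-X\hat\beta)$.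
   Formalization: The finite-sample decomposition is stated under the added condition n ≥ C(s log(e s_g b) + s_g log(ed/s_g)), without which it fails (e.g. n = 1, singleton groups, s = s_g = 1, Σ = I, large p and large β*_1); the asymptotic normality needs no added condition. *)

theory Defs
  imports
    "HOL-Probability.Probability"
    "Jordan_Normal_Form.Gauss_Jordan_Elimination"
    "Jordan_Normal_Form.Spectral_Radius"
    "Jordan_Normal_Form.DL_Submatrix"
begin

unbundle no vec_syntax
unbundle no inner_syntax

section \<open>Groups, norms, sparsity\<close>

text \<open>
  Dimensions are natural numbers, since the constants of the theorem must not depend on them;
  vectors and matrices are those of \<^theory>\<open>Jordan_Normal_Form.Matrix\<close>.
  Coordinates are numbered from 0, and the groups form a partition \<open>P\<close> of
  \<open>{..<p}\<close> (so \<open>d = card P\<close>).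
\<close>

definition max_group_size :: "nat set set \<Rightarrow> nat" where
  "max_group_size P = Max (card ` P)"

definition supp :: "real Matrix.vec \<Rightarrow> nat set" where
  "supp v = {i. i < dim_vec v \<and> v $ i \<noteq> 0}"

definition norm_0 :: "real Matrix.vec \<Rightarrow> nat" where
  "norm_0 v = card (supp v)"

definition norm_1 :: "real Matrix.vec \<Rightarrow> real" where
  "norm_1 v = (\<Sum>i<dim_vec v. \<bar>v $ i\<bar>)"

definition norm_2 :: "real Matrix.vec \<Rightarrow> real" where
  "norm_2 v = L2_set (\<lambda>i. v $ i) {..<dim_vec v}"

definition norm_inf :: "real Matrix.vec \<Rightarrow> real" where
  "norm_inf v = Max ((\<lambda>i. \<bar>v $ i\<bar>) ` {..<dim_vec v})"

definition norm_0_2 :: "nat set set \<Rightarrow> real Matrix.vec \<Rightarrow> nat" where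
  "norm_0_2 P v = card {g \<in> P. \<exists>i\<in>g. v $ i \<noteq> 0}"

definition norm_1_2 :: "nat set set \<Rightarrow> real Matrix.vec \<Rightarrow> real" where
  "norm_1_2 P v = (\<Sum>g\<in>P. L2_set (\<lambda>i. v $ i) g)"

definition norm_inf_2 :: "nat set set \<Rightarrow> real Matrix.vec \<Rightarrow> real" where
  "norm_inf_2 P v = Max ((\<lambda>g. L2_set (\<lambda>i. v $ i) g) ` P)"

definition soft_threshold :: "real \<Rightarrow> real \<Rightarrow> real" where
  "soft_threshold a x = sgn x * max (\<bar>x\<bar> - a) 0"

definition sparsity_levels :: "nat set set \<Rightarrow> nat \<Rightarrow> nat \<Rightarrow> bool" where
  "sparsity_levels P s sg \<longleftrightarrow> 0 < s \<and> 0 < sg \<and> sg \<le> card P \<and> sg \<le> s \<and>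
     s \<le> Max {(\<Sum>g\<in>\<Omega>. card g) |\<Omega>. \<Omega> \<subseteq> P \<and> card \<Omega> = sg}"

definition sparse :: "nat set set \<Rightarrow> nat \<Rightarrow> nat \<Rightarrow> real Matrix.vec \<Rightarrow> bool" where
  "sparse P s sg v \<longleftrightarrow> norm_0_2 P v \<le> sg \<and> norm_0 v \<le> s"

section \<open>Random vectors and normal laws\<close>

definition vec_borel :: "nat \<Rightarrow> real Matrix.vec measure" where
  "vec_borel p = vimage_algebra (carrier_vec p)
     (\<lambda>v. \<lambda>i\<in>{..<p}. v $ i) (\<Pi>\<^sub>M i\<in>{..<p}. borel)"

definition mat_borel :: "nat \<Rightarrow> nat \<Rightarrow> real mat measure" where
  "mat_borel n p = vimage_algebra (carrier_mat n p)
     (\<lambda>A. \<lambda>ij\<in>{..<n} \<times> {..<p}. A $$ ij) (\<Pi>\<^sub>M ij\<in>{..<n} \<times> {..<p}. borel)"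

text \<open>The law \<open>N(0, v)\<close> on the reals with variance \<open>v \<ge> 0\<close>; it is a point mass for
  \<open>v = 0\<close>.\<close>

definition centered_normal :: "real \<Rightarrow> real measure" where
  "centered_normal v =
     (if v = 0 then return borel 0 else density lborel (normal_density 0 (sqrt v)))"

text \<open>\<open>\<mu>\<close> is the law \<open>N(0, V)\<close> on \<open>p\<close>-dimensional space, with \<open>V\<close> possibly singular:
  every linear functional has a normal law.\<close>

definition centered_normal_vec :: "nat \<Rightarrow> real mat \<Rightarrow> real Matrix.vec measure \<Rightarrow> bool" where
  "centered_normal_vec p V \<mu> \<longleftrightarrow> prob_space \<mu> \<and> sets \<mu> = sets (vec_borel p) \<and>
     (\<forall>v\<in>carrier_vec p. distr \<mu> borel (\<lambda>x. v \<bullet> x) = centered_normal (v \<bullet> (V *\<^sub>v v)))"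

text \<open>\<open>W | X \<sim> N(0, V X)\<close>: the normal laws \<open>N(0, V x)\<close> form a regular conditional
  distribution of \<open>W\<close> given \<open>X\<close>.\<close>

definition cond_centered_normal ::
  "'a measure \<Rightarrow> 'b measure \<Rightarrow> ('a \<Rightarrow> 'b) \<Rightarrow> nat \<Rightarrow> ('a \<Rightarrow> real Matrix.vec) \<Rightarrow> ('b \<Rightarrow> real mat) \<Rightarrow> bool"
  where
  "cond_centered_normal M N X p W V \<longleftrightarrow> X \<in> M \<rightarrow>\<^sub>M N \<and> W \<in> M \<rightarrow>\<^sub>M vec_borel p \<and>
     (\<exists>K \<in> N \<rightarrow>\<^sub>M prob_algebra (vec_borel p).
        (\<forall>x\<in>space N. centered_normal_vec p (V x) (K x)) \<and>
        (\<forall>A\<in>sets N. \<forall>B\<in>sets (vec_borel p).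
           emeasure M {\<omega> \<in> space M. X \<omega> \<in> A \<and> W \<omega> \<in> B} =
             (\<integral>\<^sup>+x\<in>A. emeasure (K x) B \<partial>distr M N X)))"

section \<open>Design and noise\<close>

text \<open>\<open>R\<close> is the matrix \<open>S\<^sup>-\<^sup>1\<^sup>/\<^sup>2\<close>, i.e. the symmetric positive definite square root of the inverse
  of \<open>S\<close>.\<close>

definition is_inv_sqrt_mat :: "nat \<Rightarrow> real mat \<Rightarrow> real mat \<Rightarrow> bool" where
  "is_inv_sqrt_mat p S R \<longleftrightarrow> R \<in> carrier_mat p p \<and> transpose_mat R = R \<and>
     (\<forall>v\<in>carrier_vec p. v \<noteq> 0\<^sub>v p \<longrightarrow> 0 < v \<bullet> (R *\<^sub>v v)) \<and> R * R * S = 1\<^sub>m p"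

definition subgaussian_design ::
  "real \<Rightarrow> real \<Rightarrow> real \<Rightarrow> 'a measure \<Rightarrow> nat \<Rightarrow> nat \<Rightarrow> real mat \<Rightarrow> ('a \<Rightarrow> real mat) \<Rightarrow> bool" where
  "subgaussian_design \<kappa> cmin Cmax M n p S X \<longleftrightarrow>
     X \<in> M \<rightarrow>\<^sub>M mat_borel n p \<and>
     prob_space.indep_vars M (\<lambda>_. vec_borel p) (\<lambda>k \<omega>. Matrix.row (X \<omega>) k) {..<n} \<and>
     (\<forall>k<n. \<forall>l<n. distr M (vec_borel p) (\<lambda>\<omega>. Matrix.row (X \<omega>) k)
                  = distr M (vec_borel p) (\<lambda>\<omega>. Matrix.row (X \<omega>) l)) \<and>
     (\<forall>k<n. \<forall>i<p. integrable M (\<lambda>\<omega>. X \<omega> $$ (k, i)) \<and> (\<integral>\<omega>. X \<omega> $$ (k, i) \<partial>M) = 0) \<and>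
     S \<in> carrier_mat p p \<and>
     (\<forall>k<n. \<forall>i<p. \<forall>j<p. integrable M (\<lambda>\<omega>. X \<omega> $$ (k, i) * X \<omega> $$ (k, j)) \<and>
        (\<integral>\<omega>. X \<omega> $$ (k, i) * X \<omega> $$ (k, j) \<partial>M) = S $$ (i, j)) \<and>
     cmin \<le> Min (spectrum S) \<and> Max (spectrum S) \<le> Cmax \<and>
     (\<exists>R. is_inv_sqrt_mat p S R \<and>
        (\<forall>k<n. \<forall>v\<in>carrier_vec p.
           integrable M (\<lambda>\<omega>. exp (v \<bullet> (R *\<^sub>v Matrix.row (X \<omega>) k))) \<and>
           (\<integral>\<omega>. exp (v \<bullet> (R *\<^sub>v Matrix.row (X \<omega>) k)) \<partial>M) \<le> exp (\<kappa>\<^sup>2 * (norm_2 v)\<^sup>2 / 2)))"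

definition gaussian_noise ::
  "'a measure \<Rightarrow> nat \<Rightarrow> nat \<Rightarrow> real \<Rightarrow> ('a \<Rightarrow> real mat) \<Rightarrow> ('a \<Rightarrow> real Matrix.vec) \<Rightarrow> bool" where
  "gaussian_noise M n p \<sigma> X \<epsilon> \<longleftrightarrow>
     \<epsilon> \<in> M \<rightarrow>\<^sub>M vec_borel n \<and>
     prob_space.indep_vars M (\<lambda>_. borel) (\<lambda>k \<omega>. \<epsilon> \<omega> $ k) {..<n} \<and>
     (\<forall>k<n. distr M borel (\<lambda>\<omega>. \<epsilon> \<omega> $ k) = density lborel (normal_density 0 \<sigma>)) \<and>
     prob_space.indep_set M {X -` A \<inter> space M |A. A \<in> sets (mat_borel n p)}
       {\<epsilon> -` B \<inter> space M |B. B \<in> sets (vec_borel n)}"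

text \<open>The row vector \<open>\<Sigma>\<^bsub>i,T\<^esub> \<Sigma>\<^bsub>T,T\<^esub>\<^sup>-\<^sup>1\<close>. The inverse exists whenever \<open>S\<close> is positive definite.\<close>

definition coherence_row :: "real mat \<Rightarrow> nat set \<Rightarrow> nat \<Rightarrow> real Matrix.vec" where
  "coherence_row S T i = Matrix.row (submatrix S {i} T * the (mat_inverse (submatrix S T T))) 0"

section \<open>Tuning parameters and estimators\<close>

definition complexity :: "nat set set \<Rightarrow> nat \<Rightarrow> nat \<Rightarrow> real" where
  "complexity P s sg =
     real s * ln (exp 1 * real sg * real (max_group_size P)) + real sg * ln (real (card P) / real sg)"

definition complexity_e :: "nat set set \<Rightarrow> nat \<Rightarrow> nat \<Rightarrow> real" where
  "complexity_e P s sg =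
     real s * ln (exp 1 * real sg * real (max_group_size P)) +
     real sg * ln (exp 1 * real (card P) / real sg)"

definition lasso_param :: "real \<Rightarrow> real \<Rightarrow> nat \<Rightarrow> nat set set \<Rightarrow> nat \<Rightarrow> nat \<Rightarrow> real" where
  "lasso_param C \<sigma> n P s sg = C * \<sigma> * sqrt (complexity P s sg * real n / real s)"

definition group_param :: "real \<Rightarrow> real \<Rightarrow> nat \<Rightarrow> nat set set \<Rightarrow> nat \<Rightarrow> nat \<Rightarrow> real" where
  "group_param C \<sigma> n P s sg = sqrt (real s / real sg) * lasso_param C \<sigma> n P s sg"

definition alpha_param :: "real \<Rightarrow> real \<Rightarrow> nat \<Rightarrow> nat set set \<Rightarrow> nat \<Rightarrow> nat \<Rightarrow> real" where
  "alpha_param C \<sigma> n P s sg = lasso_param C \<sigma> n P s sg / (real n * \<sigma>)"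

definition gamma_param :: "real \<Rightarrow> real \<Rightarrow> nat \<Rightarrow> nat set set \<Rightarrow> nat \<Rightarrow> nat \<Rightarrow> real" where
  "gamma_param C \<sigma> n P s sg = sqrt (real s / real sg) * (lasso_param C \<sigma> n P s sg / (real n * \<sigma>))"

definition is_sparse_group_lasso ::
  "nat set set \<Rightarrow> real \<Rightarrow> real \<Rightarrow> real mat \<Rightarrow> real Matrix.vec \<Rightarrow> real Matrix.vec \<Rightarrow> bool" where
  "is_sparse_group_lasso P lam lamg X Y b \<longleftrightarrow>
     is_arg_min (\<lambda>b. (norm_2 (Y - X *\<^sub>v b))\<^sup>2 + lam * norm_1 b + lamg * norm_1_2 P b)
       (\<lambda>b. b \<in> carrier_vec (dim_col X)) b"

definition sample_cov :: "real mat \<Rightarrow> real mat" where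
  "sample_cov X = (1 / real (dim_row X)) \<cdot>\<^sub>m (transpose_mat X * X)"

definition debias_feasible ::
  "nat set set \<Rightarrow> real \<Rightarrow> real \<Rightarrow> real mat \<Rightarrow> nat \<Rightarrow> real Matrix.vec \<Rightarrow> bool" where
  "debias_feasible P a c X i m \<longleftrightarrow> m \<in> carrier_vec (dim_col X) \<and>
     norm_inf_2 P (map_vec (soft_threshold a) (sample_cov X *\<^sub>v m - unit_vec (dim_col X) i)) \<le> c"

definition is_debias_solution ::
  "nat set set \<Rightarrow> real \<Rightarrow> real \<Rightarrow> real mat \<Rightarrow> nat \<Rightarrow> real Matrix.vec \<Rightarrow> bool" where
  "is_debias_solution P a c X i m \<longleftrightarrow>
     is_arg_min (\<lambda>m. m \<bullet> (sample_cov X *\<^sub>v m)) (debias_feasible P a c X i) m"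

text \<open>\<open>mhat A i\<close> is the chosen solution of the \<open>i\<close>-th program for the design matrix \<open>A\<close>; these vectors
  are the rows of the debiasing matrix.\<close>

definition debias_mat :: "(real mat \<Rightarrow> nat \<Rightarrow> real Matrix.vec) \<Rightarrow> real mat \<Rightarrow> real mat" where
  "debias_mat mhat A = mat_of_rows (dim_col A) (map (mhat A) [0..<dim_col A])"

definition debiased ::
  "real mat \<Rightarrow> real mat \<Rightarrow> real Matrix.vec \<Rightarrow> real Matrix.vec \<Rightarrow> real Matrix.vec" where
  "debiased Mhat X Y b =
     b + (1 / real (dim_row X)) \<cdot>\<^sub>v (Mhat *\<^sub>v (transpose_mat X *\<^sub>v (Y - X *\<^sub>v b)))"

section \<open>The regression model\<close>

text \<open>
  The constants are \<open>\<kappa>\<close>, \<open>cmin\<close>, \<open>Cmax\<close>, \<open>c\<close> (bound on the coherence) and \<open>C\<close> (in the tuning parameter).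
  Neither minimiser need be unique: \<open>\<beta>hat\<close> is any measurable choice of a sparse group Lasso
  estimator, and \<open>mhat\<close> any measurable function of the design matrix that selects a solution of
  each convex program. A program may be infeasible for some samples; there \<open>mhat\<close> is unconstrained.
\<close>

definition sgl_model ::
  "real \<Rightarrow> real \<Rightarrow> real \<Rightarrow> real \<Rightarrow> real \<Rightarrow> 'a measure \<Rightarrow> nat \<Rightarrow> nat \<Rightarrow> nat set set \<Rightarrow> nat \<Rightarrow> nat \<Rightarrow> real \<Rightarrow>
   real mat \<Rightarrow> real Matrix.vec \<Rightarrow> ('a \<Rightarrow> real mat) \<Rightarrow> ('a \<Rightarrow> real Matrix.vec) \<Rightarrow> ('a \<Rightarrow> real Matrix.vec) \<Rightarrow>
   ('a \<Rightarrow> real Matrix.vec) \<Rightarrow> (real mat \<Rightarrow> nat \<Rightarrow> real Matrix.vec) \<Rightarrow> bool" where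
  "sgl_model \<kappa> cmin Cmax c C M n p P s sg \<sigma> S \<beta> X \<epsilon> Y \<beta>hat mhat \<longleftrightarrow>
     prob_space M \<and> 0 < n \<and> 0 < \<sigma> \<and>
     partition_on {..<p} P \<and> sparsity_levels P s sg \<and>
     \<beta> \<in> carrier_vec p \<and> sparse P s sg \<beta> \<and>
     subgaussian_design \<kappa> cmin Cmax M n p S X \<and>
     gaussian_noise M n p \<sigma> X \<epsilon> \<and>
     (\<forall>\<omega>\<in>space M. Y \<omega> = X \<omega> *\<^sub>v \<beta> + \<epsilon> \<omega>) \<and>
     (\<forall>i\<in>{..<p} - supp \<beta>. norm_2 (coherence_row S (supp \<beta>) i) \<le> c / sqrt (real s)) \<and>
     \<beta>hat \<in> M \<rightarrow>\<^sub>M vec_borel p \<and>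
     (\<forall>\<omega>\<in>space M. is_sparse_group_lasso P (lasso_param C \<sigma> n P s sg) (group_param C \<sigma> n P s sg)
        (X \<omega>) (Y \<omega>) (\<beta>hat \<omega>)) \<and>
     (\<forall>i<p. (\<lambda>A. mhat A i) \<in> mat_borel n p \<rightarrow>\<^sub>M vec_borel p) \<and>
     (\<forall>\<omega>\<in>space M. \<forall>i<p.
        (\<exists>m. debias_feasible P (alpha_param C \<sigma> n P s sg) (gamma_param C \<sigma> n P s sg) (X \<omega>) i m) \<longrightarrow>
        is_debias_solution P (alpha_param C \<sigma> n P s sg) (gamma_param C \<sigma> n P s sg) (X \<omega>) i
          (mhat (X \<omega>) i))"

end

theory Submission
  imports Defs
begin

text \<open>
  Write \<open>r = s / s\<^sub>g\<close>. Soft thresholding at level \<open>a\<close> is dominated by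
  integer directions: if \<open>\<langle>w, u\<rangle> \<le> r a\<close> for all integer vectors \<open>w\<close> with \<open>|w|\<^sup>2 \<le> 4 r\<close>, then
  \<open>|H\<^sub>a(u)|\<^sub>2 \<le> sqrt r a\<close>, because at most \<open>r\<close> entries of \<open>u\<close> exceed \<open>a\<close> and a rescaled \<open>H\<^sub>a(u)\<close> can be
  rounded. Hence integer vectors with squared norm at most \<open>4 s\<close> in at most \<open>s\<^sub>g\<close> groups, of which there are only
  \<open>exp O(complexity)\<close>, control linear and, applied twice, bilinear forms on the cone
  \<open>|\<delta>|\<^sub>1 \<le> L sqrt s |\<delta>|\<^sub>2\<close>, \<open>|\<delta>|\<^sub>1\<^sub>,\<^sub>2 \<le> L sqrt s\<^sub>g |\<delta>|\<^sub>2\<close>. A union bound over them with Bernstein's inequality gives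
  restricted eigenvalues, the noise bound for the Lasso, and the feasibility of the columns of the inverse
  of \<open>\<Sigma>\<close> in the debiasing programs.

  The probability bound need not tend to one along a sequence with bounded \<open>complexity / s\<close>. In that case \<open>p\<close> is
  bounded, every vector lies in a fixed cone, and the sample covariance is invertible with
  probability tending to one, which makes the programs feasible. So for the normal limit one splits
  according to whether \<open>complexity / s\<close> exceeds a large constant.
\<close>

section \<open>Thresholding and integer directions\<close>

text \<open>With \<open>\<gamma> = sqrt r * \<alpha>\<close> the debiasing constraint is dual to the
  penalty, and \<open>sqrt r * a\<close> is exactly the bound that rounding yields for a thresholded
  group. The remainder is \<open>- sqrt n\<close> times the pairing of the constraint residual with
  the Lasso error, so duality bounds it by the penalty of the error over
  \<open>sqrt n * \<sigma>\<close>; that penalty is of order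
  \<open>\<sigma>\<^sup>2 * complexity\<close>. Within one group the tail exponents are multiples of
  \<open>C\<^sup>2 * complexity / sg\<close>, while the directions number at most
  \<open>exp (11 * complexity / sg)\<close>: hence \<open>C\<close> must be large. If
  \<open>complexity / s\<close> stays bounded, noise above a quarter of the penalty level need not
  have vanishing probability, and then the basic inequality no longer puts the error into a cone. So
  the noise level carries a free factor \<open>q\<close>, and the rate lemma takes the cone as a
  hypothesis. Given the design, the studentized Gaussian part is exactly normal; the limit law needs
  only a small remainder and a variance bounded away from zero.\<close>

lemma sum_swap_bilinear:
  fixes B :: "nat \<Rightarrow> nat \<Rightarrow> real"
  shows "(\<Sum>i\<in>I. \<Sum>j\<in>J. u i * B i j * v j) = (\<Sum>j\<in>J. (\<Sum>i\<in>I. u i * B i j) * v j)"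
  by (subst sum.swap) (simp add: sum_distrib_right)

lemma soft_threshold_rounding:
  fixes u :: "nat \<Rightarrow> real"
  assumes fin: "finite G" and r: "r \<ge> 1" and a: "a \<ge> 0"
    and H: "\<And>w :: nat \<Rightarrow> int. \<lbrakk>\<And>i. i \<notin> G \<Longrightarrow> w i = 0; (\<Sum>i\<in>G. (real_of_int (w i))\<^sup>2) \<le> 4 * r\<rbrakk> \<Longrightarrow>
               (\<Sum>i\<in>G. real_of_int (w i) * u i) \<le> r * a"
  shows "L2_set (\<lambda>i. soft_threshold a (u i)) G \<le> sqrt r * a"
proof -
  define f where "f i = soft_threshold a (u i)" for i
  have f_eq: "f = (\<lambda>i. soft_threshold a (u i))" by (auto simp: f_def)
  define A where "A = {i \<in> G. \<bar>u i\<bar> > a}"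
  have finA: "finite A" "A \<subseteq> G" using fin by (auto simp: A_def)
  have f0: "f i = 0" if "i \<in> G" "i \<notin> A" for i using that by (auto simp: A_def f_def soft_threshold_def)
  have cardA: "real (card A) \<le> r"
  proof (rule ccontr)
    assume "\<not> real (card A) \<le> r"
    then have c: "real (card A) > r" by simp
    \<comment> \<open>If more than \<open>r\<close> entries exceeded \<open>a\<close>, the signs of
      \<open>k\<close> of them, with \<open>r \<le> k \<le> 2 * r\<close>, would form an admissible
      direction whose pairing with \<open>u\<close> exceeds
      \<open>k * a \<ge> r * a\<close>.\<close>
    define k where "k = nat \<lceil>r\<rceil>"
    have k: "real k \<ge> r" "real k \<le> 2 * r" "k > 0" using r unfolding k_def by linarith+
    have "k \<le> card A" using c unfolding k_def by linarith
    then obtain B where B: "B \<subseteq> A" "card B = k" by (meson obtain_subset_with_card_n)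
    have finB: "finite B" "B \<subseteq> G" using B finA finite_subset by auto
    define w :: "nat \<Rightarrow> int" where "w i = (if i \<in> B then (if u i > 0 then 1 else -1) else 0)" for i
    have "(\<Sum>i\<in>G. (real_of_int (w i))\<^sup>2) = (\<Sum>i\<in>G. if i \<in> B then 1 else 0)"
      by (intro sum.cong) (auto simp: w_def)
    also have "\<dots> = real k" using finB fin B by (simp add: sum.If_cases Int_absorb1)
    finally have s: "(\<Sum>i\<in>G. (real_of_int (w i))\<^sup>2) \<le> 4 * r" using k r by simp
    have "(\<Sum>i\<in>G. real_of_int (w i) * u i) = (\<Sum>i\<in>G. if i \<in> B then \<bar>u i\<bar> else 0)"
      by (intro sum.cong) (auto simp: w_def)
    also have "\<dots> = (\<Sum>i\<in>B. \<bar>u i\<bar>)" using finB fin by (simp add: sum.If_cases Int_absorb1)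
    also have "\<dots> > (\<Sum>i\<in>B. a)"
      using B k finB by (intro sum_strict_mono) (auto simp: A_def)
    finally have "(\<Sum>i\<in>G. real_of_int (w i) * u i) > real k * a" using B by simp
    moreover have "real k * a \<ge> r * a" using k a by (intro mult_right_mono) auto
    moreover have "(\<Sum>i\<in>G. real_of_int (w i) * u i) \<le> r * a"
      using finB by (intro H[OF _ s]) (auto simp: w_def)
    ultimately show False by linarith
  qed
  define F where "F = L2_set f G"
  have F0: "F \<ge> 0" by (simp add: F_def)
  have F2: "(\<Sum>i\<in>G. (f i)\<^sup>2) = F\<^sup>2" by (simp add: F_def L2_set_def sum_nonneg)
  show ?thesis
  proof (cases "F = 0")
    case True
    then show ?thesis using a r by (simp add: F_def flip: f_eq)
  next
    case False
    then have Fp: "F > 0" using F0 by simp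
    define \<theta> where "\<theta> = sqrt r / F"
    have th: "\<theta> > 0" using Fp r by (simp add: \<theta>_def)
    \<comment> \<open>Rounding moves each entry away from zero, so the pairing with \<open>u\<close>
      does not drop below \<open>\<theta> * F\<^sup>2\<close>. With
      \<open>\<theta> = sqrt r / F\<close> the squared norm is at most
      \<open>2 * \<theta>\<^sup>2 * F\<^sup>2 + 2 * card A \<le> 4 * r\<close>, the origin of the
      budget \<open>4 * r\<close>.\<close>
    define w :: "nat \<Rightarrow> int" where
      "w i = (if i \<in> A then (if u i > 0 then \<lceil>\<theta> * \<bar>f i\<bar>\<rceil> else - \<lceil>\<theta> * \<bar>f i\<bar>\<rceil>) else 0)" for i
    have wA: "\<bar>real_of_int (w i)\<bar> \<le> \<theta> * \<bar>f i\<bar> + 1" "real_of_int (w i) * u i \<ge> \<theta> * (f i)\<^sup>2" if "i \<in> A" for i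
    proof -
      have n: "\<theta> * \<bar>f i\<bar> \<ge> 0" using th by simp
      have c: "real_of_int \<lceil>\<theta> * \<bar>f i\<bar>\<rceil> \<ge> \<theta> * \<bar>f i\<bar>" "real_of_int \<lceil>\<theta> * \<bar>f i\<bar>\<rceil> \<le> \<theta> * \<bar>f i\<bar> + 1" by linarith+
      show "\<bar>real_of_int (w i)\<bar> \<le> \<theta> * \<bar>f i\<bar> + 1" using c n that by (auto simp: w_def)
      have fu: "\<bar>f i\<bar> \<le> \<bar>u i\<bar>" using that a by (auto simp: A_def f_def soft_threshold_def abs_mult sgn_if)
      have "real_of_int (w i) * u i = real_of_int \<lceil>\<theta> * \<bar>f i\<bar>\<rceil> * \<bar>u i\<bar>"
        using that by (auto simp: w_def)
      also have "\<dots> \<ge> (\<theta> * \<bar>f i\<bar>) * \<bar>f i\<bar>" using c n fu by (intro mult_mono) auto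
      finally show "real_of_int (w i) * u i \<ge> \<theta> * (f i)\<^sup>2" by (simp add: power2_eq_square)
    qed
    have "(\<Sum>i\<in>G. (real_of_int (w i))\<^sup>2) = (\<Sum>i\<in>A. (real_of_int (w i))\<^sup>2)"
      using fin finA by (intro sum.mono_neutral_right) (auto simp: w_def)
    also have "\<dots> \<le> (\<Sum>i\<in>A. 2 * \<theta>\<^sup>2 * (f i)\<^sup>2 + 2)"
    proof (rule sum_mono)
      fix i assume "i \<in> A"
      have "(real_of_int (w i))\<^sup>2 \<le> (\<theta> * \<bar>f i\<bar> + 1)\<^sup>2"
        using power_mono[OF wA(1)[OF \<open>i \<in> A\<close>], of 2] by simp
      also have "\<dots> \<le> 2 * (\<theta> * \<bar>f i\<bar>)\<^sup>2 + 2"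
        using sum_squares_bound[of "\<theta> * \<bar>f i\<bar>" 1] by (simp add: power2_sum)
      finally show "(real_of_int (w i))\<^sup>2 \<le> 2 * \<theta>\<^sup>2 * (f i)\<^sup>2 + 2" by (simp add: power_mult_distrib)
    qed
    also have "\<dots> = 2 * \<theta>\<^sup>2 * (\<Sum>i\<in>A. (f i)\<^sup>2) + 2 * real (card A)"
      by (simp add: sum.distrib sum_distrib_left)
    also have "(\<Sum>i\<in>A. (f i)\<^sup>2) = (\<Sum>i\<in>G. (f i)\<^sup>2)"
      using fin finA f0 by (intro sum.mono_neutral_left) auto
    also have "2 * \<theta>\<^sup>2 * \<dots> = 2 * r" using Fp r unfolding F2 \<theta>_def by (simp add: power_divide)
    finally have s: "(\<Sum>i\<in>G. (real_of_int (w i))\<^sup>2) \<le> 4 * r" using cardA by simp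
    have "\<theta> * F\<^sup>2 = \<theta> * (\<Sum>i\<in>A. (f i)\<^sup>2)"
      unfolding F2[symmetric] using fin finA f0 by (subst sum.mono_neutral_right[of G A]) auto
    also have "\<dots> \<le> (\<Sum>i\<in>A. real_of_int (w i) * u i)"
      unfolding sum_distrib_left by (intro sum_mono wA)
    also have "\<dots> = (\<Sum>i\<in>G. real_of_int (w i) * u i)"
      using fin finA by (intro sum.mono_neutral_left) (auto simp: w_def)
    also have "\<dots> \<le> r * a" using finA by (intro H[OF _ s]) (auto simp: w_def)
    finally have "sqrt r * F \<le> sqrt r * (sqrt r * a)"
      using Fp r by (simp add: \<theta>_def power2_eq_square flip: mult.assoc)
    then show ?thesis using r by (simp add: F_def flip: f_eq)
  qed
qed

text \<open>Integer vectors whose convex hull, after division by \<open>sqrt s\<close>, contains the unit-norm vectors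
  with \<open>s\<close> entries in \<open>sg\<close> groups up to a constant: a finite substitute for a net.\<close>

definition int_net :: "nat set set \<Rightarrow> real \<Rightarrow> nat \<Rightarrow> (nat \<Rightarrow> int) set" where
  "int_net P s sg = {w. (\<forall>i. i \<notin> \<Union>P \<longrightarrow> w i = 0) \<and> (\<Sum>i\<in>\<Union>P. (real_of_int (w i))\<^sup>2) \<le> 4 * s \<and>
     card {g \<in> P. \<exists>i\<in>g. w i \<noteq> 0} \<le> sg}"

text \<open>Serves to single out the \<open>sg\<close> groups with the largest thresholded norms;
  each group outside is then bounded by the quadratic mean over the chosen ones.\<close>

lemma top_subset:
  fixes h :: "'b \<Rightarrow> real"
  assumes "finite P" "k \<le> card P"
  shows "\<exists>G \<subseteq> P. card G = k \<and> (\<forall>g\<in>G. \<forall>g'\<in>P - G. h g' \<le> h g)"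
  using assms(2)
proof (induction k)
  case 0 then show ?case by (intro exI[of _ "{}"]) auto
next
  case (Suc k)
  then obtain G where G: "G \<subseteq> P" "card G = k" "\<forall>g\<in>G. \<forall>g'\<in>P - G. h g' \<le> h g" by auto
  have "P - G \<noteq> {}" using G Suc.prems
    by (metis Diff_eq_empty_iff Suc_n_not_le_n subset_antisym)
  then obtain m where m: "m \<in> P - G" "\<forall>g\<in>P - G. h g \<le> h m"
  proof -
    have f: "finite (h ` (P - G))" using assms(1) by simp
    obtain m where m: "m \<in> P - G" "Max (h ` (P - G)) = h m"
      using Max_in[OF f] \<open>P - G \<noteq> {}\<close> by auto
    have "h g \<le> h m" if "g \<in> P - G" for g using Max_ge[OF f imageI[OF that]] m by simp
    with m that show thesis by blast
  qed
  have "finite G" using G assms finite_subset by blast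
  then show ?case using G m by (intro exI[of _ "insert m G"]) auto
qed

text \<open>\<open>x - soft_threshold a x\<close> is the projection of \<open>x\<close> onto the
  interval from \<open>- a\<close> to \<open>a\<close>.\<close>

lemma clip_soft_threshold:
  assumes "a \<ge> 0"
  shows "\<bar>x - soft_threshold a x\<bar> \<le> a"
  using assms by (auto simp: soft_threshold_def sgn_if max_def)

lemma sum_partition:
  fixes f :: "'b \<Rightarrow> real"
  assumes "finite I" "partition_on I P"
  shows "(\<Sum>i\<in>I. f i) = (\<Sum>g\<in>P. \<Sum>i\<in>g. f i)"
proof -
  have "finite g" if "g \<in> P" for g using that assms by (auto simp: partition_on_def intro: finite_subset)
  then have "sum f (\<Union>P) = (sum \<circ> sum) f P"
    using assms by (intro sum.Union_disjoint) (auto simp: partition_on_def disjoint_def)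
  then show ?thesis using assms by (simp add: partition_on_def)
qed

text \<open>\<open>u\<close> splits into a part clipped at \<open>a\<close>, paired with the l1 norm
  of \<open>\<delta>\<close>, and the thresholded part, paired group by group by Cauchy-Schwarz.
  This is the duality that links thresholded residuals to the sparse group penalty.\<close>

lemma threshold_dual_bound:
  fixes u \<delta> :: "nat \<Rightarrow> real"
  assumes fin: "finite I" and P: "partition_on I P" and a: "a \<ge> 0"
  shows "(\<Sum>i\<in>I. u i * \<delta> i) \<le> a * (\<Sum>i\<in>I. \<bar>\<delta> i\<bar>) +
           (\<Sum>g\<in>P. L2_set (\<lambda>i. soft_threshold a (u i)) g * L2_set \<delta> g)"
proof -
  have finP: "finite P" using P fin by (rule finite_elements[rotated])
  have fing: "finite g" if "g \<in> P" for g using that P fin by (auto simp: partition_on_def intro: finite_subset)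
  have "(\<Sum>i\<in>I. u i * \<delta> i) = (\<Sum>i\<in>I. (u i - soft_threshold a (u i)) * \<delta> i) + (\<Sum>i\<in>I. soft_threshold a (u i) * \<delta> i)"
    by (simp add: algebra_simps flip: sum.distrib)
  also have "(\<Sum>i\<in>I. (u i - soft_threshold a (u i)) * \<delta> i) \<le> (\<Sum>i\<in>I. a * \<bar>\<delta> i\<bar>)"
  proof (rule sum_mono)
    fix i
    have "(u i - soft_threshold a (u i)) * \<delta> i \<le> \<bar>u i - soft_threshold a (u i)\<bar> * \<bar>\<delta> i\<bar>"
      by (metis abs_ge_self abs_mult)
    also have "\<dots> \<le> a * \<bar>\<delta> i\<bar>" using clip_soft_threshold[OF a] by (intro mult_right_mono) auto
    finally show "(u i - soft_threshold a (u i)) * \<delta> i \<le> a * \<bar>\<delta> i\<bar>" .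
  qed
  also have "(\<Sum>i\<in>I. soft_threshold a (u i) * \<delta> i) = (\<Sum>g\<in>P. \<Sum>i\<in>g. soft_threshold a (u i) * \<delta> i)"
    by (rule sum_partition[OF fin P])
  also have "\<dots> \<le> (\<Sum>g\<in>P. L2_set (\<lambda>i. soft_threshold a (u i)) g * L2_set \<delta> g)"
  proof (rule sum_mono)
    fix g
    have "(\<Sum>i\<in>g. soft_threshold a (u i) * \<delta> i) \<le> (\<Sum>i\<in>g. \<bar>soft_threshold a (u i)\<bar> * \<bar>\<delta> i\<bar>)"
      by (intro sum_mono) (metis abs_ge_self abs_mult)
    also have "\<dots> \<le> L2_set (\<lambda>i. soft_threshold a (u i)) g * L2_set \<delta> g" by (rule L2_set_mult_ineq)
    finally show "(\<Sum>i\<in>g. soft_threshold a (u i) * \<delta> i) \<le> \<dots>" .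
  qed
  finally show ?thesis by (simp add: sum_distrib_left)
qed

lemma sum_squares_groups:
  assumes "finite I" "partition_on I P"
  shows "(\<Sum>g\<in>P. (L2_set \<delta> g)\<^sup>2) = (\<Sum>i\<in>I. (\<delta> i)\<^sup>2)"
proof -
  have fing: "finite g" if "g \<in> P" for g using that assms by (auto simp: partition_on_def intro: finite_subset)
  have "(\<Sum>g\<in>P. (L2_set \<delta> g)\<^sup>2) = (\<Sum>g\<in>P. \<Sum>i\<in>g. (\<delta> i)\<^sup>2)" by (simp add: L2_set_def sum_nonneg)
  also have "\<dots> = (\<Sum>i\<in>I. (\<delta> i)\<^sup>2)"
    by (rule sum_partition[OF assms, symmetric])
  finally show ?thesis .
qed

text \<open>The hypotheses on \<open>\<delta>\<close> describe the cone in which the Lasso error lies.\<close>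

lemma cone_support_bound:
  fixes u \<delta> :: "nat \<Rightarrow> real"
  assumes fin: "finite I" and P: "partition_on I P" and s: "s \<ge> 1" and sg: "0 < sg" "sg \<le> card P"
    and L: "L \<ge> 0" and D: "D \<ge> 0"
    and d2: "L2_set \<delta> I \<le> D"
    and d1: "(\<Sum>i\<in>I. \<bar>\<delta> i\<bar>) \<le> L * sqrt s * D"
    and dg: "(\<Sum>g\<in>P. L2_set \<delta> g) \<le> L * sqrt (real sg) * D"
    and H: "\<And>w. w \<in> int_net P s sg \<Longrightarrow> (\<Sum>i\<in>I. real_of_int (w i) * u i) \<le> s * a"
  shows "(\<Sum>i\<in>I. u i * \<delta> i) \<le> (1 + 2 * L) * D * sqrt s * a"
proof -
  have PI: "\<Union>P = I" using P by (simp add: partition_on_def)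
  have finP: "finite P" using P fin by (rule finite_elements[rotated])
  \<comment> \<open>The zero direction lies in the net, which forces the level \<open>a\<close> to
    be nonnegative.\<close>
  have "(\<lambda>_. 0) \<in> int_net P s sg" using s by (auto simp: int_net_def)
  from H[OF this] s have a: "a \<ge> 0" by (simp add: zero_le_mult_iff)
  define h where "h g = L2_set (\<lambda>i. soft_threshold a (u i)) g" for g
  obtain G where G: "G \<subseteq> P" "card G = sg" "\<forall>g\<in>G. \<forall>g'\<in>P - G. h g' \<le> h g"
    using top_subset[OF finP sg(2), of h] by blast
  have finG: "finite G" using G finP finite_subset by blast
  have GI: "\<Union>G \<subseteq> I" using G PI by blast
  then have finUG: "finite (\<Union>G)" using fin finite_subset by blast
  have pG: "partition_on (\<Union>G) G" using P G(1)
    by (auto simp: partition_on_def disjoint_def)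
  have hU: "L2_set (\<lambda>i. soft_threshold a (u i)) (\<Union>G) \<le> sqrt s * a"
  proof (rule soft_threshold_rounding[OF finUG s a])
    fix w :: "nat \<Rightarrow> int"
    assume w0: "\<And>i. i \<notin> \<Union> G \<Longrightarrow> w i = 0" and ws: "(\<Sum>i\<in>\<Union> G. (real_of_int (w i))\<^sup>2) \<le> 4 * s"
    have e: "(\<Sum>i\<in>I. f i) = (\<Sum>i\<in>\<Union>G. f i)" if "\<And>i. w i = 0 \<Longrightarrow> f i = 0" for f :: "nat \<Rightarrow> real"
      using fin GI w0 that by (intro sum.mono_neutral_right) auto
    have "{g \<in> P. \<exists>i\<in>g. w i \<noteq> 0} \<subseteq> G"
    proof
      fix g assume g: "g \<in> {g \<in> P. \<exists>i\<in>g. w i \<noteq> 0}"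
      then obtain i where i: "i \<in> g" "w i \<noteq> 0" by auto
      then obtain g' where "g' \<in> G" "i \<in> g'" using w0 by blast
      then have "g' = g" using P g i G(1) by (auto simp: partition_on_def disjoint_def)
      then show "g \<in> G" using \<open>g' \<in> G\<close> by simp
    qed
    then have "card {g \<in> P. \<exists>i\<in>g. w i \<noteq> 0} \<le> sg" using G(2) finG card_mono by blast
    moreover have "w i = 0" if "i \<notin> I" for i using that w0 GI by blast
    ultimately have "w \<in> int_net P s sg" using ws e[of "\<lambda>i. (real_of_int (w i))\<^sup>2"] by (auto simp: int_net_def PI)
    from H[OF this] show "(\<Sum>i\<in>\<Union> G. real_of_int (w i) * u i) \<le> s * a"
      using e[of "\<lambda>i. real_of_int (w i) * u i"] by simp
  qed
  define M where "M = sqrt s * a"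
  have M0: "M \<ge> 0" using a s by (simp add: M_def)
  have hsum: "(\<Sum>g\<in>G. (h g)\<^sup>2) \<le> M\<^sup>2"
  proof -
    have "(\<Sum>g\<in>G. (h g)\<^sup>2) = (L2_set (\<lambda>i. soft_threshold a (u i)) (\<Union>G))\<^sup>2"
      unfolding h_def by (subst sum_squares_groups[OF finUG pG]) (simp add: L2_set_def sum_nonneg)
    also have "\<dots> \<le> M\<^sup>2" unfolding M_def using hU by (intro power_mono) auto
    finally show ?thesis .
  qed
  have h0: "h g \<ge> 0" for g by (simp add: h_def)
  \<comment> \<open>A group left out of \<open>G\<close> has a norm no larger than any of the
    \<open>sg\<close> norms in \<open>G\<close>, whose squares sum to at most
    \<open>M\<^sup>2\<close>.\<close>
  have hrest: "h g \<le> M / sqrt (real sg)" if "g \<in> P - G" for g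
  proof -
    have "real sg * (h g)\<^sup>2 = (\<Sum>g'\<in>G. (h g)\<^sup>2)" using G by simp
    also have "\<dots> \<le> (\<Sum>g'\<in>G. (h g')\<^sup>2)" using G(3) that h0 by (intro sum_mono power_mono) auto
    also have "\<dots> \<le> M\<^sup>2" by (rule hsum)
    finally have "(h g)\<^sup>2 \<le> (M / sqrt (real sg))\<^sup>2" using sg by (simp add: power_divide field_simps)
    then show ?thesis by (rule power2_le_imp_le) (use M0 in auto)
  qed
  have "(\<Sum>i\<in>I. u i * \<delta> i) \<le> a * (\<Sum>i\<in>I. \<bar>\<delta> i\<bar>) + (\<Sum>g\<in>P. h g * L2_set \<delta> g)"
    unfolding h_def by (rule threshold_dual_bound[OF fin P a])
  \<comment> \<open>Groups outside \<open>G\<close> pay through the l1,2 norm of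
    \<open>\<delta>\<close> and contribute \<open>L * D * M\<close>; those in \<open>G\<close> are
    summed by Cauchy-Schwarz and contribute \<open>D * M\<close>. Together with
    \<open>L * D * M\<close> from the l1 part this gives the factor
    \<open>1 + 2 * L\<close>.\<close>
  also have "(\<Sum>g\<in>P. h g * L2_set \<delta> g) = (\<Sum>g\<in>P - G. h g * L2_set \<delta> g) + (\<Sum>g\<in>G. h g * L2_set \<delta> g)"
    by (rule sum.subset_diff[OF G(1) finP])
  also have "(\<Sum>g\<in>P - G. h g * L2_set \<delta> g) \<le> (\<Sum>g\<in>P - G. M / sqrt (real sg) * L2_set \<delta> g)"
    by (intro sum_mono mult_right_mono hrest) auto
  also have "\<dots> \<le> (\<Sum>g\<in>P. M / sqrt (real sg) * L2_set \<delta> g)"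
    using finP M0 by (intro sum_mono2) auto
  also have "\<dots> \<le> M / sqrt (real sg) * (L * sqrt (real sg) * D)"
    unfolding sum_distrib_left[symmetric] using M0 by (intro mult_left_mono dg) auto
  also have "\<dots> = L * D * M" using sg by simp
  also have "(\<Sum>g\<in>G. h g * L2_set \<delta> g) \<le> L2_set h G * L2_set (L2_set \<delta>) G"
    using L2_set_mult_ineq[of h "L2_set \<delta>" G] by (simp add: h0)
  also have "\<dots> \<le> M * D"
  proof (rule mult_mono)
    show "L2_set h G \<le> M" unfolding L2_set_def using hsum M0 by (metis real_le_lsqrt sum_nonneg zero_le_power2 h0 real_sqrt_le_iff real_sqrt_unique)
    have "(\<Sum>g\<in>G. (L2_set \<delta> g)\<^sup>2) \<le> (\<Sum>g\<in>P. (L2_set \<delta> g)\<^sup>2)" using finP G(1) by (intro sum_mono2) auto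
    also have "\<dots> = (\<Sum>i\<in>I. (\<delta> i)\<^sup>2)" by (rule sum_squares_groups[OF fin P])
    finally have "L2_set (L2_set \<delta>) G \<le> L2_set \<delta> I" by (simp add: L2_set_def)
    then show "L2_set (L2_set \<delta>) G \<le> D" using d2 by simp
  qed (use M0 in auto)
  also have "a * (\<Sum>i\<in>I. \<bar>\<delta> i\<bar>) \<le> a * (L * sqrt s * D)" using a d1 by (intro mult_left_mono) auto
  finally show ?thesis by (simp add: M_def algebra_simps)
qed

lemma cone_quadratic_form_bound:
  fixes B :: "nat \<Rightarrow> nat \<Rightarrow> real"
  assumes fin: "finite I" and P: "partition_on I P" and s: "s \<ge> 1" and sg: "0 < sg" "sg \<le> card P"
    and L: "L \<ge> 0" and D: "D \<ge> 0"
    and d2: "L2_set \<delta> I \<le> D"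
    and d1: "(\<Sum>i\<in>I. \<bar>\<delta> i\<bar>) \<le> L * sqrt s * D"
    and dg: "(\<Sum>g\<in>P. L2_set \<delta> g) \<le> L * sqrt (real sg) * D"
    and H: "\<And>w w'. \<lbrakk>w \<in> int_net P s sg; w' \<in> int_net P s sg\<rbrakk> \<Longrightarrow>
       (\<Sum>i\<in>I. \<Sum>j\<in>I. real_of_int (w i) * B i j * real_of_int (w' j)) \<le> s * \<rho>"
  shows "(\<Sum>i\<in>I. \<Sum>j\<in>I. \<delta> i * B i j * \<delta> j) \<le> (1 + 2 * L)\<^sup>2 * D\<^sup>2 * \<rho>"
proof -
  note cone = cone_support_bound[OF fin P s sg L D d2 d1 dg]
  \<comment> \<open>With \<open>w\<close> fixed, the cone bound is applied in the second argument.
    Its result is rewritten as \<open>s\<close> times a level, which is the hypothesis needed to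
    apply it again in the first argument.\<close>
  have "(\<Sum>i\<in>I. real_of_int (w i) * (\<Sum>j\<in>I. B i j * \<delta> j)) \<le> s * ((1 + 2 * L) * D * \<rho> / sqrt s)"
    if w: "w \<in> int_net P s sg" for w
  proof -
    have "(\<Sum>i\<in>I. real_of_int (w i) * (\<Sum>j\<in>I. B i j * \<delta> j)) = (\<Sum>j\<in>I. (\<Sum>i\<in>I. real_of_int (w i) * B i j) * \<delta> j)"
      by (subst sum_swap_bilinear[symmetric]) (simp add: sum_distrib_left mult.assoc)
    also have "\<dots> \<le> (1 + 2 * L) * D * sqrt s * \<rho>"
    proof (rule cone)
      fix w' assume "w' \<in> int_net P s sg"
      have "(\<Sum>j\<in>I. real_of_int (w' j) * (\<Sum>i\<in>I. real_of_int (w i) * B i j)) =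
            (\<Sum>i\<in>I. \<Sum>j\<in>I. real_of_int (w i) * B i j * real_of_int (w' j))"
        by (subst sum_swap_bilinear) (simp add: mult.commute)
      also have "\<dots> \<le> s * \<rho>" by (rule H) fact+
      finally show "(\<Sum>j\<in>I. real_of_int (w' j) * (\<Sum>i\<in>I. real_of_int (w i) * B i j)) \<le> s * \<rho>" .
    qed
    also have "\<dots> = s * ((1 + 2 * L) * D * \<rho> / sqrt s)" using s by (simp add: field_simps)
    finally show ?thesis .
  qed
  from cone[OF this]
  have "(\<Sum>i\<in>I. (\<Sum>j\<in>I. B i j * \<delta> j) * \<delta> i) \<le> (1 + 2 * L) * D * sqrt s * ((1 + 2 * L) * D * \<rho> / sqrt s)" .
  also have "\<dots> = (1 + 2 * L)\<^sup>2 * D\<^sup>2 * \<rho>" using s by (simp add: power2_eq_square)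
  also have "(\<Sum>i\<in>I. (\<Sum>j\<in>I. B i j * \<delta> j) * \<delta> i) = (\<Sum>i\<in>I. \<Sum>j\<in>I. \<delta> i * B i j * \<delta> j)"
    by (simp add: sum_distrib_left mult.commute mult.left_commute)
  finally show ?thesis .
qed

section \<open>Counting integer vectors\<close>

text \<open>A nonzero vector of l1 norm at most \<open>N + 1\<close> becomes one of norm at most
  \<open>N\<close> after a signed unit vector is subtracted. So each unit of norm costs a factor of
  \<open>2 * card G + 1\<close> choices, the zero step included.\<close>

lemma card_int_vectors_L1:
  assumes fin: "finite G"
  shows "finite {w :: nat \<Rightarrow> int. (\<forall>i. i \<notin> G \<longrightarrow> w i = 0) \<and> (\<Sum>i\<in>G. \<bar>w i\<bar>) \<le> int N} \<and>
    card {w :: nat \<Rightarrow> int. (\<forall>i. i \<notin> G \<longrightarrow> w i = 0) \<and> (\<Sum>i\<in>G. \<bar>w i\<bar>) \<le> int N} \<le> (2 * card G + 1) ^ N"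
proof (induction N)
  case 0
  have "{w :: nat \<Rightarrow> int. (\<forall>i. i \<notin> G \<longrightarrow> w i = 0) \<and> (\<Sum>i\<in>G. \<bar>w i\<bar>) \<le> int 0} \<subseteq> {\<lambda>_. 0}"
  proof
    fix w :: "nat \<Rightarrow> int"
    assume w: "w \<in> {w. (\<forall>i. i \<notin> G \<longrightarrow> w i = 0) \<and> (\<Sum>i\<in>G. \<bar>w i\<bar>) \<le> int 0}"
    then have "(\<Sum>i\<in>G. \<bar>w i\<bar>) = 0" by (simp add: sum_nonneg antisym)
    then have "\<forall>i\<in>G. w i = 0" using fin by (simp add: sum_nonneg_eq_0_iff)
    then show "w \<in> {\<lambda>_. 0}" using w by auto
  qed
  note sub = this
  show ?case using finite_subset[OF sub] card_mono[OF _ sub] by simp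
next
  case (Suc N)
  define W where "W N = {w :: nat \<Rightarrow> int. (\<forall>i. i \<notin> G \<longrightarrow> w i = 0) \<and> (\<Sum>i\<in>G. \<bar>w i\<bar>) \<le> int N}" for N
  define E where "E = insert (\<lambda>_. 0) ((\<lambda>(i, e) j. if j = i then e else 0) ` (G \<times> {1, -1 :: int}))"
  have finE: "finite E" using fin by (simp add: E_def)
  have cE: "card E \<le> 2 * card G + 1"
  proof -
    have "card E \<le> Suc (card ((\<lambda>(i, e) (j::nat). if j = i then e else 0) ` (G \<times> {1, -1 :: int})))"
      unfolding E_def by (rule card_insert_le_m1[THEN le_trans]) auto
    also have "\<dots> \<le> Suc (card (G \<times> {1, -1 :: int}))" using fin by (intro Suc_le_mono[THEN iffD2] card_image_le) auto
    finally show ?thesis by (simp add: card_cartesian_product)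
  qed
  have "W (Suc N) \<subseteq> (\<lambda>(w, e) j. w j + e j) ` (W N \<times> E)"
  proof
    fix w assume w: "w \<in> W (Suc N)"
    show "w \<in> (\<lambda>(w, e) j. w j + e j) ` (W N \<times> E)"
    proof (cases "\<exists>i\<in>G. w i \<noteq> 0")
      case False
      then have "w = (\<lambda>_. 0)" using w by (auto simp: W_def)
      moreover have "(\<lambda>_. 0) \<in> W N" by (simp add: W_def)
      ultimately show ?thesis by (intro image_eqI[of _ _ "(\<lambda>_. 0, \<lambda>_. 0)"]) (auto simp: E_def)
    next
      case True
      then obtain i where i: "i \<in> G" "w i \<noteq> 0" by blast
      define e :: "nat \<Rightarrow> int" where "e = (\<lambda>j. if j = i then sgn (w i) else 0)"
      have "e \<in> E" unfolding E_def e_def using i by (intro insertI2 image_eqI[of _ _ "(i, sgn (w i))"]) (auto simp: sgn_if)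
      moreover have "(\<lambda>j. w j - e j) \<in> W N"
      proof -
        have "(\<Sum>j\<in>G. \<bar>w j - e j\<bar>) = \<bar>w i - sgn (w i)\<bar> + (\<Sum>j\<in>G - {i}. \<bar>w j\<bar>)"
          using i fin by (subst sum.remove[OF fin i(1)]) (auto simp: e_def intro!: sum.cong)
        also have "\<bar>w i - sgn (w i)\<bar> = \<bar>w i\<bar> - 1" using i by (auto simp: sgn_if)
        also have "\<dots> + (\<Sum>j\<in>G - {i}. \<bar>w j\<bar>) = (\<Sum>j\<in>G. \<bar>w j\<bar>) - 1"
          using i fin by (subst sum.remove[OF fin i(1)]) auto
        finally show ?thesis using w i by (auto simp: W_def e_def)
      qed
      ultimately show ?thesis by (intro image_eqI[of _ _ "(\<lambda>j. w j - e j, e)"]) auto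
    qed
  qed
  moreover have "finite (W N \<times> E)" using Suc finE by (simp add: W_def)
  ultimately have "finite (W (Suc N))" "card (W (Suc N)) \<le> card (W N \<times> E)"
    by (meson finite_surj, meson surj_card_le)
  moreover have "card (W N \<times> E) \<le> (2 * card G + 1) ^ N * (2 * card G + 1)"
    unfolding card_cartesian_product using Suc cE by (intro mult_mono) (auto simp: W_def)
  ultimately show ?case by (simp add: W_def mult.commute)
qed

text \<open>Integers satisfy \<open>\<bar>x\<bar> \<le> x\<^sup>2\<close>, so the l1 norm of an
  integer vector is at most its squared l2 norm.\<close>

lemma card_int_vectors_L2:
  assumes fin: "finite G" and q: "q \<le> real N"
  defines "W \<equiv> {w :: nat \<Rightarrow> int. (\<forall>i. i \<notin> G \<longrightarrow> w i = 0) \<and> (\<Sum>i\<in>G. (real_of_int (w i))\<^sup>2) \<le> q}"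
  shows "finite W" "card W \<le> (2 * card G + 1) ^ N"
proof -
  define V where "V = {w :: nat \<Rightarrow> int. (\<forall>i. i \<notin> G \<longrightarrow> w i = 0) \<and> (\<Sum>i\<in>G. \<bar>w i\<bar>) \<le> int N}"
  have sub: "W \<subseteq> V"
  proof
    fix w assume w: "w \<in> W"
    have "\<bar>x\<bar> \<le> x\<^sup>2" for x :: int
      using mult_left_mono[of 1 "\<bar>x\<bar>" "\<bar>x\<bar>"] by (cases "x = 0") (auto simp: power2_eq_square)
    then have "(\<Sum>i\<in>G. \<bar>w i\<bar>) \<le> (\<Sum>i\<in>G. (w i)\<^sup>2)" by (intro sum_mono)
    moreover have "real_of_int (\<Sum>i\<in>G. (w i)\<^sup>2) \<le> real N" using w q by (simp add: W_def)
    ultimately have "(\<Sum>i\<in>G. \<bar>w i\<bar>) \<le> int N" by linarith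
    then show "w \<in> V" using w by (simp add: V_def W_def)
  qed
  have V: "finite V" "card V \<le> (2 * card G + 1) ^ N"
    unfolding V_def using card_int_vectors_L1[OF fin, of N] by simp_all
  show "finite W" using sub V(1) by (rule finite_subset)
  show "card W \<le> (2 * card G + 1) ^ N" using card_mono[OF V(1) sub] V(2) by linarith
qed

text \<open>The classical bound \<open>(e d / k) ^ k\<close>: for \<open>j \<le> k\<close> the
  weight \<open>(k / d) ^ j * (d / k) ^ k\<close> is at least one, and the weighted binomial
  coefficients sum to \<open>(1 + k / d) ^ d * (d / k) ^ k\<close>.\<close>

lemma card_small_subsets:
  assumes fin: "finite P" and k: "0 < k" "k \<le> card P"
  shows "real (card {\<Omega>. \<Omega> \<subseteq> P \<and> card \<Omega> \<le> k}) \<le> exp (real k * ln (exp 1 * real (card P) / real k))"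
proof -
  define d where "d = card P"
  have d: "0 < d" "k \<le> d" using k by (auto simp: d_def)
  have "{\<Omega>. \<Omega> \<subseteq> P \<and> card \<Omega> \<le> k} = (\<Union>j\<le>k. {\<Omega>. \<Omega> \<subseteq> P \<and> card \<Omega> = j})" by auto
  then have "card {\<Omega>. \<Omega> \<subseteq> P \<and> card \<Omega> \<le> k} \<le> (\<Sum>j\<le>k. card {\<Omega>. \<Omega> \<subseteq> P \<and> card \<Omega> = j})"
    by (simp add: card_UN_le)
  also have "\<dots> = (\<Sum>j\<le>k. d choose j)" using fin by (simp add: n_subsets d_def)
  finally have "real (card {\<Omega>. \<Omega> \<subseteq> P \<and> card \<Omega> \<le> k}) \<le> (\<Sum>j\<le>k. real (d choose j))"
    by (metis of_nat_le_iff of_nat_sum)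
  also have "\<dots> \<le> (\<Sum>j\<le>k. real (d choose j) * ((real k / real d) ^ j * (real d / real k) ^ k))"
  proof (rule sum_mono)
    fix j assume j: "j \<in> {..k}"
    have "(real k / real d) ^ j * (real d / real k) ^ j = 1"
      using d k by (simp flip: power_mult_distrib)
    moreover have "(real d / real k) ^ j \<le> (real d / real k) ^ k"
      using d k j by (intro power_increasing) auto
    ultimately have "1 \<le> (real k / real d) ^ j * (real d / real k) ^ k"
      by (metis mult_left_mono of_nat_0_le_iff zero_le_divide_iff zero_le_power)
    then show "real (d choose j) \<le> real (d choose j) * ((real k / real d) ^ j * (real d / real k) ^ k)"
      by (metis mult_left_mono mult.right_neutral of_nat_0_le_iff)
  qed
  also have "\<dots> \<le> (\<Sum>j\<le>d. real (d choose j) * ((real k / real d) ^ j * (real d / real k) ^ k))"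
    using d by (intro sum_mono2) auto
  also have "\<dots> = (real k / real d + 1) ^ d * (real d / real k) ^ k"
    by (simp add: binomial_ring sum_distrib_right mult.assoc)
  also have "\<dots> \<le> exp (real k) * (real d / real k) ^ k"
  proof (rule mult_right_mono)
    have "(real k / real d + 1) ^ d \<le> exp (real k / real d) ^ d"
      using exp_ge_add_one_self[of "real k / real d"] by (intro power_mono) (auto simp: add.commute)
    then show "(real k / real d + 1) ^ d \<le> exp (real k)" using d by (simp flip: exp_of_nat_mult)
  qed simp
  also have "\<dots> = exp (real k * ln (exp 1 * real d / real k))"
  proof -
    have "ln (exp 1 * real d / real k) = 1 + ln (real d / real k)" using d k by (simp add: ln_mult ln_div)
    then have "exp (real k * ln (exp 1 * real d / real k)) = exp (real k) * exp (real k * ln (real d / real k))"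
      by (simp add: distrib_left exp_add)
    also have "exp (real k * ln (real d / real k)) = (real d / real k) ^ k"
      using d k by (simp add: exp_of_nat_mult)
    finally show ?thesis by simp
  qed
  finally show ?thesis by (simp add: d_def)
qed

text \<open>The right side is \<open>(e x)\<^sup>2\<close>; this form turns counts into exponents
  built from the logarithms in \<open>complexity\<close>.\<close>

lemma two_n_plus_one_le:
  fixes x :: real
  assumes "1 \<le> x"
  shows "2 * x + 1 \<le> exp (2 * ln (exp 1 * x))"
proof -
  have "2 * x + 1 \<le> 4 * (x * x)" using assms mult_left_mono[of 1 x x] by linarith
  also have "(4::real) \<le> exp 1 * exp 1" using mult_mono[of 2 "exp 1" 2 "exp (1::real)"] exp_ge_add_one_self[of 1] by simp
  then have "4 * (x * x) \<le> exp 1 * exp 1 * (x * x)" by (intro mult_right_mono) auto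
  also have "\<dots> = exp (2 * ln (exp 1 * x))"
    using assms by (simp add: exp_double power2_eq_square)
  finally show ?thesis .
qed

text \<open>A net vector is determined by at most \<open>sg\<close> active groups and an integer
  vector of squared norm at most \<open>4 * s\<close> on their at most \<open>sg * b\<close>
  coordinates. The \<open>8\<close> is the power \<open>4 * s\<close> times the \<open>2\<close> of
  \<open>two_n_plus_one_le\<close>.\<close>

lemma card_int_net:
  assumes fin: "finite I" and P: "partition_on I P" and sg: "0 < sg" "sg \<le> card P"
    and b: "\<And>g. g \<in> P \<Longrightarrow> card g \<le> b" and b1: "1 \<le> b"
  shows "finite (int_net P (real s) sg)"
    "real (card (int_net P (real s) sg)) \<le>
       exp (8 * real s * ln (exp 1 * real sg * real b) + real sg * ln (exp 1 * real (card P) / real sg))"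
proof -
  have PI: "\<Union>P = I" using P by (simp add: partition_on_def)
  have finP: "finite P" using P fin by (rule finite_elements[rotated])
  define F where "F = {\<Omega>. \<Omega> \<subseteq> P \<and> card \<Omega> \<le> sg}"
  have finF: "finite F" using finP by (simp add: F_def)
  define W where "W \<Omega> = {w :: nat \<Rightarrow> int. (\<forall>i. i \<notin> \<Union>\<Omega> \<longrightarrow> w i = 0) \<and> (\<Sum>i\<in>\<Union>\<Omega>. (real_of_int (w i))\<^sup>2) \<le> 4 * real s}" for \<Omega>
  have finU: "finite (\<Union>\<Omega>)" if "\<Omega> \<in> F" for \<Omega>
    by (rule finite_subset[OF _ fin]) (use that PI in \<open>auto simp: F_def\<close>)
  have W: "finite (W \<Omega>)" "card (W \<Omega>) \<le> (2 * (sg * b) + 1) ^ (4 * s)" if "\<Omega> \<in> F" for \<Omega>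
  proof -
    have "card (\<Union>\<Omega>) \<le> (\<Sum>g\<in>\<Omega>. card g)" by (rule card_Union_le_sum_card)
    also have "\<dots> \<le> (\<Sum>g\<in>\<Omega>. b)" using that b by (intro sum_mono) (auto simp: F_def)
    also have "\<dots> \<le> sg * b" using that by (auto simp: F_def)
    finally have "(2 * card (\<Union>\<Omega>) + 1) ^ (4 * s) \<le> (2 * (sg * b) + 1) ^ (4 * s)" by (intro power_mono) auto
    then show "card (W \<Omega>) \<le> (2 * (sg * b) + 1) ^ (4 * s)"
      using card_int_vectors_L2(2)[OF finU[OF that], of "4 * real s" "4 * s"] by (simp add: W_def)
    show "finite (W \<Omega>)" using card_int_vectors_L2(1)[OF finU[OF that], of "4 * real s" "4 * s"] by (simp add: W_def)
  qed
  have sub: "int_net P (real s) sg \<subseteq> (\<Union>\<Omega>\<in>F. W \<Omega>)"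
  proof
    fix w assume w: "w \<in> int_net P (real s) sg"
    define \<Omega> where "\<Omega> = {g \<in> P. \<exists>i\<in>g. w i \<noteq> 0}"
    have "\<Omega> \<in> F" using w by (auto simp: F_def \<Omega>_def int_net_def)
    have z: "w i = 0" if "i \<notin> \<Union>\<Omega>" for i
      using that w by (cases "i \<in> \<Union>P") (auto simp: \<Omega>_def int_net_def)
    have "(\<Sum>i\<in>\<Union>\<Omega>. (real_of_int (w i))\<^sup>2) \<le> (\<Sum>i\<in>\<Union>P. (real_of_int (w i))\<^sup>2)"
      using fin PI by (intro sum_mono2) (auto simp: \<Omega>_def)
    then have "w \<in> W \<Omega>" using z w by (auto simp: W_def int_net_def)
    then show "w \<in> (\<Union>\<Omega>\<in>F. W \<Omega>)" using \<open>\<Omega> \<in> F\<close> by blast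
  qed
  have finUW: "finite (\<Union>\<Omega>\<in>F. W \<Omega>)" using finF W(1) by blast
  show "finite (int_net P (real s) sg)" using sub finUW by (rule finite_subset)
  have "card (int_net P (real s) sg) \<le> card (\<Union>\<Omega>\<in>F. W \<Omega>)" by (rule card_mono[OF finUW sub])
  also have "\<dots> \<le> (\<Sum>\<Omega>\<in>F. card (W \<Omega>))" by (rule card_UN_le[OF finF])
  also have "\<dots> \<le> (\<Sum>\<Omega>\<in>F. (2 * (sg * b) + 1) ^ (4 * s))" by (intro sum_mono W(2))
  also have "\<dots> = card F * (2 * (sg * b) + 1) ^ (4 * s)" by simp
  finally have "real (card (int_net P (real s) sg)) \<le> real (card F) * (2 * (real sg * real b) + 1) ^ (4 * s)"
    by (metis (mono_tags, lifting) of_nat_1 of_nat_add of_nat_le_iff of_nat_mult of_nat_numeral of_nat_power)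
  also have "\<dots> \<le> exp (real sg * ln (exp 1 * real (card P) / real sg)) * exp (2 * ln (exp 1 * (real sg * real b))) ^ (4 * s)"
  proof (intro mult_mono power_mono two_n_plus_one_le)
    show "real (card F) \<le> exp (real sg * ln (exp 1 * real (card P) / real sg))"
      unfolding F_def by (rule card_small_subsets[OF finP sg])
    have "1 * 1 \<le> real sg * real b" using sg b1 by (intro mult_mono) auto
    then show "1 \<le> real sg * real b" by simp
  qed auto
  also have "\<dots> = exp (8 * real s * ln (exp 1 * real sg * real b) + real sg * ln (exp 1 * real (card P) / real sg))"
    by (simp add: exp_add mult.assoc flip: exp_of_nat_mult)
  finally show "real (card (int_net P (real s) sg)) \<le> \<dots>" .
qed

lemma card_int_vectors_group:
  assumes fin: "finite g" and b: "card g \<le> b" "1 \<le> b" and r: "r \<ge> 0"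
  defines "W \<equiv> {w :: nat \<Rightarrow> int. (\<forall>i. i \<notin> g \<longrightarrow> w i = 0) \<and> (\<Sum>i\<in>g. (real_of_int (w i))\<^sup>2) \<le> 4 * r}"
  shows "finite W" "real (card W) \<le> exp (8 * r * ln (exp 1 * real b))"
proof -
  define N where "N = nat \<lfloor>4 * r\<rfloor>"
  have N: "real N \<le> 4 * r" using r by (simp add: N_def)
  \<comment> \<open>\<open>r\<close> need not be an integer, but the squared norm of an integer
    vector is one, so the bound \<open>4 * r\<close> may be rounded down.\<close>
  have e: "(\<Sum>i\<in>g. (real_of_int (w i))\<^sup>2) \<le> 4 * r \<longleftrightarrow> (\<Sum>i\<in>g. (real_of_int (w i))\<^sup>2) \<le> real N" for w :: "nat \<Rightarrow> int"
  proof -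
    have "(\<Sum>i\<in>g. (real_of_int (w i))\<^sup>2) = real_of_int (\<Sum>i\<in>g. (w i)\<^sup>2)" by simp
    also have "real_of_int (\<Sum>i\<in>g. (w i)\<^sup>2) \<le> 4 * r \<longleftrightarrow> real_of_int (\<Sum>i\<in>g. (w i)\<^sup>2) \<le> real N"
      using r unfolding N_def by (simp add: le_floor_iff[symmetric] del: of_int_sum)
    finally show ?thesis by simp
  qed
  have W: "W = {w :: nat \<Rightarrow> int. (\<forall>i. i \<notin> g \<longrightarrow> w i = 0) \<and> (\<Sum>i\<in>g. (real_of_int (w i))\<^sup>2) \<le> real N}"
    by (simp add: W_def e)
  show "finite W" unfolding W by (rule card_int_vectors_L2(1)[OF fin order_refl])
  have "card W \<le> (2 * card g + 1) ^ N" unfolding W by (rule card_int_vectors_L2(2)[OF fin order_refl])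
  also have "\<dots> \<le> (2 * b + 1) ^ N" using b by (intro power_mono) auto
  finally have "real (card W) \<le> (2 * real b + 1) ^ N"
    by (metis (mono_tags, lifting) of_nat_1 of_nat_add of_nat_le_iff of_nat_mult of_nat_numeral of_nat_power)
  also have "\<dots> \<le> exp (2 * ln (exp 1 * real b)) ^ N" using b by (intro power_mono two_n_plus_one_le) auto
  also have "\<dots> = exp (real N * (2 * ln (exp 1 * real b)))" by (simp flip: exp_of_nat_mult)
  also have "\<dots> \<le> exp (4 * r * (2 * ln (exp 1 * real b)))"
  proof -
    have "0 \<le> ln (exp 1 * real b)" using b by (simp add: ln_mult)
    then have "real N * (2 * ln (exp 1 * real b)) \<le> 4 * r * (2 * ln (exp 1 * real b))"
      using N by (intro mult_right_mono) auto
    then show ?thesis by simp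
  qed
  finally show "real (card W) \<le> exp (8 * r * ln (exp 1 * real b))" by (simp add: mult.assoc)
qed

section \<open>Deterministic Lasso bounds\<close>

text \<open>The dual norm inequality in the form used later: once for the noise and once for the
  residual of the debiasing constraint, both paired with the Lasso error.\<close>

lemma threshold_dual_bound_abs:
  fixes u \<delta> :: "nat \<Rightarrow> real"
  assumes fin: "finite I" and P: "partition_on I P" and a: "a \<ge> 0"
    and \<gamma>: "\<And>g. g \<in> P \<Longrightarrow> L2_set (\<lambda>i. soft_threshold a (u i)) g \<le> \<gamma>"
  shows "\<bar>\<Sum>i\<in>I. u i * \<delta> i\<bar> \<le> a * (\<Sum>i\<in>I. \<bar>\<delta> i\<bar>) + \<gamma> * (\<Sum>g\<in>P. L2_set \<delta> g)"
proof -
  have *: "(\<Sum>i\<in>I. u i * \<eta> i) \<le> a * (\<Sum>i\<in>I. \<bar>\<eta> i\<bar>) + \<gamma> * (\<Sum>g\<in>P. L2_set \<eta> g)" for \<eta> :: "nat \<Rightarrow> real"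
  proof -
    have "(\<Sum>i\<in>I. u i * \<eta> i) \<le> a * (\<Sum>i\<in>I. \<bar>\<eta> i\<bar>) +
           (\<Sum>g\<in>P. L2_set (\<lambda>i. soft_threshold a (u i)) g * L2_set \<eta> g)"
      by (rule threshold_dual_bound[OF fin P a])
    also have "(\<Sum>g\<in>P. L2_set (\<lambda>i. soft_threshold a (u i)) g * L2_set \<eta> g) \<le> (\<Sum>g\<in>P. \<gamma> * L2_set \<eta> g)"
      by (intro sum_mono mult_right_mono \<gamma>) auto
    finally show ?thesis by (simp add: sum_distrib_left)
  qed
  have "L2_set (\<lambda>i. - \<delta> i) g = L2_set \<delta> g" for g by (simp add: L2_set_def)
  with *[of \<delta>] *[of "\<lambda>i. - \<delta> i"] show ?thesis by (simp add: sum_negf abs_le_iff)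
qed

lemma L1_le_sqrt_card_L2:
  assumes "finite T" "real (card T) \<le> s" "T \<subseteq> I" "finite I"
  shows "(\<Sum>i\<in>T. \<bar>f i\<bar>) \<le> sqrt s * L2_set f I"
proof -
  have "(\<Sum>i\<in>T. \<bar>f i\<bar>) = (\<Sum>i\<in>T. \<bar>f i\<bar> * \<bar>1\<bar>)" by simp
  also have "\<dots> \<le> L2_set f T * L2_set (\<lambda>_. 1) T" by (rule L2_set_mult_ineq)
  also have "L2_set (\<lambda>_. 1) T = sqrt (real (card T))" by (simp add: L2_set_def)
  also have "L2_set f T * sqrt (real (card T)) \<le> L2_set f I * sqrt s"
  proof (intro mult_mono)
    show "L2_set f T \<le> L2_set f I" unfolding L2_set_def using assms by (intro real_sqrt_le_mono sum_mono2) auto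
  qed (use assms in auto)
  finally show ?thesis by (simp add: mult.commute)
qed

text \<open>The index \<open>j\<close> stands for a coordinate or for a group, so one argument
  serves both penalties. Off the support \<open>T\<close> of \<open>\<beta>\<close> the vectors
  \<open>b\<close> and \<open>\<delta>\<close> have equal norms; on \<open>T\<close> the triangle
  inequality applies.\<close>

lemma decomposable_penalty:
  fixes N :: "'b \<Rightarrow> (nat \<Rightarrow> real) \<Rightarrow> real"
  assumes fin: "finite J"
    and tri: "\<And>j. j \<in> T \<Longrightarrow> N j \<beta> \<le> N j b + N j \<delta>" and off: "\<And>j. j \<in> J - T \<Longrightarrow> N j \<beta> = 0 \<and> N j b = N j \<delta>"
    and T: "T \<subseteq> J"
  shows "(\<Sum>j\<in>J. N j \<beta>) - (\<Sum>j\<in>J. N j b) \<le> 2 * (\<Sum>j\<in>T. N j \<delta>) - (\<Sum>j\<in>J. N j \<delta>)"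
proof -
  have parts: "(\<Sum>j\<in>J. N j f) = (\<Sum>j\<in>J - T. N j f) + (\<Sum>j\<in>T. N j f)" for f
    by (rule sum.subset_diff[OF T fin])
  have "(\<Sum>j\<in>J - T. N j \<beta>) = 0" "(\<Sum>j\<in>J - T. N j b) = (\<Sum>j\<in>J - T. N j \<delta>)" using off by (auto intro!: sum.neutral sum.cong)
  moreover have "(\<Sum>j\<in>T. N j \<beta>) \<le> (\<Sum>j\<in>T. N j b) + (\<Sum>j\<in>T. N j \<delta>)"
    unfolding sum.distrib[symmetric] by (intro sum_mono tri)
  ultimately show ?thesis by (simp add: parts)
qed

lemma penalty_difference:
  fixes \<beta> b \<delta> :: "nat \<Rightarrow> real"
  assumes fin: "finite I" and P: "partition_on I P" and lam: "lam \<ge> 0" "lamg \<ge> 0" and b: "\<And>i. b i = \<beta> i + \<delta> i"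
  shows "(lam * (\<Sum>i\<in>I. \<bar>\<beta> i\<bar>) + lamg * (\<Sum>g\<in>P. L2_set \<beta> g)) - (lam * (\<Sum>i\<in>I. \<bar>b i\<bar>) + lamg * (\<Sum>g\<in>P. L2_set b g))
    \<le> 2 * (lam * (\<Sum>i\<in>{i\<in>I. \<beta> i \<noteq> 0}. \<bar>\<delta> i\<bar>) + lamg * (\<Sum>g\<in>{g\<in>P. \<exists>i\<in>g. \<beta> i \<noteq> 0}. L2_set \<delta> g))
       - (lam * (\<Sum>i\<in>I. \<bar>\<delta> i\<bar>) + lamg * (\<Sum>g\<in>P. L2_set \<delta> g))"
proof -
  have finP: "finite P" using P fin by (rule finite_elements[rotated])
  have tri: "L2_set \<beta> g \<le> L2_set b g + L2_set \<delta> g" for g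
  proof -
    have "L2_set (\<lambda>i. b i + - \<delta> i) g \<le> L2_set b g + L2_set (\<lambda>i. - \<delta> i) g" by (rule L2_set_triangle_ineq)
    moreover have "L2_set (\<lambda>i. - \<delta> i) g = L2_set \<delta> g" by (simp add: L2_set_def)
    ultimately show ?thesis by (simp add: b)
  qed
  have 1: "(\<Sum>i\<in>I. \<bar>\<beta> i\<bar>) - (\<Sum>i\<in>I. \<bar>b i\<bar>) \<le> 2 * (\<Sum>i\<in>{i\<in>I. \<beta> i \<noteq> 0}. \<bar>\<delta> i\<bar>) - (\<Sum>i\<in>I. \<bar>\<delta> i\<bar>)"
    by (rule decomposable_penalty[OF fin, where N="\<lambda>i f. \<bar>f i\<bar>"]) (auto simp: b)
  have 2: "(\<Sum>g\<in>P. L2_set \<beta> g) - (\<Sum>g\<in>P. L2_set b g) \<le>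
      2 * (\<Sum>g\<in>{g\<in>P. \<exists>i\<in>g. \<beta> i \<noteq> 0}. L2_set \<delta> g) - (\<Sum>g\<in>P. L2_set \<delta> g)"
  proof (rule decomposable_penalty[OF finP, where N="\<lambda>g f. L2_set f g"])
    fix g assume "g \<in> P - {g \<in> P. \<exists>i\<in>g. \<beta> i \<noteq> 0}"
    then have "\<forall>i\<in>g. \<beta> i = 0" by auto
    then show "L2_set \<beta> g = 0 \<and> L2_set b g = L2_set \<delta> g" by (simp add: L2_set_def b)
  qed (use tri in auto)
  from mult_left_mono[OF 1 lam(1)] mult_left_mono[OF 2 lam(2)] show ?thesis by (simp add: algebra_simps)
qed

text \<open>The ratio \<open>sqrt (s / sg)\<close> of the two penalty levels is what makes each term
  at most \<open>lam * sqrt s * L2_set \<delta> I\<close>.\<close>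

lemma sparse_penalty_le:
  fixes \<delta> :: "nat \<Rightarrow> real"
  assumes fin: "finite I" and P: "partition_on I P" and lam: "lam \<ge> 0" and s: "0 < s" "0 < sg"
    and T: "T \<subseteq> I" "card T \<le> s" and G: "G \<subseteq> P" "card G \<le> sg"
  shows "lam * (\<Sum>i\<in>T. \<bar>\<delta> i\<bar>) + sqrt (real s / real sg) * lam * (\<Sum>g\<in>G. L2_set \<delta> g) \<le> 2 * lam * sqrt (real s) * L2_set \<delta> I"
proof -
  have finP: "finite P" using P fin by (rule finite_elements[rotated])
  have "(\<Sum>i\<in>T. \<bar>\<delta> i\<bar>) \<le> sqrt (real s) * L2_set \<delta> I"
    using T fin finite_subset by (intro L1_le_sqrt_card_L2) auto
  then have 1: "lam * (\<Sum>i\<in>T. \<bar>\<delta> i\<bar>) \<le> lam * (sqrt (real s) * L2_set \<delta> I)" using lam by (rule mult_left_mono)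
  have "(\<Sum>g\<in>G. \<bar>L2_set \<delta> g\<bar>) \<le> sqrt (real sg) * L2_set (L2_set \<delta>) P"
    using G finP finite_subset by (intro L1_le_sqrt_card_L2) auto
  also have "L2_set (L2_set \<delta>) P = L2_set \<delta> I" using sum_squares_groups[OF fin P] by (simp add: L2_set_def)
  finally have "sqrt (real s / real sg) * lam * (\<Sum>g\<in>G. L2_set \<delta> g) \<le> sqrt (real s / real sg) * lam * (sqrt (real sg) * L2_set \<delta> I)"
    using lam by (intro mult_left_mono) auto
  also have "\<dots> = lam * (sqrt (real s) * L2_set \<delta> I)" using s by (simp add: real_sqrt_divide)
  finally show ?thesis using 1 by simp
qed

text \<open>\<open>A\<close> is the quadratic term and \<open>z\<close> the pairing of noise and
  error. The constant \<open>1 / 4\<close> lets \<open>2 * z\<close> consume only half of the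
  penalty of \<open>\<delta>\<close>; the other half is at most twice its part on the support. So
  the whole is at most four times that part, and \<open>8 = 4 * 2\<close>.\<close>

lemma lasso_cone:
  fixes \<beta> b \<delta> :: "nat \<Rightarrow> real"
  assumes fin: "finite I" and P: "partition_on I P" and lam: "lam > 0" and s: "0 < s" "0 < sg"
    and sp: "card {i\<in>I. \<beta> i \<noteq> 0} \<le> s" "card {g\<in>P. \<exists>i\<in>g. \<beta> i \<noteq> 0} \<le> sg"
    and b: "\<And>i. b i = \<beta> i + \<delta> i" and A: "A \<ge> 0"
    and lamg: "lamg = sqrt (real s / real sg) * lam"
    and basic: "A - 2 * z + (lam * (\<Sum>i\<in>I. \<bar>b i\<bar>) + lamg * (\<Sum>g\<in>P. L2_set b g)) \<le>
                lam * (\<Sum>i\<in>I. \<bar>\<beta> i\<bar>) + lamg * (\<Sum>g\<in>P. L2_set \<beta> g)"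
    and noise: "\<bar>z\<bar> \<le> 1 / 4 * (lam * (\<Sum>i\<in>I. \<bar>\<delta> i\<bar>) + lamg * (\<Sum>g\<in>P. L2_set \<delta> g))"
  shows "(\<Sum>i\<in>I. \<bar>\<delta> i\<bar>) \<le> 8 * sqrt (real s) * L2_set \<delta> I"
    "(\<Sum>g\<in>P. L2_set \<delta> g) \<le> 8 * sqrt (real sg) * L2_set \<delta> I"
proof -
  let ?T = "{i\<in>I. \<beta> i \<noteq> 0}" and ?G = "{g\<in>P. \<exists>i\<in>g. \<beta> i \<noteq> 0}"
  have lg: "lamg > 0" using lam s by (simp add: lamg)
  have "lam * (\<Sum>i\<in>I. \<bar>\<delta> i\<bar>) + lamg * (\<Sum>g\<in>P. L2_set \<delta> g) \<le>
     4 * (lam * (\<Sum>i\<in>?T. \<bar>\<delta> i\<bar>) + lamg * (\<Sum>g\<in>?G. L2_set \<delta> g))"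
    using penalty_difference[OF fin P, of lam lamg b \<beta> \<delta>] basic noise A lam lg b by (simp add: abs_le_iff)
  also have "\<dots> \<le> 8 * lam * sqrt (real s) * L2_set \<delta> I"
    using sparse_penalty_le[OF fin P _ s _ sp(1) _ sp(2), of lam \<delta>] lam by (simp add: lamg)
  finally have *: "lam * (\<Sum>i\<in>I. \<bar>\<delta> i\<bar>) + lamg * (\<Sum>g\<in>P. L2_set \<delta> g) \<le> 8 * lam * sqrt (real s) * L2_set \<delta> I" .
  have nn: "0 \<le> (\<Sum>i\<in>I. \<bar>\<delta> i\<bar>)" "0 \<le> (\<Sum>g\<in>P. L2_set \<delta> g)" by (auto intro: sum_nonneg)
  have "lam * (\<Sum>i\<in>I. \<bar>\<delta> i\<bar>) \<le> lam * (8 * sqrt (real s) * L2_set \<delta> I)"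
    using * mult_nonneg_nonneg[OF less_imp_le[OF lg] nn(2)] by (simp add: algebra_simps)
  then show "(\<Sum>i\<in>I. \<bar>\<delta> i\<bar>) \<le> 8 * sqrt (real s) * L2_set \<delta> I" using lam by simp
  have "lamg * (\<Sum>g\<in>P. L2_set \<delta> g) \<le> lam * (8 * sqrt (real s) * L2_set \<delta> I)"
    using * mult_nonneg_nonneg[OF less_imp_le[OF lam] nn(1)] by (simp add: algebra_simps)
  also have "\<dots> = lamg * (8 * sqrt (real sg) * L2_set \<delta> I)" using s by (simp add: lamg real_sqrt_divide)
  finally show "(\<Sum>g\<in>P. L2_set \<delta> g) \<le> 8 * sqrt (real sg) * L2_set \<delta> I" using lg by simp
qed

lemma lasso_rate:
  fixes \<beta> b \<delta> :: "nat \<Rightarrow> real"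
  assumes fin: "finite I" and P: "partition_on I P" and lam: "lam > 0" and s: "0 < s" "0 < sg"
    and b: "\<And>i. b i = \<beta> i + \<delta> i" and lamg: "lamg = sqrt (real s / real sg) * lam"
    and basic: "A - 2 * z + (lam * (\<Sum>i\<in>I. \<bar>b i\<bar>) + lamg * (\<Sum>g\<in>P. L2_set b g)) \<le>
                lam * (\<Sum>i\<in>I. \<bar>\<beta> i\<bar>) + lamg * (\<Sum>g\<in>P. L2_set \<beta> g)"
    and noise: "\<bar>z\<bar> \<le> \<tau> / 4 * (lam * (\<Sum>i\<in>I. \<bar>\<delta> i\<bar>) + lamg * (\<Sum>g\<in>P. L2_set \<delta> g))" and \<tau>: "\<tau> \<ge> 0"
    and L: "L \<ge> 0" and c1: "(\<Sum>i\<in>I. \<bar>\<delta> i\<bar>) \<le> L * sqrt (real s) * L2_set \<delta> I"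
    and cg: "(\<Sum>g\<in>P. L2_set \<delta> g) \<le> L * sqrt (real sg) * L2_set \<delta> I"
    and A: "A \<ge> \<mu> * (L2_set \<delta> I)\<^sup>2" and \<mu>: "\<mu> > 0"
  shows "lam * (\<Sum>i\<in>I. \<bar>\<delta> i\<bar>) + lamg * (\<Sum>g\<in>P. L2_set \<delta> g) \<le> (\<tau> / 2 + 1) * 4 * lam\<^sup>2 * L\<^sup>2 * real s / \<mu>"
proof -
  have lg: "lamg > 0" using lam s by (simp add: lamg)
  define D where "D = L2_set \<delta> I"
  have D0: "D \<ge> 0" by (simp add: D_def)
  define pen where "pen f = lam * (\<Sum>i\<in>I. \<bar>f i\<bar>) + lamg * (\<Sum>g\<in>P. L2_set f g)" for f :: "nat \<Rightarrow> real"
  have tri: "L2_set \<beta> g \<le> L2_set b g + L2_set \<delta> g" for g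
  proof -
    have "L2_set (\<lambda>i. b i + - \<delta> i) g \<le> L2_set b g + L2_set (\<lambda>i. - \<delta> i) g" by (rule L2_set_triangle_ineq)
    moreover have "L2_set (\<lambda>i. - \<delta> i) g = L2_set \<delta> g" by (simp add: L2_set_def)
    ultimately show ?thesis by (simp add: b)
  qed
  have "lam * (\<Sum>i\<in>I. \<bar>\<beta> i\<bar>) \<le> lam * ((\<Sum>i\<in>I. \<bar>b i\<bar>) + (\<Sum>i\<in>I. \<bar>\<delta> i\<bar>))"
    unfolding sum.distrib[symmetric] using lam by (intro mult_left_mono sum_mono) (auto simp: b)
  moreover have "lamg * (\<Sum>g\<in>P. L2_set \<beta> g) \<le> lamg * ((\<Sum>g\<in>P. L2_set b g) + (\<Sum>g\<in>P. L2_set \<delta> g))"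
    unfolding sum.distrib[symmetric] using lg tri by (intro mult_left_mono sum_mono) auto
  ultimately have "pen \<beta> \<le> pen b + pen \<delta>" by (simp add: pen_def distrib_left)
  then have "A \<le> (\<tau> / 2 + 1) * pen \<delta>"
    using basic noise unfolding pen_def[symmetric] by (simp add: abs_le_iff algebra_simps)
  then have 1: "\<mu> * D\<^sup>2 \<le> (\<tau> / 2 + 1) * pen \<delta>" using A by (simp add: D_def)
  have "pen \<delta> \<le> lam * (L * sqrt (real s) * D) + lamg * (L * sqrt (real sg) * D)"
    unfolding pen_def D_def using lam lg c1 cg by (intro add_mono mult_left_mono) auto
  also have "\<dots> = 2 * lam * L * sqrt (real s) * D" using s by (simp add: lamg real_sqrt_divide)
  finally have 2: "pen \<delta> \<le> 2 * lam * L * sqrt (real s) * D" .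
  have "\<mu> * D\<^sup>2 \<le> (\<tau> / 2 + 1) * (2 * lam * L * sqrt (real s) * D)"
    using 1 mult_left_mono[OF 2, of "\<tau> / 2 + 1"] \<tau> by linarith
  then have "D * (\<mu> * D) \<le> D * ((\<tau> / 2 + 1) * (2 * lam * L * sqrt (real s)))" by (simp add: power2_eq_square mult_ac)
  then have "\<mu> * D \<le> (\<tau> / 2 + 1) * (2 * lam * L * sqrt (real s))"
    using D0 lam L \<tau> by (cases "D = 0") auto
  then have 3: "D \<le> (\<tau> / 2 + 1) * (2 * lam * L * sqrt (real s)) / \<mu>" using \<mu> by (simp add: field_simps)
  have "pen \<delta> \<le> 2 * lam * L * sqrt (real s) * ((\<tau> / 2 + 1) * (2 * lam * L * sqrt (real s)) / \<mu>)"
    using order_trans[OF 2 mult_left_mono[OF 3, of "2 * lam * L * sqrt (real s)"]] lam L by simp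
  also have "\<dots> = (\<tau> / 2 + 1) * 4 * lam\<^sup>2 * L\<^sup>2 * (sqrt (real s))\<^sup>2 / \<mu>"
    unfolding power2_eq_square by (simp only: times_divide_eq_right mult_ac)
  finally show ?thesis by (simp add: pen_def)
qed

section \<open>Squares of sub-Gaussian variables\<close>

lemma nn_integral_normal_density: "0 < \<sigma> \<Longrightarrow> (\<integral>\<^sup>+x. ennreal (normal_density \<mu> \<sigma> x) \<partial>lborel) = 1"
  using prob_space.emeasure_space_1[OF prob_space_normal_density[of \<sigma> \<mu>]]
  by (simp add: emeasure_density)

text \<open>Completing the square: exponential tilting shifts the mean to \<open>c\<close>.\<close>

lemma normal_density_exp:
  "normal_density 0 1 x * exp (c * x) = exp (c\<^sup>2 / 2) * normal_density c 1 x"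
  by (simp add: normal_density_def power2_diff flip: exp_add) (simp add: field_simps power2_eq_square)

text \<open>Gaussian mixture: \<open>exp (h y\<^sup>2)\<close> is the average of \<open>exp (sqrt (2 h) y g)\<close> over a standard normal \<open>g\<close>.\<close>

lemma (in prob_space) nn_integral_exp_square_le_2:
  assumes Y[measurable]: "Y \<in> borel_measurable M" and \<tau>: "\<tau> > 0"
    and mgf: "\<And>\<theta>. (\<integral>\<^sup>+\<omega>. ennreal (exp (\<theta> * Y \<omega>)) \<partial>M) \<le> ennreal (exp (\<tau>\<^sup>2 * \<theta>\<^sup>2 / 2))"
    and h: "0 \<le> h" "h \<le> 3 / (8 * \<tau>\<^sup>2)"
  shows "(\<integral>\<^sup>+\<omega>. ennreal (exp (h * (Y \<omega>)\<^sup>2)) \<partial>M) \<le> 2"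
proof -
  define c where "c = sqrt (2 * h)"
  interpret P: pair_sigma_finite M lborel ..
  have "(\<integral>\<^sup>+\<omega>. ennreal (exp (h * (Y \<omega>)\<^sup>2)) \<partial>M) =
      (\<integral>\<^sup>+\<omega>. (\<integral>\<^sup>+g. ennreal (normal_density 0 1 g * exp ((c * Y \<omega>) * g)) \<partial>lborel) \<partial>M)"
    by (simp add: normal_density_exp ennreal_mult nn_integral_cmult nn_integral_normal_density
        power_mult_distrib c_def h)
  also have "\<dots> = (\<integral>\<^sup>+g. (\<integral>\<^sup>+\<omega>. ennreal (normal_density 0 1 g * exp ((c * Y \<omega>) * g)) \<partial>M) \<partial>lborel)"
    by (rule P.Fubini'[symmetric]) simp
  also have "\<dots> \<le> (\<integral>\<^sup>+g. ennreal (2 * normal_density 0 2 g) \<partial>lborel)"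
  proof (rule nn_integral_mono)
    fix g :: real
    have "(\<integral>\<^sup>+\<omega>. ennreal (normal_density 0 1 g * exp ((c * Y \<omega>) * g)) \<partial>M) =
          ennreal (normal_density 0 1 g) * (\<integral>\<^sup>+\<omega>. ennreal (exp ((c * g) * Y \<omega>)) \<partial>M)"
      by (simp add: ennreal_mult nn_integral_cmult mult_ac)
    also have "\<dots> \<le> ennreal (normal_density 0 1 g) * ennreal (exp (\<tau>\<^sup>2 * (c * g)\<^sup>2 / 2))"
      by (intro mult_left_mono mgf) auto
    also have "\<dots> \<le> ennreal (normal_density 0 1 g) * ennreal (exp (3 * g\<^sup>2 / 8))"
    proof (intro mult_left_mono ennreal_leI)
      have "\<tau>\<^sup>2 * (c * g)\<^sup>2 / 2 = (\<tau>\<^sup>2 * h) * g\<^sup>2" using h by (simp add: c_def power_mult_distrib)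
      also have "\<dots> \<le> (3 / 8) * g\<^sup>2" using h \<tau> by (intro mult_right_mono) (auto simp: field_simps)
      finally show "exp (\<tau>\<^sup>2 * (c * g)\<^sup>2 / 2) \<le> exp (3 * g\<^sup>2 / 8)" by simp
    qed auto
    also have "\<dots> = ennreal (normal_density 0 1 g * exp (3 * g\<^sup>2 / 8))" by (simp add: ennreal_mult)
    \<comment> \<open>The cap \<open>3 / (8 * \<tau>\<^sup>2)\<close> on \<open>h\<close> leaves the
      exponent \<open>- g\<^sup>2 / 8\<close>, that of a normal density with standard deviation
      \<open>2\<close>; the missing normalisation is the factor \<open>2\<close>.\<close>
    also have "normal_density 0 1 g * exp (3 * g\<^sup>2 / 8) = 2 * normal_density 0 2 g"
    proof -
      have "exp (- g\<^sup>2 / 2) * exp (3 * g\<^sup>2 / 8) = exp (- g\<^sup>2 / 8)" by (simp flip: exp_add)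
      moreover have "sqrt (8 * pi) = 2 * sqrt (2 * pi)"
        using real_sqrt_mult[of 4 "2 * pi"] by simp
      ultimately show ?thesis by (simp add: normal_density_def)
    qed
    finally show "(\<integral>\<^sup>+\<omega>. ennreal (normal_density 0 1 g * exp ((c * Y \<omega>) * g)) \<partial>M)
      \<le> ennreal (2 * normal_density 0 2 g)" .
  qed
  also have "\<dots> = 2" by (simp add: ennreal_mult nn_integral_cmult nn_integral_normal_density)
  finally show ?thesis .
qed

text \<open>Second-order Taylor expansion. As \<open>\<bar>t\<bar> \<le> 1 / 2\<close>, a factor
  \<open>exp (\<bar>v\<bar> / 2)\<close> is left to absorb \<open>v\<^sup>2 / 8\<close>, so the
  remainder is quadratic in \<open>t\<close> and needs only an exponential moment of
  \<open>v\<close>.\<close>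

lemma exp_le_quadratic_remainder:
  fixes t v :: real
  assumes "\<bar>t\<bar> \<le> 1 / 2"
  shows "exp (t * v) \<le> 1 + t * v + 4 * t\<^sup>2 * exp \<bar>v\<bar>"
proof -
  obtain x where x: "\<bar>x\<bar> \<le> \<bar>t * v\<bar>" "exp (t * v) = (\<Sum>m<2. (t * v) ^ m / fact m) + exp x / fact 2 * (t * v) ^ 2"
    using Maclaurin_exp_le[of "t * v" 2] by auto
  have "\<bar>t * v\<bar> \<le> \<bar>v\<bar> / 2" using assms mult_right_mono[of "\<bar>t\<bar>" "1/2" "\<bar>v\<bar>"] by (simp add: abs_mult)
  then have "exp x \<le> exp (\<bar>v\<bar> / 2)" using x by auto
  moreover have "(v\<^sup>2 / 8) \<le> exp (\<bar>v\<bar> / 2)"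
    using exp_lower_Taylor_quadratic[of "\<bar>v\<bar> / 2"] by (simp add: power_divide)
  ultimately have "exp x * (v\<^sup>2 / 8) \<le> exp (\<bar>v\<bar> / 2) * exp (\<bar>v\<bar> / 2)" by (intro mult_mono) auto
  also have "\<dots> = exp \<bar>v\<bar>" by (simp flip: exp_add)
  finally have "t\<^sup>2 * (exp x * (v\<^sup>2 / 8)) \<le> t\<^sup>2 * exp \<bar>v\<bar>" by (intro mult_left_mono) auto
  then have "exp x / fact 2 * (t * v) ^ 2 \<le> 4 * t\<^sup>2 * exp \<bar>v\<bar>" by (simp add: power_mult_distrib mult_ac)
  then show ?thesis using x(2) by (simp add: numeral_2_eq_2)
qed

text \<open>The rate constants of the Bernstein bound for squares of a sub-Gaussian variable
  with parameter \<open>\<tau>\<close> and second moment at most \<open>Q\<close>.\<close>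

definition bern_h :: "real \<Rightarrow> real" where "bern_h \<tau> = min 1 (3 / (8 * \<tau>\<^sup>2))"
definition bern_B :: "real \<Rightarrow> real \<Rightarrow> real" where "bern_B \<tau> Q = 8 * exp (bern_h \<tau> * Q)"
definition bern_c :: "real \<Rightarrow> real \<Rightarrow> real" where "bern_c \<tau> Q = (bern_h \<tau>)\<^sup>2 / (4 * bern_B \<tau> Q)"

lemma bern_pos:
  assumes "\<tau> > 0"
  shows "bern_h \<tau> > 0" "bern_B \<tau> Q > 0" "bern_c \<tau> Q > 0"
proof -
  show "bern_h \<tau> > 0" using assms by (simp add: bern_h_def)
  then show "bern_B \<tau> Q > 0" "bern_c \<tau> Q > 0" by (simp_all add: bern_B_def bern_c_def)
qed

text \<open>\<open>exp_le_quadratic_remainder\<close> with \<open>t = \<theta> / h\<close> and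
  \<open>v = h * (Y\<^sup>2 - q)\<close>: centering kills the linear term, and the remainder is at
  most \<open>4 * t\<^sup>2 * exp (h * Q)\<close> times an exponential moment bounded by
  \<open>2\<close>, whence \<open>bern_B\<close>.\<close>

lemma (in prob_space) centered_square_mgf:
  assumes Y[measurable]: "Y \<in> borel_measurable M" and \<tau>: "\<tau> > 0"
    and mgf: "\<And>\<theta>. (\<integral>\<^sup>+\<omega>. ennreal (exp (\<theta> * Y \<omega>)) \<partial>M) \<le> ennreal (exp (\<tau>\<^sup>2 * \<theta>\<^sup>2 / 2))"
    and int: "integrable M (\<lambda>\<omega>. (Y \<omega>)\<^sup>2)" and q: "expectation (\<lambda>\<omega>. (Y \<omega>)\<^sup>2) = q" "q \<le> Q"
    and \<theta>: "\<bar>\<theta>\<bar> \<le> bern_h \<tau> / 2"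
  shows "integrable M (\<lambda>\<omega>. exp (\<theta> * ((Y \<omega>)\<^sup>2 - q)))"
    "expectation (\<lambda>\<omega>. exp (\<theta> * ((Y \<omega>)\<^sup>2 - q))) \<le> exp (bern_B \<tau> Q * (\<theta> / bern_h \<tau>)\<^sup>2)"
proof -
  define h where "h = bern_h \<tau>"
  have h: "0 < h" "h \<le> 3 / (8 * \<tau>\<^sup>2)" using \<tau> by (auto simp: h_def bern_h_def)
  have q0: "q \<ge> 0" unfolding q(1)[symmetric] by (rule integral_nonneg_AE) auto
  have le2: "(\<integral>\<^sup>+\<omega>. ennreal (exp (h * (Y \<omega>)\<^sup>2)) \<partial>M) \<le> 2"
    using h by (intro nn_integral_exp_square_le_2[OF Y \<tau> mgf]) auto
  have I: "integrable M (\<lambda>\<omega>. exp (h * (Y \<omega>)\<^sup>2))"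
    using le2 by (intro integrableI_bounded) (auto intro: le_less_trans)
  have E2: "expectation (\<lambda>\<omega>. exp (h * (Y \<omega>)\<^sup>2)) \<le> 2"
    using nn_integral_eq_integral[OF I] le2 by (simp flip: ennreal_numeral)
  define t where "t = \<theta> / h"
  have t: "\<bar>t\<bar> \<le> 1 / 2" using \<theta> h by (simp add: t_def h_def abs_divide)
  have pt: "exp (\<theta> * ((Y \<omega>)\<^sup>2 - q)) \<le> 1 + \<theta> * ((Y \<omega>)\<^sup>2 - q) + 4 * t\<^sup>2 * exp (h * Q) * exp (h * (Y \<omega>)\<^sup>2)" for \<omega>
  proof -
    have "\<theta> * ((Y \<omega>)\<^sup>2 - q) = t * (h * ((Y \<omega>)\<^sup>2 - q))" using h by (simp add: t_def)
    then have "exp (\<theta> * ((Y \<omega>)\<^sup>2 - q)) \<le> 1 + \<theta> * ((Y \<omega>)\<^sup>2 - q) + 4 * t\<^sup>2 * exp \<bar>h * ((Y \<omega>)\<^sup>2 - q)\<bar>"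
      using exp_le_quadratic_remainder[OF t, of "h * ((Y \<omega>)\<^sup>2 - q)"] by (simp only:)
    also have "exp \<bar>h * ((Y \<omega>)\<^sup>2 - q)\<bar> \<le> exp (h * Q + h * (Y \<omega>)\<^sup>2)"
    proof -
      have "\<bar>(Y \<omega>)\<^sup>2 - q\<bar> \<le> Q + (Y \<omega>)\<^sup>2" using q0 q(2) zero_le_power2[of "Y \<omega>"] by linarith
      then have "h * \<bar>(Y \<omega>)\<^sup>2 - q\<bar> \<le> h * (Q + (Y \<omega>)\<^sup>2)" using h by (intro mult_left_mono) auto
      then show ?thesis using h by (simp add: abs_mult distrib_left)
    qed
    finally show ?thesis by (simp add: exp_add mult.assoc mult_left_mono)
  qed
  have Ib: "integrable M (\<lambda>\<omega>. 1 + \<theta> * ((Y \<omega>)\<^sup>2 - q) + 4 * t\<^sup>2 * exp (h * Q) * exp (h * (Y \<omega>)\<^sup>2))"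
    using I int by auto
  show IM: "integrable M (\<lambda>\<omega>. exp (\<theta> * ((Y \<omega>)\<^sup>2 - q)))"
  proof (rule Bochner_Integration.integrable_bound[OF Ib])
    show "AE \<omega> in M. norm (exp (\<theta> * ((Y \<omega>)\<^sup>2 - q))) \<le>
       norm (1 + \<theta> * ((Y \<omega>)\<^sup>2 - q) + 4 * t\<^sup>2 * exp (h * Q) * exp (h * (Y \<omega>)\<^sup>2))"
      by (intro AE_I2) (use order_trans[OF pt abs_ge_self] in simp)
  qed simp
  have "expectation (\<lambda>\<omega>. exp (\<theta> * ((Y \<omega>)\<^sup>2 - q))) \<le>
    expectation (\<lambda>\<omega>. 1 + \<theta> * ((Y \<omega>)\<^sup>2 - q) + 4 * t\<^sup>2 * exp (h * Q) * exp (h * (Y \<omega>)\<^sup>2))"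
    by (intro integral_mono IM Ib pt)
  also have "\<dots> = 1 + 4 * t\<^sup>2 * exp (h * Q) * expectation (\<lambda>\<omega>. exp (h * (Y \<omega>)\<^sup>2))"
    using I int q by (simp add: prob_space)
  also have "\<dots> \<le> 1 + 4 * t\<^sup>2 * exp (h * Q) * 2" using E2 by (intro add_left_mono mult_left_mono) auto
  also have "\<dots> = 1 + bern_B \<tau> Q * t\<^sup>2" by (simp add: bern_B_def h_def)
  also have "\<dots> \<le> exp (bern_B \<tau> Q * t\<^sup>2)" by (rule exp_ge_add_one_self)
  finally show "expectation (\<lambda>\<omega>. exp (\<theta> * ((Y \<omega>)\<^sup>2 - q))) \<le> exp (bern_B \<tau> Q * (\<theta> / bern_h \<tau>)\<^sup>2)"
    by (simp add: t_def h_def)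
qed

text \<open>Chernoff bound; the sign \<open>e\<close> lets one statement serve the upper and the
  lower tail.\<close>

lemma (in prob_space) sum_squares_tail_one_sided:
  fixes Y :: "nat \<Rightarrow> 'a \<Rightarrow> real"
  assumes ind: "indep_vars (\<lambda>_. borel) Y {..<n}" and n: "n > 0" and \<tau>: "\<tau> > 0"
    and mgf: "\<And>k \<theta>. k < n \<Longrightarrow> (\<integral>\<^sup>+\<omega>. ennreal (exp (\<theta> * Y k \<omega>)) \<partial>M) \<le> ennreal (exp (\<tau>\<^sup>2 * \<theta>\<^sup>2 / 2))"
    and int: "\<And>k. k < n \<Longrightarrow> integrable M (\<lambda>\<omega>. (Y k \<omega>)\<^sup>2)"
    and q: "\<And>k. k < n \<Longrightarrow> expectation (\<lambda>\<omega>. (Y k \<omega>)\<^sup>2) = q" "q \<le> Q"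
    and t: "0 < t" "t \<le> 1" and e: "\<bar>e\<bar> = 1"
  shows "prob {\<omega> \<in> space M. (\<Sum>k<n. e * ((Y k \<omega>)\<^sup>2 - q)) \<ge> real n * t} \<le> exp (- bern_c \<tau> Q * real n * t\<^sup>2)"
proof -
  note pos = bern_pos[OF \<tau>]
  have "0 \<le> expectation (\<lambda>\<omega>. (Y 0 \<omega>)\<^sup>2)" by (rule integral_nonneg_AE) auto
  then have Q0: "Q \<ge> 0" using q(1)[OF n] q(2) by simp
  \<comment> \<open>\<open>B \<ge> 1\<close>, \<open>h \<le> 1\<close> and \<open>t \<le> 1\<close>
    together keep \<open>\<theta>\<close> within the range \<open>h / 2\<close> of the moment
    bound.\<close>
  have B1: "bern_B \<tau> Q \<ge> 1"
  proof -
    have "exp (bern_h \<tau> * Q) \<ge> 1" using pos Q0 by simp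
    then show ?thesis unfolding bern_B_def by linarith
  qed
  define h where "h = bern_h \<tau>"
  define B where "B = bern_B \<tau> Q"
  have hB: "0 < h" "h \<le> 1" "1 \<le> B" using pos B1 by (auto simp: h_def B_def bern_h_def)
  \<comment> \<open>Minimiser of \<open>B * (\<theta> / h)\<^sup>2 - \<theta> * t\<close>; the
    minimum is \<open>- bern_c \<tau> Q * t\<^sup>2\<close>.\<close>
  define \<theta> where "\<theta> = h\<^sup>2 * t / (2 * B)"
  have \<theta>0: "0 < \<theta>" using hB t by (simp add: \<theta>_def)
  have "h * t \<le> 1 * B" using hB t mult_mono[of h 1 t 1] by simp
  then have "\<theta> \<le> h / 2" using hB by (simp add: \<theta>_def field_simps power2_eq_square)
  then have \<theta>h: "\<bar>\<theta> * e\<bar> \<le> bern_h \<tau> / 2" using e \<theta>0 by (simp add: abs_mult h_def)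
  have [measurable]: "Y k \<in> borel_measurable M" if "k < n" for k
    using ind that by (auto simp: indep_vars_def)
  have sq: "(\<theta> * e / bern_h \<tau>)\<^sup>2 = (\<theta> / h)\<^sup>2"
    using e by (simp add: power_divide power_mult_distrib h_def) (metis power2_abs power_one)
  have 1: "integrable M (\<lambda>\<omega>. exp (\<theta> * e * ((Y k \<omega>)\<^sup>2 - q)))"
      "expectation (\<lambda>\<omega>. exp (\<theta> * e * ((Y k \<omega>)\<^sup>2 - q))) \<le> exp (B * (\<theta> / h)\<^sup>2)" if k: "k < n" for k
    using centered_square_mgf[OF _ \<tau> mgf[OF k] int[OF k] q(1)[OF k] q(2) \<theta>h] k by (simp_all add: sq B_def)
  have ind': "indep_vars (\<lambda>_. borel) (\<lambda>k \<omega>. exp (\<theta> * e * ((Y k \<omega>)\<^sup>2 - q))) {..<n}"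
    by (rule indep_vars_compose2[OF ind, where Y="\<lambda>_ y. exp (\<theta> * e * (y\<^sup>2 - q))"]) simp
  have prodeq: "exp (\<theta> * (\<Sum>k<n. e * ((Y k \<omega>)\<^sup>2 - q))) = (\<Prod>k<n. exp (\<theta> * e * ((Y k \<omega>)\<^sup>2 - q)))" for \<omega>
    by (simp add: sum_distrib_left exp_sum mult.assoc)
  have I: "integrable M (\<lambda>\<omega>. exp (\<theta> * (\<Sum>k<n. e * ((Y k \<omega>)\<^sup>2 - q))))"
    unfolding prodeq using 1 by (intro indep_vars_integrable[OF _ ind']) auto
  have "expectation (\<lambda>\<omega>. exp (\<theta> * (\<Sum>k<n. e * ((Y k \<omega>)\<^sup>2 - q)))) =
        (\<Prod>k<n. expectation (\<lambda>\<omega>. exp (\<theta> * e * ((Y k \<omega>)\<^sup>2 - q))))"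
    unfolding prodeq using 1 by (intro indep_vars_lebesgue_integral[OF _ ind']) auto
  also have "\<dots> \<le> (\<Prod>k<n. exp (B * (\<theta> / h)\<^sup>2))"
    using 1 by (intro prod_mono) (auto intro!: integral_nonneg_AE)
  also have "\<dots> = exp (real n * (B * (\<theta> / h)\<^sup>2))" by (simp add: exp_of_nat_mult)
  finally have E: "expectation (\<lambda>\<omega>. exp (\<theta> * (\<Sum>k<n. e * ((Y k \<omega>)\<^sup>2 - q)))) \<le> exp (real n * (B * (\<theta> / h)\<^sup>2))" .
  have "prob {\<omega> \<in> space M. (\<Sum>k<n. e * ((Y k \<omega>)\<^sup>2 - q)) \<ge> real n * t} =
        prob {\<omega> \<in> space M. exp (\<theta> * (\<Sum>k<n. e * ((Y k \<omega>)\<^sup>2 - q))) \<ge> exp (\<theta> * (real n * t))}"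
    using \<theta>0 by simp
  also have "\<dots> \<le> expectation (\<lambda>\<omega>. exp (\<theta> * (\<Sum>k<n. e * ((Y k \<omega>)\<^sup>2 - q)))) / exp (\<theta> * (real n * t))"
    by (rule integral_Markov_inequality_measure[OF I sets.top]) auto
  also have "\<dots> \<le> exp (real n * (B * (\<theta> / h)\<^sup>2)) / exp (\<theta> * (real n * t))"
    by (intro divide_right_mono E) auto
  also have "\<dots> = exp (real n * (B * (\<theta> / h)\<^sup>2) - \<theta> * (real n * t))" by (simp add: exp_diff)
  also have "real n * (B * (\<theta> / h)\<^sup>2) - \<theta> * (real n * t) = - bern_c \<tau> Q * real n * t\<^sup>2"
  proof -
    have "B * (\<theta> / h)\<^sup>2 - \<theta> * t = - (h\<^sup>2 / (4 * B)) * t\<^sup>2"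
      using hB by (simp add: \<theta>_def power2_eq_square field_simps)
    then have "real n * (B * (\<theta> / h)\<^sup>2 - \<theta> * t) = real n * (- (h\<^sup>2 / (4 * B)) * t\<^sup>2)" by simp
    then show ?thesis by (simp add: bern_c_def h_def B_def algebra_simps)
  qed
  finally show ?thesis .
qed

lemma (in prob_space) sum_squares_tail:
  fixes Y :: "nat \<Rightarrow> 'a \<Rightarrow> real"
  assumes ind: "indep_vars (\<lambda>_. borel) Y {..<n}" and n: "n > 0" and \<tau>: "\<tau> > 0"
    and mgf: "\<And>k \<theta>. k < n \<Longrightarrow> (\<integral>\<^sup>+\<omega>. ennreal (exp (\<theta> * Y k \<omega>)) \<partial>M) \<le> ennreal (exp (\<tau>\<^sup>2 * \<theta>\<^sup>2 / 2))"
    and int: "\<And>k. k < n \<Longrightarrow> integrable M (\<lambda>\<omega>. (Y k \<omega>)\<^sup>2)"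
    and q: "\<And>k. k < n \<Longrightarrow> expectation (\<lambda>\<omega>. (Y k \<omega>)\<^sup>2) = q" "q \<le> Q"
    and t: "0 < t" "t \<le> 1"
  shows "prob {\<omega> \<in> space M. \<bar>(\<Sum>k<n. (Y k \<omega>)\<^sup>2) / real n - q\<bar> \<ge> t} \<le> 2 * exp (- bern_c \<tau> Q * real n * t\<^sup>2)"
proof -
  have [measurable]: "Y k \<in> borel_measurable M" if "k < n" for k
    using ind that by (auto simp: indep_vars_def)
  let ?A = "\<lambda>e. {\<omega> \<in> space M. (\<Sum>k<n. e * ((Y k \<omega>)\<^sup>2 - q)) \<ge> real n * t}"
  have A: "?A e \<in> events" for e by measurable
  have eq: "(\<Sum>k<n. e * ((Y k \<omega>)\<^sup>2 - q)) = real n * (e * ((\<Sum>k<n. (Y k \<omega>)\<^sup>2) / real n - q))" for e \<omega>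
    using n by (simp add: sum_subtractf field_simps flip: sum_distrib_left)
  have "{\<omega> \<in> space M. \<bar>(\<Sum>k<n. (Y k \<omega>)\<^sup>2) / real n - q\<bar> \<ge> t} \<subseteq> ?A 1 \<union> ?A (-1)"
    unfolding eq using n by (auto simp: abs_if split: if_splits)
  then have "prob {\<omega> \<in> space M. \<bar>(\<Sum>k<n. (Y k \<omega>)\<^sup>2) / real n - q\<bar> \<ge> t} \<le> prob (?A 1 \<union> ?A (-1))"
    by (intro finite_measure_mono sets.Un A)
  also have "\<dots> \<le> prob (?A 1) + prob (?A (-1))" by (intro measure_Un_le A)
  also have "\<dots> \<le> exp (- bern_c \<tau> Q * real n * t\<^sup>2) + exp (- bern_c \<tau> Q * real n * t\<^sup>2)"
    using assms by (intro add_mono sum_squares_tail_one_sided[OF ind n \<tau> mgf int q t]) auto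
  finally show ?thesis by simp
qed

section \<open>Quadratic forms and the spectrum\<close>

lemma scalar_prod_mult_mat_vec:
  fixes A :: "real mat"
  assumes "A \<in> carrier_mat p p" "v \<in> carrier_vec p" "w \<in> carrier_vec p"
  shows "v \<bullet> (A *\<^sub>v w) = (\<Sum>i<p. \<Sum>j<p. v $ i * A $$ (i, j) * w $ j)"
  using assms by (auto simp: scalar_prod_def sum_distrib_left atLeast0LessThan mult.assoc intro!: sum.cong)

lemma scalar_prod_self:
  fixes v :: "real Matrix.vec"
  assumes "v \<in> carrier_vec p"
  shows "v \<bullet> v = (\<Sum>i<p. (v $ i)\<^sup>2)" "0 \<le> v \<bullet> v" "v \<bullet> v = 0 \<longleftrightarrow> v = 0\<^sub>v p"
proof -
  show e: "v \<bullet> v = (\<Sum>i<p. (v $ i)\<^sup>2)"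
    using assms by (auto simp: scalar_prod_def atLeast0LessThan power2_eq_square)
  then show "0 \<le> v \<bullet> v" by (simp add: sum_nonneg)
  show "v \<bullet> v = 0 \<longleftrightarrow> v = 0\<^sub>v p"
    unfolding e using assms by (auto simp: sum_nonneg_eq_0_iff intro!: eq_vecI)
qed

text \<open>Only the existence of some \<open>K\<close> matters: it takes the place of compactness
  of the unit sphere in the eigenvalue argument.\<close>

lemma quadratic_form_bounded:
  fixes A :: "real mat"
  assumes A: "A \<in> carrier_mat p p"
  obtains K where "K > 0" "\<And>v. v \<in> carrier_vec p \<Longrightarrow> \<bar>v \<bullet> (A *\<^sub>v v)\<bar> \<le> K * (v \<bullet> v)"
proof
  define K where "K = (\<Sum>i<p. \<Sum>j<p. \<bar>A $$ (i, j)\<bar>)"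
  show "K + 1 > 0" unfolding K_def by (intro add_nonneg_pos sum_nonneg) auto
  fix v :: "real Matrix.vec" assume v: "v \<in> carrier_vec p"
  have le: "\<bar>v $ i * v $ j\<bar> \<le> v \<bullet> v" if "i < p" "j < p" for i j
  proof -
    have sq: "(v $ i)\<^sup>2 \<le> v \<bullet> v" if "i < p" for i
      unfolding scalar_prod_self(1)[OF v] using that by (intro member_le_sum) auto
    have "2 * \<bar>v $ i * v $ j\<bar> \<le> (v $ i)\<^sup>2 + (v $ j)\<^sup>2"
      using sum_squares_bound[of "\<bar>v $ i\<bar>" "\<bar>v $ j\<bar>"] by (simp add: abs_mult)
    then show ?thesis using sq[OF that(1)] sq[OF that(2)] by linarith
  qed
  have "\<bar>v \<bullet> (A *\<^sub>v v)\<bar> \<le> (\<Sum>i<p. \<Sum>j<p. \<bar>v $ i * A $$ (i, j) * v $ j\<bar>)"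
    unfolding scalar_prod_mult_mat_vec[OF A v v] by (intro order_trans[OF sum_abs] sum_mono sum_abs)
  also have "\<dots> \<le> (\<Sum>i<p. \<Sum>j<p. \<bar>A $$ (i, j)\<bar> * (v \<bullet> v))"
  proof (intro sum_mono)
    fix i j assume "i \<in> {..<p}" "j \<in> {..<p}"
    then have "\<bar>A $$ (i, j)\<bar> * \<bar>v $ i * v $ j\<bar> \<le> \<bar>A $$ (i, j)\<bar> * (v \<bullet> v)"
      by (intro mult_left_mono le) auto
    then show "\<bar>v $ i * A $$ (i, j) * v $ j\<bar> \<le> \<bar>A $$ (i, j)\<bar> * (v \<bullet> v)" by (simp add: abs_mult mult_ac)
  qed
  also have "\<dots> = K * (v \<bullet> v)" by (simp add: K_def sum_distrib_right)
  also have "\<dots> \<le> (K + 1) * (v \<bullet> v)" using scalar_prod_self(2)[OF v] by (intro mult_right_mono) auto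
  finally show "\<bar>v \<bullet> (A *\<^sub>v v)\<bar> \<le> (K + 1) * (v \<bullet> v)" .
qed

lemma symmetric_entries:
  assumes "A \<in> carrier_mat p p" "transpose_mat A = A" "i < p" "j < p"
  shows "A $$ (i, j) = A $$ (j, i)"
  using assms index_transpose_mat(1)[of j A i] by auto

lemma symmetric_scalar_prod:
  fixes A :: "real mat"
  assumes "A \<in> carrier_mat p p" "transpose_mat A = A" "v \<in> carrier_vec p" "w \<in> carrier_vec p"
  shows "v \<bullet> (A *\<^sub>v w) = (A *\<^sub>v v) \<bullet> w" "w \<bullet> (A *\<^sub>v v) = v \<bullet> (A *\<^sub>v w)"
proof -
  show 1: "v \<bullet> (A *\<^sub>v w) = (A *\<^sub>v v) \<bullet> w"
    using transpose_vec_mult_scalar[of A p p w v] assms by simp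
  show "w \<bullet> (A *\<^sub>v v) = v \<bullet> (A *\<^sub>v w)"
    unfolding 1 using assms by (intro comm_scalar_prod) auto
qed

text \<open>The form is evaluated at \<open>c u - b v\<close>. As it is only semidefinite,
  \<open>c = 0\<close> is possible and is treated apart.\<close>

lemma psd_cauchy_schwarz:
  fixes B :: "real mat"
  assumes B: "B \<in> carrier_mat p p" "transpose_mat B = B"
    and psd: "\<And>v. v \<in> carrier_vec p \<Longrightarrow> 0 \<le> v \<bullet> (B *\<^sub>v v)"
    and u: "u \<in> carrier_vec p" and v: "v \<in> carrier_vec p"
  shows "(u \<bullet> (B *\<^sub>v v))\<^sup>2 \<le> (u \<bullet> (B *\<^sub>v u)) * (v \<bullet> (B *\<^sub>v v))"
proof -
  define a b c where "a = u \<bullet> (B *\<^sub>v u)" and "b = u \<bullet> (B *\<^sub>v v)" and "c = v \<bullet> (B *\<^sub>v v)"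
  have exp: "(x \<cdot>\<^sub>v u + y \<cdot>\<^sub>v v) \<bullet> (B *\<^sub>v (x \<cdot>\<^sub>v u + y \<cdot>\<^sub>v v)) = x\<^sup>2 * a + 2 * x * y * b + y\<^sup>2 * c" for x y
  proof -
    have "B *\<^sub>v (x \<cdot>\<^sub>v u + y \<cdot>\<^sub>v v) = x \<cdot>\<^sub>v (B *\<^sub>v u) + y \<cdot>\<^sub>v (B *\<^sub>v v)"
      using B u v by (simp add: mult_add_distrib_mat_vec mult_mat_vec)
    moreover have "v \<bullet> (B *\<^sub>v u) = b" unfolding b_def using symmetric_scalar_prod(2)[OF B u v] .
    moreover have "B *\<^sub>v u \<in> carrier_vec p" "B *\<^sub>v v \<in> carrier_vec p" using B u v by auto
    ultimately show ?thesis using u v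
      by (simp add: add_scalar_prod_distrib[of _ p] scalar_prod_add_distrib[of _ p] a_def b_def c_def power2_eq_square algebra_simps)
  qed
  have nn: "0 \<le> x\<^sup>2 * a + 2 * x * y * b + y\<^sup>2 * c" for x y
    unfolding exp[symmetric] using u v by (intro psd) auto
  have "b\<^sup>2 \<le> a * c"
  proof (cases "c = 0")
    case True
    have "b = 0"
    proof (rule ccontr)
      assume "b \<noteq> 0"
      \<comment> \<open>For \<open>c = 0\<close> and \<open>b \<noteq> 0\<close> the chosen multiple
        of \<open>v\<close> makes the form equal to \<open>-1\<close>.\<close>
      then have "0 \<le> a + (- (2 * a) - 2) / 2" using nn[of 1 "- (a + 1) / (2 * b)"] True by simp
      then show False by (simp add: field_simps)
    qed
    then show ?thesis using True by simp
  next
    case False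
    have "0 \<le> c" unfolding c_def using v by (rule psd)
    with False have "c > 0" by simp
    have "0 \<le> c\<^sup>2 * a + 2 * c * (- b) * b + (- b)\<^sup>2 * c" by (rule nn)
    also have "\<dots> = c * (a * c - b\<^sup>2)" by (simp add: power2_eq_square algebra_simps)
    finally show ?thesis using \<open>c > 0\<close> by (simp add: zero_le_mult_iff)
  qed
  then show ?thesis by (simp add: a_def b_def c_def)
qed

text \<open>The infimum \<open>\<mu>\<close> of the Rayleigh quotient is an eigenvalue: otherwise \<open>A - \<mu> I\<close> would be
  positive semidefinite and invertible, hence bounded below, contradicting the choice of \<open>\<mu>\<close>.\<close>

lemma rayleigh_eigenvalue:
  fixes A :: "real mat"
  assumes A: "A \<in> carrier_mat p p" and sym: "transpose_mat A = A" and p: "p > 0"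
  obtains \<mu> where "eigenvalue A \<mu>" "\<And>v. v \<in> carrier_vec p \<Longrightarrow> \<mu> * (v \<bullet> v) \<le> v \<bullet> (A *\<^sub>v v)"
proof -
  define R where "R = {v \<bullet> (A *\<^sub>v v) |v. v \<in> carrier_vec p \<and> v \<bullet> v = 1}"
  obtain K where K: "\<And>v. v \<in> carrier_vec p \<Longrightarrow> \<bar>v \<bullet> (A *\<^sub>v v)\<bar> \<le> K * (v \<bullet> v)"
    using quadratic_form_bounded[OF A] by metis
  have Rb: "bdd_below R"
  proof (rule bdd_belowI)
    fix x assume "x \<in> R"
    then show "- K \<le> x" unfolding R_def using K by fastforce
  qed
  have Rne: "R \<noteq> {}"
    unfolding R_def using p by (auto intro!: exI[of _ "unit_vec p 0"])
  define \<mu> where "\<mu> = Inf R"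
  have scale: "c * (v \<bullet> v) \<le> v \<bullet> (A *\<^sub>v v)" if c: "\<And>x. x \<in> R \<Longrightarrow> c \<le> x" and v: "v \<in> carrier_vec p" for c v
  proof (cases "v = 0\<^sub>v p")
    case True then show ?thesis using A by simp
  next
    case False
    then have vv: "v \<bullet> v > 0" using scalar_prod_self(2,3)[OF v] by linarith
    define t where "t = 1 / sqrt (v \<bullet> v)"
    have t2: "t * t * (v \<bullet> v) = 1" using vv by (simp add: t_def)
    have e: "(t \<cdot>\<^sub>v v) \<bullet> (A *\<^sub>v (t \<cdot>\<^sub>v v)) = t * t * (v \<bullet> (A *\<^sub>v v))"
      using A v by (simp add: mult_mat_vec[of _ p p])
    have "(t \<cdot>\<^sub>v v) \<bullet> (t \<cdot>\<^sub>v v) = 1" using v t2 by simp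
    then have "(t \<cdot>\<^sub>v v) \<bullet> (A *\<^sub>v (t \<cdot>\<^sub>v v)) \<in> R"
      unfolding R_def by (intro CollectI exI[of _ "t \<cdot>\<^sub>v v"] conjI refl) (use v in auto)
    then have "c \<le> t * t * (v \<bullet> (A *\<^sub>v v))" using c e by auto
    then have "(v \<bullet> v) * c \<le> (v \<bullet> v) * (t * t * (v \<bullet> (A *\<^sub>v v)))" using vv by (intro mult_left_mono) auto
    also have "\<dots> = (t * t * (v \<bullet> v)) * (v \<bullet> (A *\<^sub>v v))" by simp
    finally show ?thesis using t2 by (simp add: mult.commute)
  qed
  have \<mu>: "\<mu> * (v \<bullet> v) \<le> v \<bullet> (A *\<^sub>v v)" if "v \<in> carrier_vec p" for v
    using scale[OF _ that, of \<mu>] Rb unfolding \<mu>_def by (simp add: cInf_lower)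
  have "eigenvalue A \<mu>"
  proof (rule ccontr)
    assume ne: "\<not> eigenvalue A \<mu>"
    define B where "B = char_matrix A \<mu>"
    have B: "B \<in> carrier_mat p p" unfolding B_def using A by simp
    have Bv: "B *\<^sub>v v = A *\<^sub>v v - \<mu> \<cdot>\<^sub>v v" if "v \<in> carrier_vec p" for v
    proof -
      have "A *\<^sub>v v + (- \<mu>) \<cdot>\<^sub>v v = B *\<^sub>v v"
        unfolding B_def char_matrix_def
        by (rule eq_vecI, insert that A, auto simp: add_scalar_prod_distrib[of _ p])
      moreover have "A *\<^sub>v v + (- \<mu>) \<cdot>\<^sub>v v = A *\<^sub>v v - \<mu> \<cdot>\<^sub>v v"
        using that A by (intro eq_vecI) auto
      ultimately show ?thesis by simp
    qed
    have Bsym: "transpose_mat B = B"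
      unfolding B_def char_matrix_def using A symmetric_entries[OF A sym] by (intro eq_matI) auto
    have q: "v \<bullet> (B *\<^sub>v v) = v \<bullet> (A *\<^sub>v v) - \<mu> * (v \<bullet> v)" if "v \<in> carrier_vec p" for v
      using that A by (simp add: Bv scalar_prod_minus_distrib[of _ p])
    have psd: "0 \<le> v \<bullet> (B *\<^sub>v v)" if "v \<in> carrier_vec p" for v using q[OF that] \<mu>[OF that] by simp
    have "det B \<noteq> 0" using ne eigenvalue_det[OF A] by (simp add: B_def)
    from det_non_zero_imp_unit[OF B this, of "()"]
    obtain C where C: "C \<in> carrier_mat p p" "C * B = 1\<^sub>m p" by (auto simp: Units_def ring_mat_simps)
    obtain K1 where K1: "K1 > 0" "\<And>v. v \<in> carrier_vec p \<Longrightarrow> \<bar>v \<bullet> (B *\<^sub>v v)\<bar> \<le> K1 * (v \<bullet> v)"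
      using quadratic_form_bounded[OF B] by metis
    have CC: "transpose_mat C * C \<in> carrier_mat p p" using C by simp
    obtain K2 where K2: "K2 > 0" "\<And>v. v \<in> carrier_vec p \<Longrightarrow> \<bar>v \<bullet> ((transpose_mat C * C) *\<^sub>v v)\<bar> \<le> K2 * (v \<bullet> v)"
      using quadratic_form_bounded[OF CC] by metis
    have lower: "v \<bullet> v \<le> K2 * K1 * (v \<bullet> (B *\<^sub>v v))" if v: "v \<in> carrier_vec p" for v
    proof -
      define u where "u = B *\<^sub>v v"
      have u: "u \<in> carrier_vec p" using B v by (simp add: u_def)
      have Cu: "C *\<^sub>v u = v" unfolding u_def using C B v by (simp flip: assoc_mult_mat_vec)
      have "v \<bullet> v = u \<bullet> ((transpose_mat C * C) *\<^sub>v u)"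
        using transpose_vec_mult_scalar[of C p p u v] C u v Cu
        by (simp add: assoc_mult_mat_vec[of _ p p] comm_scalar_prod[of u p])
      also have "\<dots> \<le> K2 * (u \<bullet> u)" using K2(2)[OF u] by simp
      finally have 1: "v \<bullet> v \<le> K2 * (u \<bullet> u)" .
      \<comment> \<open>Cauchy-Schwarz for the form of \<open>B\<close> with
        \<open>u = B *\<^sub>v v\<close>: the mixed term is \<open>u \<bullet> u\<close> itself.
        Cancelling one factor bounds \<open>u \<bullet> u\<close>, and through the inverse
        \<open>C\<close> also \<open>v \<bullet> v\<close>, by a multiple of
        \<open>v \<bullet> (B *\<^sub>v v)\<close>.\<close>
      have "(u \<bullet> u)\<^sup>2 \<le> (u \<bullet> (B *\<^sub>v u)) * (v \<bullet> (B *\<^sub>v v))"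
        using psd_cauchy_schwarz[OF B Bsym psd u v] by (simp add: u_def)
      also have "\<dots> \<le> (K1 * (u \<bullet> u)) * (v \<bullet> (B *\<^sub>v v))"
        using K1(2)[OF u] psd[OF v] by (intro mult_right_mono) auto
      finally have "(u \<bullet> u) * (u \<bullet> u) \<le> (u \<bullet> u) * (K1 * (v \<bullet> (B *\<^sub>v v)))" by (simp add: power2_eq_square mult_ac)
      then have "u \<bullet> u \<le> K1 * (v \<bullet> (B *\<^sub>v v))"
        using scalar_prod_self(2)[OF u] K1(1) psd[OF v] by (cases "u \<bullet> u = 0") auto
      then have "K2 * (u \<bullet> u) \<le> K2 * (K1 * (v \<bullet> (B *\<^sub>v v)))" using K2(1) by (intro mult_left_mono) auto
      with 1 show ?thesis by simp
    qed
    have "\<mu> + 1 / (K2 * K1) \<le> x" if xR: "x \<in> R" for x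
    proof -
      obtain v where v: "v \<in> carrier_vec p" "v \<bullet> v = 1" "x = v \<bullet> (A *\<^sub>v v)" using xR by (auto simp: R_def)
      have "1 \<le> K2 * K1 * (x - \<mu>)" using lower[OF v(1)] q[OF v(1)] v by simp
      then have "1 / (K2 * K1) \<le> x - \<mu>" using K1 K2 by (simp add: field_simps)
      then show ?thesis by simp
    qed
    then have "\<mu> + 1 / (K2 * K1) \<le> \<mu>" unfolding \<mu>_def using Rne by (intro cInf_greatest) auto
    moreover have "1 / (K2 * K1) > 0" using K1 K2 by simp
    ultimately show False by linarith
  qed
  then show thesis using \<mu> that by blast
qed

lemma spectrum_quadratic_form_bounds:
  fixes A :: "real mat"
  assumes A: "A \<in> carrier_mat p p" and sym: "transpose_mat A = A" and p: "p > 0"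
    and lo: "lo \<le> Min (spectrum A)" and hi: "Max (spectrum A) \<le> hi" and v: "v \<in> carrier_vec p"
  shows "lo * (v \<bullet> v) \<le> v \<bullet> (A *\<^sub>v v)" "v \<bullet> (A *\<^sub>v v) \<le> hi * (v \<bullet> v)"
proof -
  have fin: "finite (spectrum A)" using A by (rule card_finite_spectrum)
  obtain \<mu> where \<mu>: "eigenvalue A \<mu>" "\<mu> * (v \<bullet> v) \<le> v \<bullet> (A *\<^sub>v v)"
    using rayleigh_eigenvalue[OF A sym p] v by metis
  have "lo \<le> \<mu>" using lo Min_le[OF fin, of \<mu>] \<mu>(1) by (simp add: spectrum_def)
  then have "lo * (v \<bullet> v) \<le> \<mu> * (v \<bullet> v)" using scalar_prod_self(2)[OF v] by (rule mult_right_mono)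
  then show "lo * (v \<bullet> v) \<le> v \<bullet> (A *\<^sub>v v)" using \<mu> by simp
  \<comment> \<open>The largest eigenvalue is reached as minus the smallest one of
    \<open>- A\<close>.\<close>
  have mA: "- A \<in> carrier_mat p p" "transpose_mat (- A) = - A" using A symmetric_entries[OF A sym] by (auto intro!: eq_matI)
  obtain \<nu> where \<nu>: "eigenvalue (- A) \<nu>" "\<nu> * (v \<bullet> v) \<le> v \<bullet> (- A *\<^sub>v v)"
    using rayleigh_eigenvalue[OF mA p] v by metis
  obtain x where x: "x \<in> carrier_vec p" "x \<noteq> 0\<^sub>v p" "- A *\<^sub>v x = \<nu> \<cdot>\<^sub>v x"
    using \<nu>(1) A by (auto simp: eigenvalue_def eigenvector_def)
  have "A *\<^sub>v x = (- \<nu>) \<cdot>\<^sub>v x"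
  proof -
    have "- (A *\<^sub>v x) = \<nu> \<cdot>\<^sub>v x" using x A by (simp add: uminus_mult_mat_vec)
    then have "A *\<^sub>v x = - (\<nu> \<cdot>\<^sub>v x)" by (metis uminus_uminus_vec)
    also have "\<dots> = (- \<nu>) \<cdot>\<^sub>v x" using x by (intro eq_vecI) auto
    finally show ?thesis .
  qed
  then have "eigenvalue A (- \<nu>)" using x A unfolding eigenvalue_def eigenvector_def by auto
  then have "- \<nu> \<le> hi" using hi Max_ge[OF fin, of "- \<nu>"] by (simp add: spectrum_def)
  then have "- \<nu> * (v \<bullet> v) \<le> hi * (v \<bullet> v)" using scalar_prod_self(2)[OF v] by (rule mult_right_mono)
  moreover have "v \<bullet> (- A *\<^sub>v v) = - (v \<bullet> (A *\<^sub>v v))" using A v by (simp add: uminus_mult_mat_vec scalar_prod_uminus_right)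
  ultimately show "v \<bullet> (A *\<^sub>v v) \<le> hi * (v \<bullet> v)" using \<nu>(2) by simp
qed

section \<open>Gaussian laws and conditioning on the design\<close>

lemma space_vec_borel: "space (vec_borel p) = carrier_vec p"
  and space_mat_borel: "space (mat_borel n p) = carrier_mat n p"
  by (simp_all add: vec_borel_def mat_borel_def)

lemma measurable_vec_borelI:
  assumes "\<And>x. x \<in> space M \<Longrightarrow> f x \<in> carrier_vec p" "\<And>i. i < p \<Longrightarrow> (\<lambda>x. f x $ i) \<in> borel_measurable M"
  shows "f \<in> M \<rightarrow>\<^sub>M vec_borel p"
  unfolding vec_borel_def
  using assms by (intro measurable_vimage_algebra2 measurable_PiM_single') (auto simp: PiE_def extensional_def)

lemma measurable_vec_nth: "i < p \<Longrightarrow> (\<lambda>v. v $ i) \<in> vec_borel p \<rightarrow>\<^sub>M borel"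
proof -
  assume i: "i < p"
  have "(\<lambda>v. (\<lambda>i\<in>{..<p}. v $ i) i) \<in> vec_borel p \<rightarrow>\<^sub>M borel"
    unfolding vec_borel_def
    by (rule measurable_compose[OF measurable_vimage_algebra1 measurable_component_singleton]) (use i in \<open>auto simp: space_PiM split: if_splits\<close>)
  then show ?thesis using i by simp
qed

lemma measurable_mat_nth: "i < n \<Longrightarrow> j < p \<Longrightarrow> (\<lambda>A. A $$ (i, j)) \<in> mat_borel n p \<rightarrow>\<^sub>M borel"
proof -
  assume i: "i < n" "j < p"
  have "(\<lambda>A. (\<lambda>ij\<in>{..<n} \<times> {..<p}. A $$ ij) (i, j)) \<in> mat_borel n p \<rightarrow>\<^sub>M borel"
    unfolding mat_borel_def
    by (rule measurable_compose[OF measurable_vimage_algebra1 measurable_component_singleton]) (use i in \<open>auto simp: space_PiM split: if_splits\<close>)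
  then show ?thesis using i by simp
qed

text \<open>Scaling a standard normal variable treats the point mass \<open>v = 0\<close> and the
  genuine normal laws alike.\<close>

lemma centered_normal_eq_distr:
  assumes "v \<ge> 0"
  shows "centered_normal v = distr std_normal_distribution borel (\<lambda>x. sqrt v * x)"
proof (cases "v = 0")
  case True
  interpret prob_space std_normal_distribution by (rule prob_space_normal_density) simp
  show ?thesis using True by (simp add: centered_normal_def distr_const)
next
  case False
  interpret prob_space std_normal_distribution by (rule prob_space_normal_density) simp
  have "distributed std_normal_distribution lborel (\<lambda>x. x) std_normal_density"
    unfolding distributed_def by (auto simp: distr_id2)
  from normal_density_affine[OF this, of "sqrt v" 0]
  have "distributed std_normal_distribution lborel (\<lambda>x. sqrt v * x) (normal_density 0 (sqrt v))"
    using assms False by simp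
  then have "distr std_normal_distribution lborel (\<lambda>x. sqrt v * x) = density lborel (normal_density 0 (sqrt v))"
    by (rule distributed_distr_eq_density)
  then show ?thesis using False by (simp add: centered_normal_def cong: distr_cong)
qed

lemma real_distribution_centered_normal: "v \<ge> 0 \<Longrightarrow> real_distribution (centered_normal v)"
  by (simp add: centered_normal_eq_distr prob_space.real_distribution_distr[OF prob_space_normal_density])

lemma char_centered_normal:
  assumes "v \<ge> 0"
  shows "char (centered_normal v) t = complex_of_real (exp (- (v * t\<^sup>2) / 2))"
proof -
  have "char (centered_normal v) t = char std_normal_distribution (t * sqrt v)"
    unfolding centered_normal_eq_distr[OF assms] char_def
    by (subst integral_distr) (auto simp: mult.assoc)
  then show ?thesis using assms by (simp add: char_std_normal_distribution power_mult_distrib mult.commute)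
qed

lemma centered_normal_square: "0 < \<sigma> \<Longrightarrow> centered_normal (\<sigma>\<^sup>2) = density lborel (normal_density 0 \<sigma>)"
  by (simp add: centered_normal_def)

text \<open>Characteristic functions multiply over independent summands and determine the law. This
  route also covers coefficients that are all zero, where the law is a point mass.\<close>

lemma (in prob_space) distr_normal_combination:
  fixes E :: "nat \<Rightarrow> 'a \<Rightarrow> real"
  assumes ind: "indep_vars (\<lambda>_. borel) E {..<n}" and \<sigma>: "0 < \<sigma>"
    and law: "\<And>k. k < n \<Longrightarrow> distr M borel (E k) = density lborel (normal_density 0 \<sigma>)"
  shows "distr M borel (\<lambda>\<omega>. \<Sum>k<n. a k * E k \<omega>) = centered_normal (\<sigma>\<^sup>2 * (\<Sum>k<n. (a k)\<^sup>2))"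
proof (rule Levy_uniqueness)
  have [measurable]: "E k \<in> borel_measurable M" if "k < n" for k
    using ind that by (auto simp: indep_vars_def)
  have v: "0 \<le> \<sigma>\<^sup>2 * (\<Sum>k<n. (a k)\<^sup>2)" by (intro mult_nonneg_nonneg sum_nonneg) auto
  show "real_distribution (distr M borel (\<lambda>\<omega>. \<Sum>k<n. a k * E k \<omega>))" by (rule real_distribution_distr) measurable
  show "real_distribution (centered_normal (\<sigma>\<^sup>2 * (\<Sum>k<n. (a k)\<^sup>2)))" using v by (rule real_distribution_centered_normal)
  have "indep_vars (\<lambda>_. borel) (\<lambda>k \<omega>. a k * E k \<omega>) {..<n}"
    by (rule indep_vars_compose2[OF ind, where Y="\<lambda>k y. a k * y"]) simp
  note cs = char_distr_sum[OF this]
  show "char (distr M borel (\<lambda>\<omega>. \<Sum>k<n. a k * E k \<omega>)) = char (centered_normal (\<sigma>\<^sup>2 * (\<Sum>k<n. (a k)\<^sup>2)))"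
  proof
    fix t
    have "char (distr M borel (\<lambda>\<omega>. a k * E k \<omega>)) t = complex_of_real (exp (- (\<sigma>\<^sup>2 * (a k)\<^sup>2 * t\<^sup>2) / 2))" if "k < n" for k
    proof -
      have "char (distr M borel (\<lambda>\<omega>. a k * E k \<omega>)) t = char (distr M borel (E k)) (t * a k)"
        unfolding char_def using that by (simp add: integral_distr mult.assoc)
      then show ?thesis
        unfolding law[OF that] centered_normal_square[OF \<sigma>, symmetric]
        by (simp add: char_centered_normal power_mult_distrib mult_ac)
    qed
    then have "char (distr M borel (\<lambda>\<omega>. \<Sum>k<n. a k * E k \<omega>)) t =
       (\<Prod>k<n. complex_of_real (exp (- (\<sigma>\<^sup>2 * (a k)\<^sup>2 * t\<^sup>2) / 2)))" unfolding cs by simp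
    also have "\<dots> = complex_of_real (exp (\<Sum>k<n. - (\<sigma>\<^sup>2 * (a k)\<^sup>2 * t\<^sup>2) / 2))"
      by (simp add: exp_sum)
    also have "(\<Sum>k<n. - (\<sigma>\<^sup>2 * (a k)\<^sup>2 * t\<^sup>2) / 2) = - (\<sigma>\<^sup>2 * (\<Sum>k<n. (a k)\<^sup>2) * t\<^sup>2) / 2"
      by (simp add: sum_distrib_left sum_distrib_right sum_negf sum_divide_distrib)
    finally show "char (distr M borel (\<lambda>\<omega>. \<Sum>k<n. a k * E k \<omega>)) t = char (centered_normal (\<sigma>\<^sup>2 * (\<Sum>k<n. (a k)\<^sup>2))) t"
      using v by (simp add: char_centered_normal)
  qed
qed

lemma centered_normal_tail:
  assumes v: "0 \<le> v" "v \<le> V" and V: "0 < V" and t: "0 \<le> t"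
  shows "emeasure (centered_normal v) {t<..} \<le> ennreal (exp (- t\<^sup>2 / (2 * V)))"
proof -
  \<comment> \<open>Chernoff parameter for the variance bound \<open>V\<close>; working with
    \<open>V\<close> instead of \<open>v\<close> keeps the case \<open>v = 0\<close>
    regular.\<close>
  define c where "c = t / V"
  have "emeasure (centered_normal v) {t<..} = (\<integral>\<^sup>+x. indicator {t<..} (sqrt v * x) \<partial>std_normal_distribution)"
    unfolding centered_normal_eq_distr[OF v(1)]
    by (subst nn_integral_indicator[symmetric], simp, subst nn_integral_distr) auto
  also have "\<dots> \<le> (\<integral>\<^sup>+x. ennreal (exp (- c * t) * exp ((c * sqrt v) * x)) \<partial>std_normal_distribution)"
  proof (rule nn_integral_mono)
    fix x
    have "1 \<le> exp (- c * t) * exp ((c * sqrt v) * x)" if "t < sqrt v * x"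
    proof -
      have "0 \<le> c * (sqrt v * x - t)" using that t V by (auto simp: c_def)
      then show ?thesis by (simp add: algebra_simps flip: exp_add)
    qed
    then show "indicator {t<..} (sqrt v * x) \<le> ennreal (exp (- c * t) * exp ((c * sqrt v) * x))"
      by (auto simp: indicator_def simp flip: ennreal_1)
  qed
  also have "\<dots> = (\<integral>\<^sup>+x. ennreal (exp (- c * t)) * ennreal (normal_density 0 1 x * exp ((c * sqrt v) * x)) \<partial>lborel)"
    by (subst nn_integral_density) (auto intro!: nn_integral_cong simp: ennreal_mult mult_ac)
  also have "\<dots> = ennreal (exp (- c * t)) * ennreal (exp ((c * sqrt v)\<^sup>2 / 2))"
    by (simp add: nn_integral_cmult normal_density_exp ennreal_mult nn_integral_normal_density)
  also have "\<dots> = ennreal (exp (- c * t + c\<^sup>2 * v / 2))"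
    using v by (simp add: power_mult_distrib flip: ennreal_mult exp_add)
  also have "\<dots> \<le> ennreal (exp (- t\<^sup>2 / (2 * V)))"
  proof (intro ennreal_leI, simp)
    have "c\<^sup>2 * v / 2 \<le> c\<^sup>2 * V / 2" using v by (intro divide_right_mono mult_left_mono) auto
    also have "- (c * t) + c\<^sup>2 * V / 2 = - (t\<^sup>2 / (2 * V))" using V by (simp add: c_def power2_eq_square field_simps)
    finally show "c\<^sup>2 * v / 2 - c * t \<le> - (t\<^sup>2 / (2 * V))" by simp
  qed
  finally show ?thesis .
qed

lemma (in prob_space) distr_Pair_indep:
  assumes X[measurable]: "X \<in> M \<rightarrow>\<^sub>M N" and E[measurable]: "E \<in> M \<rightarrow>\<^sub>M T"
    and ind: "indep_set {X -` A \<inter> space M |A. A \<in> sets N} {E -` B \<inter> space M |B. B \<in> sets T}"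
  shows "distr M N X \<Otimes>\<^sub>M distr M T E = distr M (N \<Otimes>\<^sub>M T) (\<lambda>\<omega>. (X \<omega>, E \<omega>))"
proof (rule pair_measure_eqI)
  show "sigma_finite_measure (distr M N X)" "sigma_finite_measure (distr M T E)"
    using prob_space_distr[OF X] prob_space_distr[OF E] by (simp_all add: prob_space_imp_sigma_finite)
  show "sets (distr M N X \<Otimes>\<^sub>M distr M T E) = sets (distr M (N \<Otimes>\<^sub>M T) (\<lambda>\<omega>. (X \<omega>, E \<omega>)))"
    by (simp cong: sets_pair_measure_cong)
  fix A B assume "A \<in> sets (distr M N X)" "B \<in> sets (distr M T E)"
  then have A: "A \<in> sets N" and B: "B \<in> sets T" by simp_all
  have "prob ((X -` A \<inter> space M) \<inter> (E -` B \<inter> space M)) = prob (X -` A \<inter> space M) * prob (E -` B \<inter> space M)"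
    using ind by (rule indep_setD) (use A B in auto)
  moreover have "(\<lambda>\<omega>. (X \<omega>, E \<omega>)) -` (A \<times> B) \<inter> space M = (X -` A \<inter> space M) \<inter> (E -` B \<inter> space M)" by auto
  ultimately show "emeasure (distr M N X) A * emeasure (distr M T E) B =
       emeasure (distr M (N \<Otimes>\<^sub>M T) (\<lambda>\<omega>. (X \<omega>, E \<omega>))) (A \<times> B)"
    using A B by (simp add: emeasure_distr emeasure_eq_measure ennreal_mult)
qed

text \<open>Freezing: under independence the law of \<open>f X E\<close> given \<open>X = x\<close>
  is the law of \<open>f x E\<close>. Fubini on the product law makes this precise.\<close>

lemma (in prob_space) indep_kernel_formula:
  assumes X[measurable]: "X \<in> M \<rightarrow>\<^sub>M N" and E[measurable]: "E \<in> M \<rightarrow>\<^sub>M T"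
    and ind: "indep_set {X -` A \<inter> space M |A. A \<in> sets N} {E -` B \<inter> space M |B. B \<in> sets T}"
    and f[measurable]: "(\<lambda>(x, e). f x e) \<in> N \<Otimes>\<^sub>M T \<rightarrow>\<^sub>M R"
    and A[measurable]: "A \<in> sets N" and B[measurable]: "B \<in> sets R"
  shows "emeasure M {\<omega> \<in> space M. X \<omega> \<in> A \<and> f (X \<omega>) (E \<omega>) \<in> B} =
    (\<integral>\<^sup>+x\<in>A. emeasure (distr (distr M T E) R (f x)) B \<partial>distr M N X)"
proof -
  interpret E: prob_space "distr M T E" by (rule prob_space_distr) simp
  define S where "S = {z \<in> space (N \<Otimes>\<^sub>M T). fst z \<in> A \<and> (\<lambda>(x, e). f x e) z \<in> B}"
  have S: "S \<in> sets (N \<Otimes>\<^sub>M T)" unfolding S_def by measurable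
  have S': "S \<in> sets (distr M N X \<Otimes>\<^sub>M distr M T E)" using S by (simp cong: sets_pair_measure_cong)
  have "{\<omega> \<in> space M. X \<omega> \<in> A \<and> f (X \<omega>) (E \<omega>) \<in> B} = (\<lambda>\<omega>. (X \<omega>, E \<omega>)) -` S \<inter> space M"
    using measurable_space[OF X] measurable_space[OF E] by (auto simp: S_def space_pair_measure)
  then have "emeasure M {\<omega> \<in> space M. X \<omega> \<in> A \<and> f (X \<omega>) (E \<omega>) \<in> B} =
      emeasure (distr M N X \<Otimes>\<^sub>M distr M T E) S"
    unfolding distr_Pair_indep[OF X E ind] using S by (simp add: emeasure_distr)
  also have "\<dots> = (\<integral>\<^sup>+x. emeasure (distr M T E) (Pair x -` S) \<partial>distr M N X)"
    by (rule E.emeasure_pair_measure_alt[OF S'])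
  also have "\<dots> = (\<integral>\<^sup>+x. emeasure (distr (distr M T E) R (f x)) B * indicator A x \<partial>distr M N X)"
  proof (rule nn_integral_cong)
    fix x assume "x \<in> space (distr M N X)"
    then have x[measurable]: "x \<in> space N" by simp
    have fx: "f x \<in> T \<rightarrow>\<^sub>M R" using measurable_Pair2[OF f x] by simp
    show "emeasure (distr M T E) (Pair x -` S) = emeasure (distr (distr M T E) R (f x)) B * indicator A x"
    proof (cases "x \<in> A")
      case True
      then have "Pair x -` S = f x -` B \<inter> space T" using x by (auto simp: S_def space_pair_measure)
      then show ?thesis using True fx B by (simp add: emeasure_distr[of "f x"])
    next
      case False
      then have "Pair x -` S = {}" by (auto simp: S_def)
      then show ?thesis using False by simp
    qed
  qed
  finally show ?thesis .
qed

section \<open>The regression model\<close>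

locale sgl =
  fixes \<kappa> cmin Cmax c C :: real and M :: "'a measure" and n p :: nat and P :: "nat set set" and s sg :: nat
    and \<sigma> :: real and S :: "real mat" and \<beta> :: "real Matrix.vec" and X :: "'a \<Rightarrow> real mat"
    and \<epsilon> Y \<beta>hat :: "'a \<Rightarrow> real Matrix.vec" and mhat :: "real mat \<Rightarrow> nat \<Rightarrow> real Matrix.vec"
  assumes model: "sgl_model \<kappa> cmin Cmax c C M n p P s sg \<sigma> S \<beta> X \<epsilon> Y \<beta>hat mhat"
    and const_pos: "0 < \<kappa>" "0 < cmin" "cmin \<le> Cmax" "0 < C"
begin

sublocale prob_space M using model by (simp add: sgl_model_def)

abbreviation "cplx \<equiv> complexity P s sg"
abbreviation "cplxe \<equiv> complexity_e P s sg"
abbreviation "b \<equiv> max_group_size P"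
abbreviation "d \<equiv> card P"
abbreviation "lam \<equiv> lasso_param C \<sigma> n P s sg"
abbreviation "lamg \<equiv> group_param C \<sigma> n P s sg"
abbreviation "\<alpha> \<equiv> alpha_param C \<sigma> n P s sg"
abbreviation "\<gamma> \<equiv> gamma_param C \<sigma> n P s sg"

definition r :: real where "r = real s / real sg"

lemma n_pos: "0 < n" and \<sigma>_pos: "0 < \<sigma>" and part: "partition_on {..<p} P"
  and \<beta>_carrier: "\<beta> \<in> carrier_vec p" and \<beta>_sparse: "sparse P s sg \<beta>"
  and design: "subgaussian_design \<kappa> cmin Cmax M n p S X" and noise: "gaussian_noise M n p \<sigma> X \<epsilon>"
  and Y_eq: "\<And>\<omega>. \<omega> \<in> space M \<Longrightarrow> Y \<omega> = X \<omega> *\<^sub>v \<beta> + \<epsilon> \<omega>"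
  and \<beta>hat_meas: "\<beta>hat \<in> M \<rightarrow>\<^sub>M vec_borel p"
  and \<beta>hat: "\<And>\<omega>. \<omega> \<in> space M \<Longrightarrow> is_sparse_group_lasso P lam lamg (X \<omega>) (Y \<omega>) (\<beta>hat \<omega>)"
  and mhat_meas: "\<And>i. i < p \<Longrightarrow> (\<lambda>A. mhat A i) \<in> mat_borel n p \<rightarrow>\<^sub>M vec_borel p"
  and mhat: "\<And>\<omega> i m. \<omega> \<in> space M \<Longrightarrow> i < p \<Longrightarrow> debias_feasible P \<alpha> \<gamma> (X \<omega>) i m \<Longrightarrow>
        is_debias_solution P \<alpha> \<gamma> (X \<omega>) i (mhat (X \<omega>) i)"
  and levels: "sparsity_levels P s sg"
  using model unfolding sgl_model_def by blast+

lemma sg_pos: "0 < sg" and s_pos: "0 < s" and sg_le_s: "sg \<le> s" and sg_le_d: "sg \<le> d"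
  using levels by (auto simp: sparsity_levels_def)

lemma finite_P: "finite P" using part by (rule finite_elements[rotated]) simp

lemma group_subset: "g \<in> P \<Longrightarrow> g \<subseteq> {..<p}" and finite_group: "g \<in> P \<Longrightarrow> finite g"
  and Union_P: "\<Union>P = {..<p}"
  using part by (auto simp: partition_on_def intro: finite_subset)

lemma P_nonempty: "P \<noteq> {}" using sg_pos sg_le_d by auto

lemma card_group_le: "g \<in> P \<Longrightarrow> card g \<le> b"
  unfolding max_group_size_def using finite_P by (intro Max_ge) auto

lemma b_pos: "1 \<le> b"
proof -
  obtain g where g: "g \<in> P" using P_nonempty by auto
  then have "g \<noteq> {}" using part by (auto simp: partition_on_def)
  then have "0 < card g" using finite_group[OF g] by (simp add: card_gt_0_iff)
  then show ?thesis using card_group_le[OF g] by simp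
qed

lemma p_le: "p \<le> d * b"
proof -
  have "p = (\<Sum>i\<in>{..<p}. 1)" by simp
  also have "\<dots> = (\<Sum>g\<in>P. card g)"
    using card_Union_disjoint[of P] part finite_group by (simp add: partition_on_def disjoint_def pairwise_def disjnt_def)
  also have "\<dots> \<le> (\<Sum>g\<in>P. b)" by (intro sum_mono card_group_le)
  finally show ?thesis by simp
qed

lemma p_pos: "0 < p"
proof -
  obtain g where "g \<in> P" using P_nonempty by auto
  moreover from this have "g \<noteq> {}" using part by (auto simp: partition_on_def)
  ultimately show ?thesis using group_subset by fastforce
qed

lemma r_ge1: "1 \<le> r" and r_le_s: "r \<le> real s"
  using sg_pos sg_le_s by (auto simp: r_def field_simps)

lemma X_meas: "X \<in> M \<rightarrow>\<^sub>M mat_borel n p" and S_carrier: "S \<in> carrier_mat p p"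
  and \<epsilon>_meas: "\<epsilon> \<in> M \<rightarrow>\<^sub>M vec_borel n"
  using design noise by (auto simp: subgaussian_design_def gaussian_noise_def)

lemma X_carrier: "\<omega> \<in> space M \<Longrightarrow> X \<omega> \<in> carrier_mat n p"
  and \<epsilon>_carrier: "\<omega> \<in> space M \<Longrightarrow> \<epsilon> \<omega> \<in> carrier_vec n"
  and \<beta>hat_carrier: "\<omega> \<in> space M \<Longrightarrow> \<beta>hat \<omega> \<in> carrier_vec p"
  and mhat_carrier: "\<omega> \<in> space M \<Longrightarrow> i < p \<Longrightarrow> mhat (X \<omega>) i \<in> carrier_vec p"
  using measurable_space[OF X_meas] measurable_space[OF \<epsilon>_meas] measurable_space[OF \<beta>hat_meas]
    measurable_space[OF mhat_meas] by (auto simp: space_vec_borel space_mat_borel)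

lemma S_sym: "transpose_mat S = S"
proof (rule eq_matI)
  fix i j assume "i < dim_row S" "j < dim_col S"
  then have ij: "i < p" "j < p" using S_carrier by auto
  have "S $$ (i, j) = (\<integral>\<omega>. X \<omega> $$ (0, i) * X \<omega> $$ (0, j) \<partial>M)" if "i < p" "j < p" for i j
    using design n_pos that by (simp add: subgaussian_design_def)
  from this[OF ij] this[OF ij(2,1)] have "S $$ (j, i) = S $$ (i, j)" by (simp add: mult.commute)
  then show "transpose_mat S $$ (i, j) = S $$ (i, j)" using ij S_carrier by simp
qed (use S_carrier in auto)

lemma S_bounds:
  assumes "v \<in> carrier_vec p"
  shows "cmin * (v \<bullet> v) \<le> v \<bullet> (S *\<^sub>v v)" "v \<bullet> (S *\<^sub>v v) \<le> Cmax * (v \<bullet> v)"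
  using spectrum_quadratic_form_bounds[OF S_carrier S_sym p_pos _ _ assms, of cmin Cmax] design
  by (auto simp: subgaussian_design_def)

lemma S_bounds_fun:
  shows "cmin * (\<Sum>i<p. (v i)\<^sup>2) \<le> (\<Sum>i<p. \<Sum>j<p. v i * S $$ (i, j) * v j)"
    "(\<Sum>i<p. \<Sum>j<p. v i * S $$ (i, j) * v j) \<le> Cmax * (\<Sum>i<p. (v i)\<^sup>2)"
  using S_bounds[of "Matrix.vec p v"] scalar_prod_mult_mat_vec[OF S_carrier, of "Matrix.vec p v" "Matrix.vec p v"]
    scalar_prod_self(1)[of "Matrix.vec p v" p] by simp_all

section \<open>Sample covariance and its deviation along fixed directions\<close>

definition H :: "'a \<Rightarrow> nat \<Rightarrow> nat \<Rightarrow> real" where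
  "H \<omega> i j = (\<Sum>k<n. Matrix.row (X \<omega>) k $ i * Matrix.row (X \<omega>) k $ j) / real n"

definition Bdev :: "'a \<Rightarrow> nat \<Rightarrow> nat \<Rightarrow> real" where
  "Bdev \<omega> i j = H \<omega> i j - S $$ (i, j)"

definition bil :: "'a \<Rightarrow> (nat \<Rightarrow> real) \<Rightarrow> (nat \<Rightarrow> real) \<Rightarrow> real" where
  "bil \<omega> u v = (\<Sum>i<p. \<Sum>j<p. u i * Bdev \<omega> i j * v j)"

lemma row_nth: "\<omega> \<in> space M \<Longrightarrow> k < n \<Longrightarrow> i < p \<Longrightarrow> Matrix.row (X \<omega>) k $ i = X \<omega> $$ (k, i)"
  using X_carrier[of \<omega>] by simp

lemma sample_cov_carrier: "\<omega> \<in> space M \<Longrightarrow> sample_cov (X \<omega>) \<in> carrier_mat p p"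
  using X_carrier[of \<omega>] by (simp add: sample_cov_def)

lemma H_eq_sample_cov: "\<omega> \<in> space M \<Longrightarrow> i < p \<Longrightarrow> j < p \<Longrightarrow> H \<omega> i j = sample_cov (X \<omega>) $$ (i, j)"
  using X_carrier[of \<omega>] n_pos
  by (auto simp: H_def sample_cov_def scalar_prod_def atLeast0LessThan sum_divide_distrib row_nth intro!: sum.cong)

lemma meas_row[measurable]: "k < n \<Longrightarrow> i < p \<Longrightarrow> (\<lambda>\<omega>. Matrix.row (X \<omega>) k $ i) \<in> borel_measurable M"
proof -
  assume k: "k < n" "i < p"
  have "(\<lambda>\<omega>. X \<omega> $$ (k, i)) \<in> borel_measurable M"
    by (rule measurable_compose[OF X_meas measurable_mat_nth[OF k]])
  then show ?thesis by (rule measurable_cong[THEN iffD1, rotated]) (simp add: row_nth k)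
qed

lemma meas_Bdev[measurable]: "i < p \<Longrightarrow> j < p \<Longrightarrow> (\<lambda>\<omega>. Bdev \<omega> i j) \<in> borel_measurable M"
  unfolding Bdev_def H_def by measurable

lemma meas_bil[measurable]: "(\<lambda>\<omega>. bil \<omega> u v) \<in> borel_measurable M"
  unfolding bil_def by measurable

text \<open>The form as an average over rows: nonnegative on the diagonal, where it is a mean of
  squares of independent projections.\<close>

lemma H_quadratic: "(\<Sum>i<p. \<Sum>j<p. u i * H \<omega> i j * v j) =
    (\<Sum>k<n. (\<Sum>i<p. u i * Matrix.row (X \<omega>) k $ i) * (\<Sum>j<p. v j * Matrix.row (X \<omega>) k $ j)) / real n"
proof -
  have "(\<Sum>k<n. (\<Sum>i<p. u i * Matrix.row (X \<omega>) k $ i) * (\<Sum>j<p. v j * Matrix.row (X \<omega>) k $ j)) =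
        (\<Sum>k<n. \<Sum>i<p. \<Sum>j<p. u i * (Matrix.row (X \<omega>) k $ i * Matrix.row (X \<omega>) k $ j) * v j)"
    by (simp add: sum_product mult_ac)
  also have "\<dots> = (\<Sum>i<p. \<Sum>k<n. \<Sum>j<p. u i * (Matrix.row (X \<omega>) k $ i * Matrix.row (X \<omega>) k $ j) * v j)"
    by (rule sum.swap)
  also have "\<dots> = (\<Sum>i<p. \<Sum>j<p. \<Sum>k<n. u i * (Matrix.row (X \<omega>) k $ i * Matrix.row (X \<omega>) k $ j) * v j)"
    by (intro sum.cong refl sum.swap)
  finally show ?thesis
    by (simp add: H_def sum_distrib_left sum_distrib_right sum_divide_distrib)
qed

lemma bil_eq: "bil \<omega> u v = (\<Sum>i<p. \<Sum>j<p. u i * H \<omega> i j * v j) - (\<Sum>i<p. \<Sum>j<p. u i * S $$ (i, j) * v j)"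
  by (simp add: bil_def Bdev_def algebra_simps sum_subtractf)

text \<open>Sub-Gaussian parameter of the projection of a row on a vector of norm at most one;
  \<open>Cmax\<close> bounds the second moment of that projection, hence the rate
  \<open>c0\<close>.\<close>

definition \<tau> :: real where "\<tau> = \<kappa> * sqrt Cmax"
definition c0 :: real where "c0 = bern_c \<tau> Cmax"

lemma \<tau>_pos: "0 < \<tau>" and c0_pos: "0 < c0"
proof -
  show "0 < \<tau>" using const_pos by (simp add: \<tau>_def)
  then show "0 < c0" unfolding c0_def by (rule bern_pos(3))
qed

text \<open>The moment assumption concerns whitened rows. With \<open>R\<close> the inverse square
  root of \<open>S\<close>, the vector \<open>u\<close> undoes the whitening:
  \<open>R *\<^sub>v u\<close> is \<open>\<theta> \<cdot>\<^sub>v a\<close>, and the squared norm of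
  \<open>u\<close> is \<open>\<theta>\<^sup>2 * (a \<bullet> (S *\<^sub>v a))\<close>, at most
  \<open>\<theta>\<^sup>2 * Cmax\<close>.\<close>

lemma row_mgf:
  assumes k: "k < n" and v: "(\<Sum>i<p. (v i)\<^sup>2) \<le> 1"
  shows "(\<integral>\<^sup>+\<omega>. ennreal (exp (\<theta> * (\<Sum>i<p. v i * Matrix.row (X \<omega>) k $ i))) \<partial>M) \<le> ennreal (exp (\<tau>\<^sup>2 * \<theta>\<^sup>2 / 2))"
proof -
  have "\<exists>R. is_inv_sqrt_mat p S R \<and>
        (\<forall>k<n. \<forall>v\<in>carrier_vec p.
           integrable M (\<lambda>\<omega>. exp (v \<bullet> (R *\<^sub>v Matrix.row (X \<omega>) k))) \<and>
           (\<integral>\<omega>. exp (v \<bullet> (R *\<^sub>v Matrix.row (X \<omega>) k)) \<partial>M) \<le> exp (\<kappa>\<^sup>2 * (norm_2 v)\<^sup>2 / 2))"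
    using design unfolding subgaussian_design_def by (elim conjE)
  then obtain R where R: "is_inv_sqrt_mat p S R" and
    I: "\<And>k v. k < n \<Longrightarrow> v \<in> carrier_vec p \<Longrightarrow> integrable M (\<lambda>\<omega>. exp (v \<bullet> (R *\<^sub>v Matrix.row (X \<omega>) k))) \<and>
           (\<integral>\<omega>. exp (v \<bullet> (R *\<^sub>v Matrix.row (X \<omega>) k)) \<partial>M) \<le> exp (\<kappa>\<^sup>2 * (norm_2 v)\<^sup>2 / 2)"
    by (elim exE conjE) simp
  have Rc: "R \<in> carrier_mat p p" "transpose_mat R = R" and RRS: "R * R * S = 1\<^sub>m p"
    using R by (auto simp: is_inv_sqrt_mat_def)
  define a where "a = Matrix.vec p v"
  have a: "a \<in> carrier_vec p" by (simp add: a_def)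
  define u where "u = R *\<^sub>v (S *\<^sub>v (\<theta> \<cdot>\<^sub>v a))"
  have Sa: "S *\<^sub>v (\<theta> \<cdot>\<^sub>v a) \<in> carrier_vec p" using S_carrier a by auto
  have u: "u \<in> carrier_vec p" using Rc Sa by (auto simp: u_def)
  have Ru: "R *\<^sub>v u = \<theta> \<cdot>\<^sub>v a"
  proof -
    have "R *\<^sub>v u = (R * R * S) *\<^sub>v (\<theta> \<cdot>\<^sub>v a)"
      unfolding u_def using Rc(1) S_carrier a Sa by (simp add: assoc_mult_mat_vec[of _ p p _ p])
    then show ?thesis using a by (simp add: RRS)
  qed
  have norm: "(norm_2 u)\<^sup>2 = u \<bullet> u"
    using u by (simp add: norm_2_def L2_set_def sum_nonneg scalar_prod_self(1))
  also have "\<dots> = (R *\<^sub>v u) \<bullet> (S *\<^sub>v (\<theta> \<cdot>\<^sub>v a))"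
    using symmetric_scalar_prod(1)[OF Rc u Sa] by (simp add: u_def)
  also have "\<dots> = \<theta>\<^sup>2 * (a \<bullet> (S *\<^sub>v a))"
    unfolding Ru using S_carrier a by (simp add: mult_mat_vec[of _ p p] power2_eq_square)
  also have "\<dots> \<le> \<theta>\<^sup>2 * (Cmax * (a \<bullet> a))" by (intro mult_left_mono S_bounds a) auto
  also have "\<dots> \<le> \<theta>\<^sup>2 * (Cmax * 1)"
    using v const_pos a scalar_prod_self(1)[OF a] by (intro mult_left_mono) (auto simp: a_def)
  finally have nu: "(norm_2 u)\<^sup>2 \<le> \<theta>\<^sup>2 * Cmax" by simp
  have eq: "u \<bullet> (R *\<^sub>v Matrix.row (X \<omega>) k) = \<theta> * (\<Sum>i<p. v i * Matrix.row (X \<omega>) k $ i)" if \<omega>: "\<omega> \<in> space M" for \<omega>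
  proof -
    have row: "Matrix.row (X \<omega>) k \<in> carrier_vec p" using X_carrier[OF \<omega>] by (metis carrier_matD(2) row_carrier)
    have "u \<bullet> (R *\<^sub>v Matrix.row (X \<omega>) k) = (\<theta> \<cdot>\<^sub>v a) \<bullet> Matrix.row (X \<omega>) k"
      using symmetric_scalar_prod(1)[OF Rc u row] by (simp add: Ru)
    also have "\<dots> = \<theta> * (a \<bullet> Matrix.row (X \<omega>) k)" using a row by simp
    also have "a \<bullet> Matrix.row (X \<omega>) k = (\<Sum>i<p. v i * Matrix.row (X \<omega>) k $ i)"
      using X_carrier[OF \<omega>] by (auto simp: scalar_prod_def a_def atLeast0LessThan intro!: sum.cong)
    finally show ?thesis .
  qed
  have "(\<integral>\<^sup>+\<omega>. ennreal (exp (\<theta> * (\<Sum>i<p. v i * Matrix.row (X \<omega>) k $ i))) \<partial>M) =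
        (\<integral>\<^sup>+\<omega>. ennreal (exp (u \<bullet> (R *\<^sub>v Matrix.row (X \<omega>) k))) \<partial>M)"
    by (intro nn_integral_cong) (simp add: eq)
  also have "\<dots> = ennreal (\<integral>\<omega>. exp (u \<bullet> (R *\<^sub>v Matrix.row (X \<omega>) k)) \<partial>M)"
    using I[OF k u] by (intro nn_integral_eq_integral) auto
  also have "\<dots> \<le> ennreal (exp (\<kappa>\<^sup>2 * (norm_2 u)\<^sup>2 / 2))" using I[OF k u] by (intro ennreal_leI) auto
  also have "\<dots> \<le> ennreal (exp (\<tau>\<^sup>2 * \<theta>\<^sup>2 / 2))"
  proof (intro ennreal_leI, simp)
    have "\<kappa>\<^sup>2 * (norm_2 u)\<^sup>2 \<le> \<kappa>\<^sup>2 * (\<theta>\<^sup>2 * Cmax)" by (intro mult_left_mono nu) auto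
    also have "\<dots> = \<tau>\<^sup>2 * \<theta>\<^sup>2" using const_pos by (simp add: \<tau>_def power_mult_distrib)
    finally show "\<kappa>\<^sup>2 * (norm_2 u)\<^sup>2 \<le> \<tau>\<^sup>2 * \<theta>\<^sup>2" .
  qed
  finally show ?thesis .
qed

text \<open>\<open>bil \<omega> v v\<close> is the centered mean of the squares of the projections
  \<open>Z k\<close>, to which the Bernstein bound applies.\<close>

lemma quadratic_tail:
  assumes v: "(\<Sum>i<p. (v i)\<^sup>2) \<le> 1" and t: "0 < t" "t \<le> 1"
  shows "prob {\<omega> \<in> space M. \<bar>bil \<omega> v v\<bar> \<ge> t} \<le> 2 * exp (- c0 * real n * t\<^sup>2)"
proof -
  define Z where "Z k \<omega> = (\<Sum>i<p. v i * Matrix.row (X \<omega>) k $ i)" for k \<omega>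
  define q where "q = (\<Sum>i<p. \<Sum>j<p. v i * S $$ (i, j) * v j)"
  have rows: "indep_vars (\<lambda>_. vec_borel p) (\<lambda>k \<omega>. Matrix.row (X \<omega>) k) {..<n}"
    using design by (simp add: subgaussian_design_def)
  have "(\<lambda>x. \<Sum>i<p. v i * x $ i) \<in> borel_measurable (vec_borel p)"
    by (intro borel_measurable_sum borel_measurable_times borel_measurable_const measurable_vec_nth) auto
  then have ind: "indep_vars (\<lambda>_. borel) Z {..<n}"
    unfolding Z_def by (intro indep_vars_compose2[OF rows, where Y="\<lambda>_ x. \<Sum>i<p. v i * x $ i"])
  have Z2: "(Z k \<omega>)\<^sup>2 = (\<Sum>i<p. \<Sum>j<p. v i * v j * (X \<omega> $$ (k, i) * X \<omega> $$ (k, j)))" if "k < n" "\<omega> \<in> space M" for k \<omega>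
    using that by (simp add: Z_def power2_eq_square sum_product row_nth mult_ac)
  have mom: "integrable M (\<lambda>\<omega>. X \<omega> $$ (k, i) * X \<omega> $$ (k, j))"
      "(\<integral>\<omega>. X \<omega> $$ (k, i) * X \<omega> $$ (k, j) \<partial>M) = S $$ (i, j)" if "k < n" "i < p" "j < p" for i j k
    using design that by (auto simp: subgaussian_design_def)
  have term_int: "integrable M (\<lambda>\<omega>. v i * v j * (X \<omega> $$ (k, i) * X \<omega> $$ (k, j)))" if "k < n" "i < p" "j < p" for i j k
    by (intro integrable_mult_right mom that)
  have int: "integrable M (\<lambda>\<omega>. (Z k \<omega>)\<^sup>2)" if "k < n" for k
    using that by (subst Bochner_Integration.integrable_cong[OF refl Z2])
      (auto intro!: Bochner_Integration.integrable_sum term_int simp del: integrable_mult_right_iff)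
  have Eq: "expectation (\<lambda>\<omega>. (Z k \<omega>)\<^sup>2) = q" if k: "k < n" for k
  proof -
    have "expectation (\<lambda>\<omega>. (Z k \<omega>)\<^sup>2) = expectation (\<lambda>\<omega>. \<Sum>i<p. \<Sum>j<p. v i * v j * (X \<omega> $$ (k, i) * X \<omega> $$ (k, j)))"
      using k by (intro Bochner_Integration.integral_cong) (auto simp: Z2)
    also have "\<dots> = (\<Sum>i<p. expectation (\<lambda>\<omega>. \<Sum>j<p. v i * v j * (X \<omega> $$ (k, i) * X \<omega> $$ (k, j))))"
      by (rule Bochner_Integration.integral_sum) (intro Bochner_Integration.integrable_sum term_int, auto simp: k)
    also have "\<dots> = (\<Sum>i<p. \<Sum>j<p. expectation (\<lambda>\<omega>. v i * v j * (X \<omega> $$ (k, i) * X \<omega> $$ (k, j))))"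
      by (rule sum.cong[OF refl], rule Bochner_Integration.integral_sum) (intro term_int, auto simp: k)
    also have "\<dots> = (\<Sum>i<p. \<Sum>j<p. v i * v j * S $$ (i, j))"
      using k by (intro sum.cong refl) (simp add: mom)
    finally show ?thesis by (simp add: q_def mult_ac)
  qed
  have "q \<le> Cmax * (\<Sum>i<p. (v i)\<^sup>2)" unfolding q_def by (rule S_bounds_fun)
  also have "\<dots> \<le> Cmax * 1" using v const_pos by (intro mult_left_mono) auto
  finally have q: "q \<le> Cmax" by simp
  have "(\<Sum>k<n. (Z k \<omega>)\<^sup>2) / real n - q = bil \<omega> v v" for \<omega>
    unfolding bil_eq H_quadratic q_def Z_def by (simp add: power2_eq_square)
  then show ?thesis
    using sum_squares_tail[OF ind n_pos \<tau>_pos _ int Eq q t] row_mgf[OF _ v] by (simp add: Z_def c0_def)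
qed

lemma bil_linear: "bil \<omega> (\<lambda>i. x * u i + y * v i) w = x * bil \<omega> u w + y * bil \<omega> v w"
    "bil \<omega> w (\<lambda>i. x * u i + y * v i) = x * bil \<omega> w u + y * bil \<omega> w v"
  by (simp_all add: bil_def algebra_simps sum.distrib sum_distrib_left)

lemma bil_commute: "bil \<omega> u v = bil \<omega> v u"
proof -
  have "Bdev \<omega> i j = Bdev \<omega> j i" if "i < p" "j < p" for i j
    using symmetric_entries[OF S_carrier S_sym that] by (simp add: Bdev_def H_def mult.commute)
  then have "bil \<omega> u v = (\<Sum>i<p. \<Sum>j<p. v j * Bdev \<omega> j i * u i)"
    unfolding bil_def by (intro sum.cong) (auto simp: mult_ac)
  then show ?thesis unfolding bil_def by (subst (asm) sum.swap)
qed

text \<open>Polarisation reduces the bilinear form to two quadratic forms in vectors of norm at most one.\<close>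

lemma bilinear_tail:
  assumes u: "(\<Sum>i<p. (u i)\<^sup>2) \<le> R\<^sup>2" and v: "(\<Sum>i<p. (v i)\<^sup>2) \<le> R'\<^sup>2" and R: "0 < R" "0 < R'" and t: "0 < t" "t \<le> 1"
  shows "prob {\<omega> \<in> space M. \<bar>bil \<omega> u v\<bar> \<ge> 2 * R * R' * t} \<le> 4 * exp (- c0 * real n * t\<^sup>2)"
proof -
  \<comment> \<open>Half the sum or difference of the normalised vectors; scaling by
    \<open>R\<close> and \<open>R'\<close> separately keeps both within the unit ball.\<close>
  define y where "y e i = 1 / (2 * R) * u i + e / (2 * R') * v i" for e i
  have sq: "(\<Sum>i<p. (y e i)\<^sup>2) \<le> 1" if e: "\<bar>e\<bar> = 1" for e
  proof -
    have "(\<Sum>i<p. (y e i)\<^sup>2) \<le> (\<Sum>i<p. 1 / (2 * R\<^sup>2) * (u i)\<^sup>2 + 1 / (2 * R'\<^sup>2) * (v i)\<^sup>2)"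
    proof (rule sum_mono)
      fix i
      have "(x + z)\<^sup>2 \<le> 2 * x\<^sup>2 + 2 * z\<^sup>2" for x z :: real
        using sum_squares_bound[of x z] by (simp add: power2_sum)
      then have "(y e i)\<^sup>2 \<le> 2 * (1 / (2 * R) * u i)\<^sup>2 + 2 * (e / (2 * R') * v i)\<^sup>2" unfolding y_def .
      also have "\<dots> = 1 / (2 * R\<^sup>2) * (u i)\<^sup>2 + e\<^sup>2 / (2 * R'\<^sup>2) * (v i)\<^sup>2" by (simp add: power_mult_distrib power_divide)
      also have "e\<^sup>2 = 1" using e by (metis power2_abs power_one)
      finally show "(y e i)\<^sup>2 \<le> 1 / (2 * R\<^sup>2) * (u i)\<^sup>2 + 1 / (2 * R'\<^sup>2) * (v i)\<^sup>2" .
    qed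
    also have "\<dots> = 1 / (2 * R\<^sup>2) * (\<Sum>i<p. (u i)\<^sup>2) + 1 / (2 * R'\<^sup>2) * (\<Sum>i<p. (v i)\<^sup>2)"
      by (simp add: sum.distrib sum_distrib_left)
    also have "\<dots> \<le> 1 / (2 * R\<^sup>2) * R\<^sup>2 + 1 / (2 * R'\<^sup>2) * R'\<^sup>2" using u v by (intro add_mono mult_left_mono) auto
    also have "\<dots> = 1" using R by simp
    finally show ?thesis .
  qed
  let ?A = "\<lambda>e. {\<omega> \<in> space M. \<bar>bil \<omega> (y e) (y e)\<bar> \<ge> t}"
  have A: "?A e \<in> events" for e by measurable
  have pol: "bil \<omega> u v = R * R' * (bil \<omega> (y 1) (y 1) - bil \<omega> (y (-1)) (y (-1)))" for \<omega>
  proof -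
    have ye: "bil \<omega> (y e) (y e) = (1 / (2 * R))\<^sup>2 * bil \<omega> u u + 2 * (1 / (2 * R)) * (e / (2 * R')) * bil \<omega> u v + (e / (2 * R'))\<^sup>2 * bil \<omega> v v" for e
      unfolding y_def bil_linear using bil_commute[of \<omega> v u] by (simp add: power2_eq_square algebra_simps)
    have "bil \<omega> (y 1) (y 1) - bil \<omega> (y (-1)) (y (-1)) = bil \<omega> u v / (R * R')"
      unfolding ye by simp
    then show ?thesis using R by simp
  qed
  have "{\<omega> \<in> space M. \<bar>bil \<omega> u v\<bar> \<ge> 2 * R * R' * t} \<subseteq> ?A 1 \<union> ?A (-1)"
  proof safe
    fix \<omega> assume h: "2 * R * R' * t \<le> \<bar>bil \<omega> u v\<bar>" "\<not> t \<le> \<bar>bil \<omega> (y (-1)) (y (-1))\<bar>"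
    show "t \<le> \<bar>bil \<omega> (y 1) (y 1)\<bar>"
    proof (rule ccontr)
      assume "\<not> t \<le> \<bar>bil \<omega> (y 1) (y 1)\<bar>"
      with h have "\<bar>bil \<omega> (y 1) (y 1) - bil \<omega> (y (-1)) (y (-1))\<bar> < 2 * t" by linarith
      then have "R * R' * \<bar>bil \<omega> (y 1) (y 1) - bil \<omega> (y (-1)) (y (-1))\<bar> < R * R' * (2 * t)"
        using R by (intro mult_strict_left_mono) auto
      then show False using h R by (simp add: pol abs_mult mult_ac)
    qed
  qed
  then have "prob {\<omega> \<in> space M. \<bar>bil \<omega> u v\<bar> \<ge> 2 * R * R' * t} \<le> prob (?A 1 \<union> ?A (-1))"
    by (intro finite_measure_mono sets.Un A)
  also have "\<dots> \<le> prob (?A 1) + prob (?A (-1))" by (intro measure_Un_le A)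
  also have "\<dots> \<le> 2 * exp (- c0 * real n * t\<^sup>2) + 2 * exp (- c0 * real n * t\<^sup>2)"
    by (intro add_mono quadratic_tail sq t) auto
  finally show ?thesis by simp
qed

end

lemma (in prob_space) union_bound:
  assumes "finite T" "\<And>x. x \<in> T \<Longrightarrow> A x \<in> events" "\<And>x. x \<in> T \<Longrightarrow> prob (A x) \<le> q" "real (card T) \<le> N" "0 \<le> q"
  shows "prob (\<Union>x\<in>T. A x) \<le> N * q"
proof -
  have "prob (\<Union>x\<in>T. A x) \<le> (\<Sum>x\<in>T. prob (A x))"
    using assms by (intro finite_measure_subadditive_finite) auto
  also have "\<dots> \<le> real (card T) * q" using assms by (intro sum_bounded_above) auto
  also have "\<dots> \<le> N * q" using assms by (intro mult_right_mono)
  finally show ?thesis .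
qed

lemma exists_inverse_image_unit:
  fixes S R :: "real mat"
  assumes R: "R \<in> carrier_mat p p" and S: "S \<in> carrier_mat p p" and RRS: "R * R * S = 1\<^sub>m p" and i: "i < p"
  shows "\<exists>m\<in>carrier_vec p. S *\<^sub>v m = unit_vec p i"
proof -
  have "S * (R * R) = 1\<^sub>m p"
    using mat_mult_left_right_inverse[OF _ S RRS] R by simp
  moreover have "S *\<^sub>v ((R * R) *\<^sub>v unit_vec p i) = (S * (R * R)) *\<^sub>v unit_vec p i"
    by (rule assoc_mult_mat_vec[symmetric, of S p p _ p]) (use R S in auto)
  ultimately have "S *\<^sub>v ((R * R) *\<^sub>v unit_vec p i) = unit_vec p i" by simp
  moreover have "(R * R) *\<^sub>v unit_vec p i \<in> carrier_vec p" using R by auto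
  ultimately show ?thesis by blast
qed

context sgl
begin

section \<open>Arithmetic of the complexity\<close>

definition lnA :: real where "lnA = ln (exp 1 * real sg * real b)"
definition lnd :: real where "lnd = ln (real d / real sg)"

lemma lnA_ge: "1 \<le> lnA" "ln (real sg) \<le> lnA" "ln (exp 1 * real b) \<le> lnA" "lnA = 1 + ln (real sg) + ln (real b)"
  and lnd_ge0: "0 \<le> lnd"
proof -
  show e: "lnA = 1 + ln (real sg) + ln (real b)" using sg_pos b_pos by (simp add: lnA_def ln_mult)
  have "0 \<le> ln (real sg)" "0 \<le> ln (real b)" using sg_pos b_pos by auto
  then show "1 \<le> lnA" "ln (real sg) \<le> lnA" "ln (exp 1 * real b) \<le> lnA" using b_pos by (auto simp: e ln_mult)
  show "0 \<le> lnd" using sg_le_d sg_pos by (auto simp: lnd_def)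
qed

lemma cplx_eq: "cplx = real s * lnA + real sg * lnd"
  and cplxe_eq: "cplxe = real s * lnA + real sg * (1 + lnd)"
  using sg_pos sg_le_d
  by (auto simp: complexity_def complexity_e_def lnA_def lnd_def ln_mult ln_div algebra_simps)

lemma cplx_le_cplxe: "cplx \<le> cplxe" by (simp add: cplx_eq cplxe_eq distrib_left)

lemma cplx_ge_s: "real s \<le> cplx"
  using mult_left_mono[OF lnA_ge(1), of "real s"] mult_nonneg_nonneg[OF _ lnd_ge0, of "real sg"]
  by (simp add: cplx_eq)

lemma cplx_pos: "0 < cplx" and cplxe_ge1: "1 \<le> cplxe"
  using cplx_ge_s cplx_le_cplxe s_pos by linarith+

lemma cplx_div_sg: "cplx / real sg = r * lnA + lnd"
  using sg_pos by (simp add: cplx_eq r_def field_simps)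

lemma cplx_div_le: "cplx / real s \<le> cplx / real sg" "cplx / real s \<le> cplxe" "1 \<le> cplx / real sg" "1 \<le> cplx / real s"
proof -
  show 1: "cplx / real s \<le> cplx / real sg" using sg_le_s sg_pos cplx_pos by (intro divide_left_mono) auto
  have "cplx / real s \<le> cplx / 1" using s_pos cplx_pos by (intro divide_left_mono) auto
  then show "cplx / real s \<le> cplxe" using cplx_le_cplxe by simp
  show "1 \<le> cplx / real s" using cplx_ge_s s_pos by simp
  with 1 show "1 \<le> cplx / real sg" by linarith
qed

text \<open>The \<open>ln sg\<close> hidden in \<open>d = sg * exp lnd\<close> is paid for by
  \<open>r * lnA\<close>, which dominates \<open>lnA\<close> as \<open>r \<ge> 1\<close>. If
  coordinates are counted too, \<open>p \<le> d * b\<close> brings a second factor \<open>d\<close>,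
  and the exponents add up to at most \<open>10 * (r * lnA) + 2 * lnd\<close>.\<close>

lemma count_groups: "real d * exp (8 * r * ln (exp 1 * real b)) \<le> exp (11 * (cplx / real sg))"
  and count_groups_coords: "real p * (real d * exp (8 * r * ln (exp 1 * real b))) \<le> exp (11 * (cplx / real sg))"
proof -
  have d: "real d = exp (lnd + ln (real sg))" using sg_pos sg_le_d by (simp add: lnd_def ln_div)
  have rA: "lnA \<le> r * lnA" using mult_right_mono[OF r_ge1, of lnA] lnA_ge(1) by simp
  have e: "8 * r * ln (exp 1 * real b) \<le> 8 * (r * lnA)" using mult_left_mono[OF lnA_ge(3), of r] r_ge1 by simp
  have "ln (real sg) \<le> r * lnA" "ln (real b) + ln (real sg) \<le> r * lnA" "0 \<le> r * lnA"
    using rA lnA_ge by linarith+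
  have lin1: "l + y + e \<le> 11 * (x + l)" and lin2: "(l + y) + z + (l + y) + e \<le> 11 * (x + l)"
    if "y \<le> x" "z + y \<le> x" "0 \<le> x" "e \<le> 8 * x" "0 \<le> l" for x y z e l :: real
    using that by simp_all
  note bounds = \<open>ln (real sg) \<le> r * lnA\<close> \<open>ln (real b) + ln (real sg) \<le> r * lnA\<close>
    \<open>0 \<le> r * lnA\<close> e lnd_ge0
  have 1: "lnd + ln (real sg) + 8 * r * ln (exp 1 * real b) \<le> 11 * (cplx / real sg)"
    unfolding cplx_div_sg by (rule lin1[OF bounds])
  have 2: "(lnd + ln (real sg)) + ln (real b) + (lnd + ln (real sg)) + 8 * r * ln (exp 1 * real b) \<le> 11 * (cplx / real sg)"
    unfolding cplx_div_sg by (rule lin2[OF bounds])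
  show "real d * exp (8 * r * ln (exp 1 * real b)) \<le> exp (11 * (cplx / real sg))"
    unfolding d using 1 by (simp flip: exp_add)
  have "real p \<le> real d * real b" using p_le by (metis of_nat_le_iff of_nat_mult)
  also have "\<dots> = exp (lnd + ln (real sg) + ln (real b))" unfolding d using b_pos by (simp add: exp_add)
  finally have "real p * (real d * exp (8 * r * ln (exp 1 * real b))) \<le>
     exp (lnd + ln (real sg) + ln (real b)) * (exp (lnd + ln (real sg)) * exp (8 * r * ln (exp 1 * real b)))"
    unfolding d[symmetric] by (intro mult_right_mono) auto
  also have "\<dots> \<le> exp (11 * (cplx / real sg))" using 2 by (simp flip: exp_add)
  finally show "real p * (real d * exp (8 * r * ln (exp 1 * real b))) \<le> exp (11 * (cplx / real sg))" .
qed

subsection \<open>Restricted eigenvalues\<close>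

abbreviation "net \<equiv> int_net P (real s) sg"

definition cone :: "real \<Rightarrow> (nat \<Rightarrow> real) \<Rightarrow> bool" where
  "cone L \<delta> \<longleftrightarrow> (\<Sum>i<p. \<bar>\<delta> i\<bar>) \<le> L * sqrt (real s) * L2_set \<delta> {..<p} \<and>
     (\<Sum>g\<in>P. L2_set \<delta> g) \<le> L * sqrt (real sg) * L2_set \<delta> {..<p}"

text \<open>The second term keeps the deviation on a cone, amplified by
  \<open>(1 + 2 * L)\<^sup>2\<close>, below \<open>cmin / 2\<close>; the cap \<open>1\<close> keeps
  the Bernstein bound in its quadratic range.\<close>

definition rho :: "real \<Rightarrow> real" where "rho L = min 1 (cmin / (2 * (1 + 2 * L)\<^sup>2))"

text \<open>Only finitely many directions enter, so this set is measurable; the bounds on the whole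
  cone follow from it deterministically.\<close>

definition RE_event :: "real \<Rightarrow> 'a set" where
  "RE_event L = {\<omega> \<in> space M. \<forall>w\<in>net. \<forall>w'\<in>net.
     \<bar>bil \<omega> (\<lambda>i. real_of_int (w i)) (\<lambda>i. real_of_int (w' i))\<bar> < real s * rho L}"

lemma net_finite: "finite net"
  and net_card: "real (card net) \<le> exp (8 * cplxe)"
proof -
  note * = card_int_net[OF _ part sg_pos sg_le_d card_group_le b_pos, of s]
  show "finite net" using * by simp
  have "8 * real s * ln (exp 1 * real sg * real b) + real sg * ln (exp 1 * real d / real sg) =
      8 * (real s * lnA) + real sg * (1 + lnd)"
    using sg_pos sg_le_d by (simp add: lnA_def lnd_def ln_mult ln_div)
  also have "\<dots> \<le> 8 * cplxe" using lnd_ge0 by (simp add: cplxe_eq)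
  finally show "real (card net) \<le> exp (8 * cplxe)" using *(2) by (auto intro: order_trans)
qed

lemma rho_bounds: "L \<ge> 0 \<Longrightarrow> 0 < rho L" "rho L \<le> 1" "(1 + 2 * L)\<^sup>2 * rho L \<le> cmin / 2"
proof -
  show "L \<ge> 0 \<Longrightarrow> 0 < rho L" using const_pos by (auto simp: rho_def)
  show "rho L \<le> 1" by (simp add: rho_def)
  have "(1 + 2 * L)\<^sup>2 * rho L \<le> (1 + 2 * L)\<^sup>2 * (cmin / (2 * (1 + 2 * L)\<^sup>2))"
    by (intro mult_left_mono) (auto simp: rho_def)
  also have "\<dots> \<le> cmin / 2" using const_pos by (cases "1 + 2 * L = 0") auto
  finally show "(1 + 2 * L)\<^sup>2 * rho L \<le> cmin / 2" .
qed

lemma RE_event_sets[measurable]: "RE_event L \<in> events"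
  unfolding RE_event_def using net_finite by measurable

text \<open>Net vectors have norm at most \<open>2 * sqrt s\<close>, so the level
  \<open>s * rho L\<close> corresponds to \<open>t = rho L / 8\<close> in the bilinear bound; the
  pairs number at most \<open>exp (16 * cplxe)\<close>.\<close>

lemma RE_prob:
  assumes L: "L \<ge> 0"
  shows "prob (space M - RE_event L) \<le> 4 * exp (16 * cplxe - c0 * real n * (rho L)\<^sup>2 / 64)"
proof -
  define A where "A z = {\<omega> \<in> space M. \<bar>bil \<omega> (\<lambda>i. real_of_int (fst z i)) (\<lambda>i. real_of_int (snd z i))\<bar> \<ge> real s * rho L}"
    for z :: "(nat \<Rightarrow> int) \<times> (nat \<Rightarrow> int)"
  have A: "A z \<in> events" for z unfolding A_def by measurable
  have "prob (A z) \<le> 4 * exp (- c0 * real n * (rho L / 8)\<^sup>2)" if z: "z \<in> net \<times> net" for z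
  proof -
    have nrm: "(\<Sum>i<p. (real_of_int (w i))\<^sup>2) \<le> (2 * sqrt (real s))\<^sup>2" if "w \<in> net" for w
      using that by (simp add: int_net_def Union_P power_mult_distrib)
    have "prob {\<omega> \<in> space M. \<bar>bil \<omega> (\<lambda>i. real_of_int (fst z i)) (\<lambda>i. real_of_int (snd z i))\<bar> \<ge>
        2 * (2 * sqrt (real s)) * (2 * sqrt (real s)) * (rho L / 8)} \<le> 4 * exp (- c0 * real n * (rho L / 8)\<^sup>2)"
      using z s_pos rho_bounds(1)[OF L] rho_bounds(2)[of L] by (intro bilinear_tail nrm) auto
    also have "2 * (2 * sqrt (real s)) * (2 * sqrt (real s)) * (rho L / 8) = real s * rho L" by simp
    finally show ?thesis by (simp add: A_def)
  qed
  moreover have "real (card (net \<times> net)) \<le> exp (16 * cplxe)"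
  proof -
    have "real (card (net \<times> net)) \<le> exp (8 * cplxe) * exp (8 * cplxe)"
      unfolding card_cartesian_product of_nat_mult by (intro mult_mono net_card) auto
    then show ?thesis by (simp flip: exp_add)
  qed
  ultimately have "prob (\<Union>z\<in>net \<times> net. A z) \<le> exp (16 * cplxe) * (4 * exp (- c0 * real n * (rho L / 8)\<^sup>2))"
    using net_finite A by (intro union_bound) auto
  also have "\<dots> = 4 * exp (16 * cplxe - c0 * real n * (rho L)\<^sup>2 / 64)"
    by (simp add: power_divide flip: exp_add)
  also have "(\<Union>z\<in>net \<times> net. A z) = space M - RE_event L"
    by (force simp: A_def RE_event_def not_less)
  finally show ?thesis .
qed

text \<open>Both signs of \<open>Bdev\<close> are tested, so the deviation is at most
  \<open>cmin / 2\<close> times the squared norm in absolute value; as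
  \<open>cmin \<le> Cmax\<close>, the upper constant \<open>2 * Cmax\<close> follows.\<close>

lemma H_cone_bounds:
  assumes \<omega>: "\<omega> \<in> RE_event L" and L: "L \<ge> 0" and c: "cone L \<delta>"
  shows "cmin / 2 * (L2_set \<delta> {..<p})\<^sup>2 \<le> (\<Sum>i<p. \<Sum>j<p. \<delta> i * H \<omega> i j * \<delta> j)"
    "(\<Sum>i<p. \<Sum>j<p. \<delta> i * H \<omega> i j * \<delta> j) \<le> 2 * Cmax * (L2_set \<delta> {..<p})\<^sup>2"
proof -
  define D where "D = L2_set \<delta> {..<p}"
  have D2: "D\<^sup>2 = (\<Sum>i<p. (\<delta> i)\<^sup>2)" by (simp add: D_def L2_set_def sum_nonneg)
  have s1: "1 \<le> real s" using s_pos by simp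
  have cD: "(\<Sum>i<p. \<bar>\<delta> i\<bar>) \<le> L * sqrt (real s) * D" "(\<Sum>g\<in>P. L2_set \<delta> g) \<le> L * sqrt (real sg) * D"
    using c by (auto simp: cone_def D_def)
  have D0: "0 \<le> D" "L2_set \<delta> {..<p} \<le> D" by (auto simp: D_def)
  have w: "\<bar>\<Sum>i<p. \<Sum>j<p. real_of_int (w i) * Bdev \<omega> i j * real_of_int (w' j)\<bar> \<le> real s * rho L"
    if "w \<in> net" "w' \<in> net" for w w'
    using \<omega> that unfolding RE_event_def bil_def by (auto simp: less_imp_le)
  have "(\<Sum>i<p. \<Sum>j<p. \<delta> i * Bdev \<omega> i j * \<delta> j) \<le> (1 + 2 * L)\<^sup>2 * D\<^sup>2 * rho L"
    using w by (intro cone_quadratic_form_bound[OF _ part s1 sg_pos sg_le_d L D0 cD]) (auto simp: abs_le_iff)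
  moreover have "(\<Sum>i<p. \<Sum>j<p. \<delta> i * (- Bdev \<omega> i j) * \<delta> j) \<le> (1 + 2 * L)\<^sup>2 * D\<^sup>2 * rho L"
    using w by (intro cone_quadratic_form_bound[OF _ part s1 sg_pos sg_le_d L D0 cD])
      (auto simp: abs_le_iff sum_negf)
  ultimately have "\<bar>bil \<omega> \<delta> \<delta>\<bar> \<le> ((1 + 2 * L)\<^sup>2 * rho L) * D\<^sup>2"
    by (simp add: bil_def abs_le_iff sum_negf mult_ac)
  also have "\<dots> \<le> cmin / 2 * D\<^sup>2" by (intro mult_right_mono rho_bounds) auto
  finally have dev: "\<bar>bil \<omega> \<delta> \<delta>\<bar> \<le> cmin / 2 * D\<^sup>2" .
  define e f where "e = cmin / 2 * D\<^sup>2" and "f = Cmax * D\<^sup>2"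
  have "2 * e \<le> (\<Sum>i<p. \<Sum>j<p. \<delta> i * S $$ (i, j) * \<delta> j)"
     "(\<Sum>i<p. \<Sum>j<p. \<delta> i * S $$ (i, j) * \<delta> j) \<le> f"
    using S_bounds_fun[of \<delta>] by (simp_all add: D2 e_def f_def)
  moreover have "e \<le> f" unfolding e_def f_def using const_pos by (intro mult_right_mono) auto
  moreover note dev[folded e_def, unfolded bil_eq]
  ultimately have "e \<le> (\<Sum>i<p. \<Sum>j<p. \<delta> i * H \<omega> i j * \<delta> j)"
    "(\<Sum>i<p. \<Sum>j<p. \<delta> i * H \<omega> i j * \<delta> j) \<le> 2 * f" by linarith+
  then show "cmin / 2 * (L2_set \<delta> {..<p})\<^sup>2 \<le> (\<Sum>i<p. \<Sum>j<p. \<delta> i * H \<omega> i j * \<delta> j)"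
    "(\<Sum>i<p. \<Sum>j<p. \<delta> i * H \<omega> i j * \<delta> j) \<le> 2 * Cmax * (L2_set \<delta> {..<p})\<^sup>2"
    by (simp_all add: e_def f_def D_def)
qed

subsection \<open>Integer directions within one group\<close>

definition gvecs :: "nat set \<Rightarrow> (nat \<Rightarrow> int) set" where
  "gvecs g = {w. (\<forall>i. i \<notin> g \<longrightarrow> w i = 0) \<and> (\<Sum>i\<in>g. (real_of_int (w i))\<^sup>2) \<le> 4 * r}"

lemma gvecs_card: "g \<in> P \<Longrightarrow> finite (gvecs g)" "g \<in> P \<Longrightarrow> real (card (gvecs g)) \<le> exp (8 * r * ln (exp 1 * real b))"
  using card_int_vectors_group[OF finite_group card_group_le b_pos, of g r] r_ge1 by (auto simp: gvecs_def)

lemma gvecs_sum: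
  assumes "g \<in> P" "w \<in> gvecs g" "\<And>i. w i = 0 \<Longrightarrow> f i = (0::real)"
  shows "(\<Sum>i<p. f i) = (\<Sum>i\<in>g. f i)"
  using assms group_subset[OF assms(1)] by (intro sum.mono_neutral_right) (auto simp: gvecs_def)

lemma gvecs_norm: "g \<in> P \<Longrightarrow> w \<in> gvecs g \<Longrightarrow> (\<Sum>i<p. (real_of_int (w i))\<^sup>2) \<le> 4 * r"
  by (subst gvecs_sum) (auto simp: gvecs_def)

lemma single_group_L12:
  assumes "g \<in> P" "\<And>i. i \<notin> g \<Longrightarrow> f i = 0"
  shows "(\<Sum>h\<in>P. L2_set f h) = L2_set f {..<p}"
proof -
  have "L2_set f h = 0" if "h \<in> P - {g}" for h
  proof -
    have "i \<notin> g" if "i \<in> h" for i using that \<open>h \<in> P - {g}\<close> assms(1) part by (auto simp: partition_on_def disjoint_def)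
    then show ?thesis using assms(2) by (simp add: L2_set_def)
  qed
  then have "(\<Sum>h\<in>P. L2_set f h) = L2_set f g" using finite_P assms(1) by (subst sum.remove[OF _ assms(1)]) auto
  also have "\<dots> = L2_set f {..<p}"
    unfolding L2_set_def using assms group_subset[OF assms(1)] by (intro arg_cong[of _ _ sqrt] sum.mono_neutral_left) auto
  finally show ?thesis .
qed

text \<open>Places the test directions of a single group under the restricted eigenvalue event,
  which then bounds the noise variance along them. Since
  \<open>\<bar>x\<bar> \<le> x\<^sup>2\<close> for integers, the l1 norm is at most
  \<open>D * D\<close> with \<open>D \<le> 2 * sqrt r\<close>; the l1,2 norm is
  \<open>D\<close>.\<close>

lemma gvecs_cone:
  assumes g: "g \<in> P" and w: "w \<in> gvecs g" and L: "L \<ge> 2"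
  shows "cone L (\<lambda>i. real_of_int (w i))"
proof -
  let ?f = "\<lambda>i. real_of_int (w i)"
  define D where "D = L2_set ?f {..<p}"
  have D2: "D * D = (\<Sum>i<p. (?f i)\<^sup>2)" by (simp add: D_def L2_set_def sum_nonneg flip: power2_eq_square)
  have D0: "D \<ge> 0" by (simp add: D_def)
  have "D \<le> 2 * sqrt r"
  proof (rule power2_le_imp_le)
    show "D\<^sup>2 \<le> (2 * sqrt r)\<^sup>2" using gvecs_norm[OF g w] r_ge1 D2 by (simp add: power_mult_distrib power2_eq_square)
  qed (use r_ge1 in auto)
  also have "\<dots> \<le> L * sqrt (real s)" using L r_le_s r_ge1 by (intro mult_mono) auto
  finally have D: "D \<le> L * sqrt (real s)" .
  have "\<bar>?f i\<bar> \<le> (?f i)\<^sup>2" for i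
    using mult_left_mono[of 1 "\<bar>?f i\<bar>" "\<bar>?f i\<bar>"] by (cases "w i = 0") (auto simp: power2_eq_square)
  then have "(\<Sum>i<p. \<bar>?f i\<bar>) \<le> D * D" unfolding D2 by (intro sum_mono)
  also have "\<dots> \<le> L * sqrt (real s) * D" using D D0 by (intro mult_right_mono)
  finally have 1: "(\<Sum>i<p. \<bar>?f i\<bar>) \<le> L * sqrt (real s) * D" .
  have "(\<Sum>h\<in>P. L2_set ?f h) = D"
    unfolding D_def using w by (intro single_group_L12[OF g]) (auto simp: gvecs_def)
  also have "1 * 1 \<le> L * sqrt (real sg)" using L sg_pos by (intro mult_mono) auto
  then have "D \<le> L * sqrt (real sg) * D" using D0 mult_right_mono[of 1 "L * sqrt (real sg)" D] by simp
  finally show ?thesis using 1 by (simp add: cone_def D_def)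
qed

lemma group_soft_threshold_bound:
  assumes g: "g \<in> P" and a: "a \<ge> 0" and u: "\<And>w. w \<in> gvecs g \<Longrightarrow> (\<Sum>i<p. real_of_int (w i) * u i) \<le> r * a"
  shows "L2_set (\<lambda>i. soft_threshold a (u i)) g \<le> sqrt r * a"
proof (rule soft_threshold_rounding[OF finite_group[OF g] r_ge1 a])
  fix w :: "nat \<Rightarrow> int"
  assume "\<And>i. i \<notin> g \<Longrightarrow> w i = 0" "(\<Sum>i\<in>g. (real_of_int (w i))\<^sup>2) \<le> 4 * r"
  then have w: "w \<in> gvecs g" by (simp add: gvecs_def)
  show "(\<Sum>i\<in>g. real_of_int (w i) * u i) \<le> r * a"
    using u[OF w] gvecs_sum[OF g w, of "\<lambda>i. real_of_int (w i) * u i"] by simp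
qed

subsection \<open>Tuning parameters\<close>

lemma lam_pos: "0 < lam" and lam_sq: "lam\<^sup>2 * real s = C\<^sup>2 * \<sigma>\<^sup>2 * cplx * real n"
  and lamg_eq: "lamg = sqrt (real s / real sg) * lam" and \<alpha>_eq: "\<alpha> = lam / (real n * \<sigma>)" and \<gamma>_eq: "\<gamma> = sqrt r * \<alpha>"
  and \<gamma>_eq2: "\<gamma> = lamg / (real n * \<sigma>)"
  using const_pos \<sigma>_pos n_pos s_pos cplx_pos
  by (auto simp: lasso_param_def group_param_def alpha_param_def gamma_param_def r_def power_mult_distrib)

lemma \<alpha>_pos: "0 < \<alpha>" using lam_pos n_pos \<sigma>_pos by (simp add: \<alpha>_eq)

text \<open>This is \<open>n * \<gamma>\<^sup>2\<close>. Up to constants it is the Bernstein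
  exponent for feasibility, which has to dominate \<open>11 * (cplx / sg)\<close>.\<close>

lemma \<alpha>_sq: "real n * (r * \<alpha>\<^sup>2) = C\<^sup>2 * (cplx / real sg)"
proof -
  have "real n * (r * \<alpha>\<^sup>2) = (lam\<^sup>2 * real s) / (real n * \<sigma>\<^sup>2 * real sg)"
    using n_pos \<sigma>_pos sg_pos by (simp add: \<alpha>_eq r_def power_divide power_mult_distrib power2_eq_square mult_ac)
  also have "\<dots> = C\<^sup>2 * (cplx / real sg)" unfolding lam_sq using n_pos \<sigma>_pos by simp
  finally show ?thesis .
qed

subsection \<open>Feasibility of the debiasing programs\<close>

text \<open>\<open>cmin * (m \<bullet> m)\<close> is at most
  \<open>m \<bullet> (S *\<^sub>v m)\<close>, which is the entry \<open>m $ i\<close> and thus at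
  most the norm of \<open>m\<close>; so that norm is at most \<open>1 / cmin\<close>.\<close>

lemma exists_precision_column:
  assumes i: "i < p"
  obtains m where "m \<in> carrier_vec p" "S *\<^sub>v m = unit_vec p i" "(\<Sum>j<p. (m $ j)\<^sup>2) \<le> (1 / cmin)\<^sup>2"
proof -
  obtain R where "is_inv_sqrt_mat p S R" using design unfolding subgaussian_design_def by (elim conjE exE)
  then obtain m where m: "m \<in> carrier_vec p" "S *\<^sub>v m = unit_vec p i"
    using exists_inverse_image_unit[OF _ S_carrier _ i] by (auto simp: is_inv_sqrt_mat_def)
  define D where "D = sqrt (m \<bullet> m)"
  have D: "D \<ge> 0" "D * D = m \<bullet> m" using scalar_prod_self(2)[OF m(1)] by (auto simp: D_def)
  have "(m $ i)\<^sup>2 \<le> m \<bullet> m" unfolding scalar_prod_self(1)[OF m(1)] using i by (intro member_le_sum) auto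
  then have "\<bar>m $ i\<bar> \<le> D" unfolding D_def by (simp add: real_le_rsqrt)
  moreover have "cmin * (m \<bullet> m) \<le> m $ i" using S_bounds(1)[OF m(1)] m i by simp
  moreover have "D * (cmin * D) = cmin * (m \<bullet> m)" unfolding D(2)[symmetric] by (simp add: mult_ac)
  ultimately have "D * (cmin * D) \<le> D * 1" by linarith
  then have "cmin * D \<le> 1" using D const_pos by (cases "D = 0") auto
  then have "D \<le> 1 / cmin" using const_pos by (simp add: field_simps)
  then have "D\<^sup>2 \<le> (1 / cmin)\<^sup>2" using D by (intro power_mono)
  then have "(\<Sum>j<p. (m $ j)\<^sup>2) \<le> (1 / cmin)\<^sup>2" using D scalar_prod_self(1)[OF m(1)] by (simp add: power2_eq_square)
  with m show thesis by (rule that)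
qed

text \<open>As \<open>S *\<^sub>v m\<close> is the unit vector, the constraint residual is the
  covariance deviation applied to \<open>m\<close>; its thresholded group norms are controlled by
  integer directions.\<close>

lemma feasible_if_directions:
  assumes \<omega>: "\<omega> \<in> space M" and i: "i < p" and m: "m \<in> carrier_vec p" "S *\<^sub>v m = unit_vec p i"
    and w: "\<And>g w. g \<in> P \<Longrightarrow> w \<in> gvecs g \<Longrightarrow> bil \<omega> (\<lambda>i. real_of_int (w i)) (\<lambda>j. m $ j) \<le> r * \<alpha>"
  shows "debias_feasible P \<alpha> \<gamma> (X \<omega>) i m"
proof -
  let ?v = "sample_cov (X \<omega>) *\<^sub>v m - unit_vec p i"
  have dimX: "dim_col (X \<omega>) = p" using X_carrier[OF \<omega>] by simp
  have v: "?v $ k = (\<Sum>j<p. Bdev \<omega> k j * m $ j)" if k: "k < p" for k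
  proof -
    have "unit_vec p i $ k = (\<Sum>j<p. S $$ (k, j) * m $ j)"
      using k S_carrier m by (auto simp flip: m(2) simp: scalar_prod_def atLeast0LessThan intro!: sum.cong)
    moreover have "(sample_cov (X \<omega>) *\<^sub>v m) $ k = (\<Sum>j<p. H \<omega> k j * m $ j)"
      using k sample_cov_carrier[OF \<omega>] m
      by (auto simp: scalar_prod_def atLeast0LessThan H_eq_sample_cov[OF \<omega>] intro!: sum.cong)
    ultimately show ?thesis using k by (simp add: Bdev_def algebra_simps sum_subtractf)
  qed
  have "L2_set (\<lambda>k. map_vec (soft_threshold \<alpha>) ?v $ k) g \<le> \<gamma>" if g: "g \<in> P" for g
  proof -
    have "L2_set (\<lambda>k. map_vec (soft_threshold \<alpha>) ?v $ k) g = L2_set (\<lambda>k. soft_threshold \<alpha> (\<Sum>j<p. Bdev \<omega> k j * m $ j)) g"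
      using group_subset[OF g] v sample_cov_carrier[OF \<omega>] by (intro L2_set_cong) auto
    also have "\<dots> \<le> sqrt r * \<alpha>"
    proof (rule group_soft_threshold_bound[OF g])
      fix u assume "u \<in> gvecs g"
      from w[OF g this] show "(\<Sum>i<p. real_of_int (u i) * (\<Sum>j<p. Bdev \<omega> i j * m $ j)) \<le> r * \<alpha>"
        by (simp add: bil_def sum_distrib_left mult.assoc)
    qed (use \<alpha>_pos in simp)
    finally show ?thesis by (simp add: \<gamma>_eq)
  qed
  then have "norm_inf_2 P (map_vec (soft_threshold \<alpha>) ?v) \<le> \<gamma>"
    unfolding norm_inf_2_def using finite_P P_nonempty by (subst Max_le_iff) auto
  then show ?thesis using m dimX by (simp add: debias_feasible_def)
qed

definition feasible_event :: "'a set" where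
  "feasible_event = {\<omega> \<in> space M. \<forall>i<p. debias_feasible P \<alpha> \<gamma> (X \<omega>) i (mhat (X \<omega>) i)}"

text \<open>Once some candidate is feasible, \<open>mhat\<close> is a solution and hence feasible as
  well. The exceptional set is given as an event \<open>F\<close>, so that
  \<open>feasible_event\<close> itself need not be shown measurable.\<close>

lemma feasible_prob:
  assumes C: "192 \<le> c0 * (C * cmin)\<^sup>2" and n: "C\<^sup>2 * cmin\<^sup>2 * cplx \<le> real n"
  obtains F where "F \<in> events" "space M - F \<subseteq> feasible_event" "prob F \<le> 4 * exp (- (cplx / real s))"
proof -
  define m where "m i = (SOME m. m \<in> carrier_vec p \<and> S *\<^sub>v m = unit_vec p i \<and> (\<Sum>j<p. (m $ j)\<^sup>2) \<le> (1 / cmin)\<^sup>2)" for i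
  have m: "m i \<in> carrier_vec p \<and> S *\<^sub>v m i = unit_vec p i \<and> (\<Sum>j<p. (m i $ j)\<^sup>2) \<le> (1 / cmin)\<^sup>2" if "i < p" for i
    unfolding m_def by (rule someI_ex) (use exists_precision_column[OF that] in blast)
  \<comment> \<open>Chosen so that \<open>2 * (2 * sqrt r) * (1 / cmin) * t = r * \<alpha>\<close>,
    where \<open>2 * sqrt r\<close> and \<open>1 / cmin\<close> bound the norms of direction and
    candidate. The lower bound on \<open>n\<close> gives \<open>t \<le> 1\<close>.\<close>
  define t where "t = sqrt r * \<alpha> * cmin / 4"
  have nt: "real n * t\<^sup>2 = C\<^sup>2 * cmin\<^sup>2 * (cplx / real sg) / 16"
  proof -
    have "real n * t\<^sup>2 = real n * (r * \<alpha>\<^sup>2) * cmin\<^sup>2 / 16" using r_ge1 by (simp add: t_def power_mult_distrib power_divide)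
    then show ?thesis unfolding \<alpha>_sq by (simp add: mult_ac)
  qed
  have t0: "0 < t" using r_ge1 \<alpha>_pos const_pos by (simp add: t_def)
  have "real n * t\<^sup>2 \<le> real n * 1"
  proof -
    define x where "x = C\<^sup>2 * cmin\<^sup>2 * (cplx / real sg)"
    have "cplx / real sg \<le> cplx / 1" using sg_pos cplx_pos by (intro divide_left_mono) auto
    then have "x \<le> C\<^sup>2 * cmin\<^sup>2 * cplx" unfolding x_def by (intro mult_left_mono) auto
    moreover have "0 \<le> x" using cplx_pos by (simp add: x_def)
    ultimately show ?thesis using n unfolding nt x_def[symmetric] by linarith
  qed
  then have "t\<^sup>2 \<le> 1\<^sup>2" using n_pos by simp
  then have t1: "t \<le> 1" by (rule power2_le_imp_le) simp
  define T where "T = (SIGMA i:{..<p}. SIGMA g:P. gvecs g)"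
  define A where "A z = {\<omega> \<in> space M. \<bar>bil \<omega> (\<lambda>k. real_of_int (snd (snd z) k)) (\<lambda>j. m (fst z) $ j)\<bar> \<ge> r * \<alpha>}"
    for z :: "nat \<times> nat set \<times> (nat \<Rightarrow> int)"
  define F where "F = (\<Union>z\<in>T. A z)"
  have A: "A z \<in> events" for z unfolding A_def by measurable
  have finT: "finite T" unfolding T_def using finite_P gvecs_card(1) by auto
  have F: "F \<in> events" unfolding F_def using finT A by auto
  have "prob (A z) \<le> 4 * exp (- c0 * real n * t\<^sup>2)" if "z \<in> T" for z
  proof -
    obtain i g w where z: "z = (i, g, w)" "i < p" "g \<in> P" "w \<in> gvecs g" using \<open>z \<in> T\<close> by (auto simp: T_def)
    have "prob {\<omega> \<in> space M. \<bar>bil \<omega> (\<lambda>k. real_of_int (w k)) (\<lambda>j. m i $ j)\<bar> \<ge> 2 * (2 * sqrt r) * (1 / cmin) * t}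
      \<le> 4 * exp (- c0 * real n * t\<^sup>2)"
      using gvecs_norm[OF z(3,4)] m[OF z(2)] r_ge1 const_pos t0 t1
      by (intro bilinear_tail) (auto simp: power_mult_distrib)
    also have "2 * (2 * sqrt r) * (1 / cmin) * t = r * \<alpha>" using const_pos r_ge1 by (simp add: t_def)
    finally show ?thesis by (simp add: A_def z)
  qed
  moreover have "real (card T) \<le> real p * (real d * exp (8 * r * ln (exp 1 * real b)))"
  proof -
    have "card T = p * (\<Sum>g\<in>P. card (gvecs g))"
      unfolding T_def using finite_P gvecs_card(1) by (simp add: card_SigmaI)
    then have "real (card T) = real p * (\<Sum>g\<in>P. real (card (gvecs g)))" by simp
    also have "\<dots> \<le> real p * (\<Sum>g\<in>P. exp (8 * r * ln (exp 1 * real b)))"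
      by (intro mult_left_mono sum_mono gvecs_card) auto
    finally show ?thesis by simp
  qed
  ultimately have "prob F \<le> (real p * (real d * exp (8 * r * ln (exp 1 * real b)))) * (4 * exp (- c0 * real n * t\<^sup>2))"
    unfolding F_def using finT A by (intro union_bound) auto
  also have "\<dots> \<le> exp (11 * (cplx / real sg)) * (4 * exp (- c0 * real n * t\<^sup>2))"
    by (intro mult_right_mono count_groups_coords) auto
  also have "\<dots> = 4 * exp (11 * (cplx / real sg) - c0 * (real n * t\<^sup>2))" by (simp add: mult.assoc flip: exp_add)
  also have "\<dots> \<le> 4 * exp (- (cplx / real s))"
  proof -
    \<comment> \<open>Of the \<open>12\<close> in \<open>192 = 12 * 16\<close>, eleven pay for the
      union bound and one remains as the failure exponent.\<close>
    have "12 * (cplx / real sg) \<le> (c0 * (C * cmin)\<^sup>2 / 16) * (cplx / real sg)"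
      using C cplx_div_le by (intro mult_right_mono) auto
    also have "\<dots> = c0 * (real n * t\<^sup>2)" unfolding nt by (simp add: power_mult_distrib)
    finally show ?thesis using cplx_div_le(1) by simp
  qed
  finally have pF: "prob F \<le> 4 * exp (- (cplx / real s))" .
  have "space M - F \<subseteq> feasible_event"
  proof
    fix \<omega> assume \<omega>: "\<omega> \<in> space M - F"
    have "debias_feasible P \<alpha> \<gamma> (X \<omega>) i (mhat (X \<omega>) i)" if i: "i < p" for i
    proof -
      have "debias_feasible P \<alpha> \<gamma> (X \<omega>) i (m i)"
      proof (rule feasible_if_directions)
        fix g w assume gw: "g \<in> P" "w \<in> gvecs g"
        then have "(i, g, w) \<in> T" using i by (simp add: T_def)
        then have "\<omega> \<notin> A (i, g, w)" using \<omega> by (auto simp: F_def)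
        then show "bil \<omega> (\<lambda>i. real_of_int (w i)) (\<lambda>j. m i $ j) \<le> r * \<alpha>" using \<omega> by (simp add: A_def)
      qed (use \<omega> i m in auto)
      then show ?thesis using mhat[OF _ i] \<omega> by (auto simp: is_debias_solution_def is_arg_min_def)
    qed
    then show "\<omega> \<in> feasible_event" using \<omega> by (simp add: feasible_event_def)
  qed
  with F show thesis using pF by (rule that)
qed


subsection \<open>Noise\<close>

definition z :: "'a \<Rightarrow> nat \<Rightarrow> real" where
  "z \<omega> i = (\<Sum>k<n. Matrix.row (X \<omega>) k $ i * \<epsilon> \<omega> $ k)"

lemma meas_\<epsilon>[measurable]: "k < n \<Longrightarrow> (\<lambda>\<omega>. \<epsilon> \<omega> $ k) \<in> borel_measurable M"
  by (rule measurable_compose[OF \<epsilon>_meas measurable_vec_nth])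

lemma meas_z[measurable]: "i < p \<Longrightarrow> (\<lambda>\<omega>. z \<omega> i) \<in> borel_measurable M"
  unfolding z_def by measurable

lemma indep_design_noise: "indep_set {X -` A \<inter> space M |A. A \<in> sets (mat_borel n p)} {\<epsilon> -` B \<inter> space M |B. B \<in> sets (vec_borel n)}"
  and noise_law: "distr M borel (\<lambda>\<omega>. \<Sum>k<n. a k * \<epsilon> \<omega> $ k) = centered_normal (\<sigma>\<^sup>2 * (\<Sum>k<n. (a k)\<^sup>2))"
  using noise distr_normal_combination[OF _ \<sigma>_pos, of "\<lambda>k \<omega>. \<epsilon> \<omega> $ k" n a] by (auto simp: gaussian_noise_def)

text \<open>Given the design, a linear functional of the noise with design-dependent coefficients is
  exactly centered normal. Both the noise bound and the studentized law rest on this.\<close>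

lemma normal_given_design:
  assumes a: "\<And>k. k < n \<Longrightarrow> a k \<in> borel_measurable (mat_borel n p)" and A: "A \<in> sets (mat_borel n p)" and B: "B \<in> sets borel"
  shows "emeasure M {\<omega> \<in> space M. X \<omega> \<in> A \<and> (\<Sum>k<n. a k (X \<omega>) * \<epsilon> \<omega> $ k) \<in> B} =
    (\<integral>\<^sup>+x\<in>A. emeasure (centered_normal (\<sigma>\<^sup>2 * (\<Sum>k<n. (a k x)\<^sup>2))) B \<partial>distr M (mat_borel n p) X)"
proof -
  have f: "(\<lambda>e. \<Sum>k<n. c k * e $ k) \<in> borel_measurable (vec_borel n)" for c :: "nat \<Rightarrow> real"
    by (intro borel_measurable_sum borel_measurable_times borel_measurable_const measurable_vec_nth) auto
  have "(\<lambda>(x, e). \<Sum>k<n. a k x * e $ k) \<in> borel_measurable (mat_borel n p \<Otimes>\<^sub>M vec_borel n)"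
    unfolding split_beta
    by (intro borel_measurable_sum borel_measurable_times measurable_compose[OF measurable_fst a]
        measurable_compose[OF measurable_snd measurable_vec_nth]) auto
  from indep_kernel_formula[OF X_meas \<epsilon>_meas indep_design_noise this A B]
  show ?thesis by (simp add: distr_distr[OF f \<epsilon>_meas] comp_def noise_law)
qed

text \<open>\<open>q = 1\<close> is the level required by \<open>lasso_cone\<close>; larger
  \<open>q\<close> buys probability when \<open>cplx / s\<close> stays bounded.\<close>

definition noise_event :: "real \<Rightarrow> 'a set" where
  "noise_event q = {\<omega> \<in> space M. \<forall>g\<in>P. \<forall>w\<in>gvecs g. (\<Sum>i<p. real_of_int (w i) * z \<omega> i) \<le> r * (q * lam / 4)}"

lemma noise_event_sets[measurable]: "noise_event q \<in> events"
  unfolding noise_event_def using finite_P gvecs_card(1) by measurable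

text \<open>On the restricted eigenvalue event the conditional variance along \<open>w\<close> is at
  most \<open>V\<close>, because \<open>w\<close> lies in the cone and has squared norm at most
  \<open>4 * r\<close>; a Gaussian tail then holds uniformly in the design.\<close>

lemma noise_direction_prob:
  assumes g: "g \<in> P" and w: "w \<in> gvecs g" and L: "2 \<le> L" and q: "0 \<le> q"
  shows "prob {\<omega> \<in> RE_event L. (\<Sum>i<p. real_of_int (w i) * z \<omega> i) > r * (q * lam / 4)} \<le>
    exp (- (q\<^sup>2 * C\<^sup>2 / (256 * Cmax) * (cplx / real sg)))"
proof -
  define t where "t = r * (q * lam / 4)"
  define V where "V = \<sigma>\<^sup>2 * (8 * real n * Cmax * r)"
  define a where "a k x = (\<Sum>i<p. real_of_int (w i) * x $$ (k, i))" for k and x :: "real mat"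
  \<comment> \<open>A condition on the design alone, implied by the restricted eigenvalue event;
    conditioning on the design requires this shape.\<close>
  define A where "A = {x \<in> space (mat_borel n p). (\<Sum>k<n. (a k x)\<^sup>2) \<le> 8 * real n * Cmax * r}"
  have am[measurable]: "a k \<in> borel_measurable (mat_borel n p)" if "k < n" for k
    unfolding a_def by (intro borel_measurable_sum borel_measurable_times borel_measurable_const measurable_mat_nth) (use that in auto)
  have A: "A \<in> sets (mat_borel n p)" unfolding A_def by measurable
  have t0: "0 \<le> t" using r_ge1 q lam_pos by (simp add: t_def)
  have V0: "0 < V" using \<sigma>_pos n_pos const_pos r_ge1 by (simp add: V_def)
  let ?E = "{\<omega> \<in> space M. X \<omega> \<in> A \<and> (\<Sum>k<n. a k (X \<omega>) * \<epsilon> \<omega> $ k) \<in> {t<..}}"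
  have akX: "a k (X \<omega>) = (\<Sum>i<p. real_of_int (w i) * Matrix.row (X \<omega>) k $ i)" if "k < n" "\<omega> \<in> space M" for k \<omega>
    using that by (simp add: a_def row_nth)
  have inA: "X \<omega> \<in> A" if \<omega>: "\<omega> \<in> RE_event L" for \<omega>
  proof -
    have \<omega>': "\<omega> \<in> space M" using \<omega> by (simp add: RE_event_def)
    let ?f = "\<lambda>i. real_of_int (w i)"
    have "(\<Sum>k<n. (a k (X \<omega>))\<^sup>2) = real n * (\<Sum>i<p. \<Sum>j<p. ?f i * H \<omega> i j * ?f j)"
      using \<omega>' n_pos unfolding H_quadratic by (simp add: akX power2_eq_square)
    also have "\<dots> \<le> real n * (2 * Cmax * (L2_set ?f {..<p})\<^sup>2)"
      using L by (intro mult_left_mono H_cone_bounds(2)[OF \<omega> _ gvecs_cone[OF g w]]) auto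
    also have "\<dots> \<le> real n * (2 * Cmax * (4 * r))"
      using gvecs_norm[OF g w] const_pos by (intro mult_left_mono) (auto simp: L2_set_def sum_nonneg)
    finally show ?thesis using measurable_space[OF X_meas \<omega>'] by (simp add: A_def mult_ac)
  qed
  have "emeasure M ?E \<le> (\<integral>\<^sup>+x. ennreal (exp (- t\<^sup>2 / (2 * V))) \<partial>distr M (mat_borel n p) X)"
  proof (subst normal_given_design[of a A "{t<..}"])
    show "(\<integral>\<^sup>+x\<in>A. emeasure (centered_normal (\<sigma>\<^sup>2 * (\<Sum>k<n. (a k x)\<^sup>2))) {t<..} \<partial>distr M (mat_borel n p) X)
      \<le> (\<integral>\<^sup>+x. ennreal (exp (- t\<^sup>2 / (2 * V))) \<partial>distr M (mat_borel n p) X)"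
  proof (rule nn_integral_mono)
    fix x
    show "emeasure (centered_normal (\<sigma>\<^sup>2 * (\<Sum>k<n. (a k x)\<^sup>2))) {t<..} * indicator A x \<le> ennreal (exp (- t\<^sup>2 / (2 * V)))"
    proof (cases "x \<in> A")
      case True
      then have "\<sigma>\<^sup>2 * (\<Sum>k<n. (a k x)\<^sup>2) \<le> V" unfolding V_def A_def by (intro mult_left_mono) auto
      then have "emeasure (centered_normal (\<sigma>\<^sup>2 * (\<Sum>k<n. (a k x)\<^sup>2))) {t<..} \<le> ennreal (exp (- t\<^sup>2 / (2 * V)))"
        using V0 t0 by (intro centered_normal_tail mult_nonneg_nonneg sum_nonneg) auto
      then show ?thesis using True by simp
    qed simp
  qed
  qed (use am A in auto)
  also have "\<dots> = ennreal (exp (- t\<^sup>2 / (2 * V)))"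
    using prob_space.emeasure_space_1[OF prob_space_distr[OF X_meas]] by simp
  finally have E: "prob ?E \<le> exp (- t\<^sup>2 / (2 * V))" by (simp add: emeasure_eq_measure)
  have Em: "?E \<in> events"
  proof -
    have "(\<lambda>\<omega>. a k (X \<omega>)) \<in> borel_measurable M" if "k < n" for k by (rule measurable_compose[OF X_meas am[OF that]])
    moreover have "X -` A \<inter> space M \<in> events" using X_meas A by (rule measurable_sets)
    then have "{\<omega> \<in> space M. X \<omega> \<in> A} \<in> events" by (simp add: vimage_def Int_def conj_commute)
    ultimately show ?thesis by measurable
  qed
  have "{\<omega> \<in> RE_event L. (\<Sum>i<p. real_of_int (w i) * z \<omega> i) > t} \<subseteq> ?E"
  proof
    fix \<omega> assume \<omega>: "\<omega> \<in> {\<omega> \<in> RE_event L. (\<Sum>i<p. real_of_int (w i) * z \<omega> i) > t}"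
    then have \<omega>': "\<omega> \<in> space M" by (simp add: RE_event_def)
    have "(\<Sum>i<p. real_of_int (w i) * z \<omega> i) = (\<Sum>i<p. \<Sum>k<n. real_of_int (w i) * Matrix.row (X \<omega>) k $ i * \<epsilon> \<omega> $ k)"
      by (simp add: z_def sum_distrib_left mult.assoc)
    also have "\<dots> = (\<Sum>k<n. \<Sum>i<p. real_of_int (w i) * Matrix.row (X \<omega>) k $ i * \<epsilon> \<omega> $ k)" by (rule sum.swap)
    also have "\<dots> = (\<Sum>k<n. a k (X \<omega>) * \<epsilon> \<omega> $ k)" using \<omega>' by (simp add: akX sum_distrib_right)
    finally show "\<omega> \<in> ?E" using \<omega> \<omega>' inA by simp
  qed
  then have "prob {\<omega> \<in> RE_event L. (\<Sum>i<p. real_of_int (w i) * z \<omega> i) > t} \<le> prob ?E"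
    using Em by (rule finite_measure_mono)
  also note E
  also have "- t\<^sup>2 / (2 * V) = - (q\<^sup>2 * C\<^sup>2 / (256 * Cmax) * (cplx / real sg))"
  proof -
    have rl: "r * lam\<^sup>2 = C\<^sup>2 * \<sigma>\<^sup>2 * real n * (cplx / real sg)"
      using lam_sq sg_pos by (simp add: r_def field_simps)
    have "t\<^sup>2 / (2 * V) = q\<^sup>2 * (r * lam\<^sup>2) / (256 * (\<sigma>\<^sup>2 * real n * Cmax))"
      using r_ge1 \<sigma>_pos n_pos const_pos by (simp add: t_def V_def power_mult_distrib power_divide power2_eq_square mult_ac)
    also have "\<dots> = q\<^sup>2 * C\<^sup>2 / (256 * Cmax) * (cplx / real sg)"
      unfolding rl using \<sigma>_pos n_pos by (simp add: mult_ac)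
    finally show ?thesis by simp
  qed
  finally show ?thesis unfolding t_def .
qed

lemma noise_prob:
  assumes C: "12 \<le> C\<^sup>2 / (256 * Cmax)" and L: "2 \<le> L" and q: "1 \<le> q"
  shows "prob (RE_event L - noise_event q) \<le> exp (- (q\<^sup>2 * (cplx / real sg)))"
proof -
  define T where "T = (SIGMA g:P. gvecs g)"
  define A where "A gw = {\<omega> \<in> RE_event L. (\<Sum>i<p. real_of_int (snd gw i) * z \<omega> i) > r * (q * lam / 4)}"
    for gw :: "nat set \<times> (nat \<Rightarrow> int)"
  have A: "A gw \<in> events" for gw unfolding A_def by measurable
  have finT: "finite T" unfolding T_def using finite_P gvecs_card(1) by auto
  have "RE_event L - noise_event q = (\<Union>gw\<in>T. A gw)"
    by (force simp: T_def A_def noise_event_def RE_event_def not_le)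
  also have "prob (\<Union>gw\<in>T. A gw) \<le> (real d * exp (8 * r * ln (exp 1 * real b))) *
     exp (- (q\<^sup>2 * C\<^sup>2 / (256 * Cmax) * (cplx / real sg)))"
  proof (rule union_bound[OF finT A])
    fix gw assume "gw \<in> T"
    then obtain g w where "gw = (g, w)" "g \<in> P" "w \<in> gvecs g" by (auto simp: T_def)
    then show "prob (A gw) \<le> exp (- (q\<^sup>2 * C\<^sup>2 / (256 * Cmax) * (cplx / real sg)))"
      unfolding A_def using L q noise_direction_prob[of g w L q] by simp
  next
    have "card T = (\<Sum>g\<in>P. card (gvecs g))" unfolding T_def using finite_P gvecs_card(1) by (simp add: card_SigmaI)
    then have "real (card T) = (\<Sum>g\<in>P. real (card (gvecs g)))" by simp
    also have "\<dots> \<le> (\<Sum>g\<in>P. exp (8 * r * ln (exp 1 * real b)))" by (intro sum_mono gvecs_card)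
    finally show "real (card T) \<le> real d * exp (8 * r * ln (exp 1 * real b))" by simp
  qed simp
  also have "\<dots> \<le> exp (11 * (cplx / real sg)) * exp (- (q\<^sup>2 * C\<^sup>2 / (256 * Cmax) * (cplx / real sg)))"
    by (intro mult_right_mono count_groups) auto
  also have "\<dots> = exp (11 * (cplx / real sg) - q\<^sup>2 * C\<^sup>2 / (256 * Cmax) * (cplx / real sg))" by (simp flip: exp_add)
  also have "\<dots> \<le> exp (- (q\<^sup>2 * (cplx / real sg)))"
  proof -
    \<comment> \<open>\<open>12 * q\<^sup>2 \<ge> 11 + q\<^sup>2\<close> since
      \<open>q \<ge> 1\<close>: the eleven pay for the union bound, and \<open>q\<^sup>2\<close>
      survives.\<close>
    have "q\<^sup>2 * 12 \<le> q\<^sup>2 * (C\<^sup>2 / (256 * Cmax))" using C by (intro mult_left_mono) auto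
    moreover have "1 \<le> q\<^sup>2" using q by simp
    ultimately have K: "11 + q\<^sup>2 \<le> q\<^sup>2 * C\<^sup>2 / (256 * Cmax)" by simp
    define u K where "u = cplx / real sg" and "K = q\<^sup>2 * C\<^sup>2 / (256 * Cmax)"
    have "(11 + q\<^sup>2) * u \<le> K * u"
      using K cplx_pos unfolding u_def K_def by (intro mult_right_mono) auto
    then show ?thesis unfolding u_def[symmetric] K_def[symmetric] by (simp add: distrib_right)
  qed
  finally show ?thesis .
qed

subsection \<open>Lasso error and debiasing remainder\<close>

definition err :: "'a \<Rightarrow> nat \<Rightarrow> real" where "err \<omega> i = \<beta>hat \<omega> $ i - \<beta> $ i"

definition pen :: "(nat \<Rightarrow> real) \<Rightarrow> real" where
  "pen f = lam * (\<Sum>i<p. \<bar>f i\<bar>) + lamg * (\<Sum>g\<in>P. L2_set f g)"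

lemma noise_inner_bound:
  assumes \<omega>: "\<omega> \<in> noise_event q" and q: "0 \<le> q"
  shows "\<bar>\<Sum>i<p. z \<omega> i * \<delta> i\<bar> \<le> q / 4 * pen \<delta>"
proof -
  have "L2_set (\<lambda>i. soft_threshold (q * lam / 4) (z \<omega> i)) g \<le> sqrt r * (q * lam / 4)" if "g \<in> P" for g
    using \<omega> that q lam_pos by (intro group_soft_threshold_bound) (auto simp: noise_event_def)
  then have "\<bar>\<Sum>i<p. z \<omega> i * \<delta> i\<bar> \<le> q * lam / 4 * (\<Sum>i<p. \<bar>\<delta> i\<bar>) + sqrt r * (q * lam / 4) * (\<Sum>g\<in>P. L2_set \<delta> g)"
    using part q lam_pos by (intro threshold_dual_bound_abs) auto
  also have "\<dots> = q / 4 * pen \<delta>" by (simp add: pen_def lamg_eq r_def algebra_simps)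
  finally show ?thesis .
qed

lemma residual_nth:
  assumes \<omega>: "\<omega> \<in> space M" and k: "k < n" and b: "v \<in> carrier_vec p"
  shows "(Y \<omega> - X \<omega> *\<^sub>v v) $ k = \<epsilon> \<omega> $ k - (\<Sum>i<p. (v $ i - \<beta> $ i) * Matrix.row (X \<omega>) k $ i)"
proof -
  have "(X \<omega> *\<^sub>v u) $ k = (\<Sum>i<p. u $ i * Matrix.row (X \<omega>) k $ i)" if "u \<in> carrier_vec p" for u
    using X_carrier[OF \<omega>] k that by (auto simp: scalar_prod_def atLeast0LessThan mult.commute intro!: sum.cong)
  then show ?thesis
    using X_carrier[OF \<omega>] \<epsilon>_carrier[OF \<omega>] \<beta>_carrier k b
    by (simp add: Y_eq[OF \<omega>] left_diff_distrib sum_subtractf)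
qed

text \<open>Optimality of \<open>\<beta>hat\<close> against the true \<open>\<beta>\<close>; the
  squared noise cancels from the two objectives.\<close>

lemma lasso_basic:
  assumes \<omega>: "\<omega> \<in> space M"
  shows "real n * (\<Sum>i<p. \<Sum>j<p. err \<omega> i * H \<omega> i j * err \<omega> j) - 2 * (\<Sum>i<p. z \<omega> i * err \<omega> i) + pen (\<lambda>i. \<beta>hat \<omega> $ i)
     \<le> pen (\<lambda>i. \<beta> $ i)"
proof -
  note c = X_carrier[OF \<omega>] \<epsilon>_carrier[OF \<omega>] \<beta>_carrier \<beta>hat_carrier[OF \<omega>]
  define F where "F b = (norm_2 (Y \<omega> - X \<omega> *\<^sub>v b))\<^sup>2 + lam * norm_1 b + lamg * norm_1_2 P b" for b
  have F: "F v = (\<Sum>k<n. (\<epsilon> \<omega> $ k - (\<Sum>i<p. (v $ i - \<beta> $ i) * Matrix.row (X \<omega>) k $ i))\<^sup>2) + pen (\<lambda>i. v $ i)"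
    if v: "v \<in> carrier_vec p" for v
  proof -
    have "(norm_2 (Y \<omega> - X \<omega> *\<^sub>v v))\<^sup>2 = (\<Sum>k<n. ((Y \<omega> - X \<omega> *\<^sub>v v) $ k)\<^sup>2)"
      using c by (simp add: norm_2_def L2_set_def sum_nonneg)
    also have "\<dots> = (\<Sum>k<n. (\<epsilon> \<omega> $ k - (\<Sum>i<p. (v $ i - \<beta> $ i) * Matrix.row (X \<omega>) k $ i))\<^sup>2)"
      by (intro sum.cong refl) (simp add: residual_nth[OF \<omega> _ v])
    finally show ?thesis using v by (simp add: F_def pen_def norm_1_def norm_1_2_def)
  qed
  have "F (\<beta>hat \<omega>) \<le> F \<beta>"
    using \<beta>hat[OF \<omega>] c unfolding is_sparse_group_lasso_def is_arg_min_def F_def by (auto simp: not_less)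
  then have "(\<Sum>k<n. (\<epsilon> \<omega> $ k - (\<Sum>i<p. err \<omega> i * Matrix.row (X \<omega>) k $ i))\<^sup>2) + pen (\<lambda>i. \<beta>hat \<omega> $ i)
      \<le> (\<Sum>k<n. (\<epsilon> \<omega> $ k)\<^sup>2) + pen (\<lambda>i. \<beta> $ i)"
    using c by (simp add: F err_def)
  moreover have "(\<Sum>k<n. (\<epsilon> \<omega> $ k - (\<Sum>i<p. err \<omega> i * Matrix.row (X \<omega>) k $ i))\<^sup>2) =
      (\<Sum>k<n. (\<epsilon> \<omega> $ k)\<^sup>2) - 2 * (\<Sum>k<n. \<epsilon> \<omega> $ k * (\<Sum>i<p. err \<omega> i * Matrix.row (X \<omega>) k $ i)) +
      (\<Sum>k<n. (\<Sum>i<p. err \<omega> i * Matrix.row (X \<omega>) k $ i)\<^sup>2)"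
    by (simp add: power2_diff sum.distrib sum_subtractf sum_distrib_left mult_ac)
  moreover have "(\<Sum>k<n. \<epsilon> \<omega> $ k * (\<Sum>i<p. err \<omega> i * Matrix.row (X \<omega>) k $ i)) = (\<Sum>i<p. z \<omega> i * err \<omega> i)"
  proof -
    have "(\<Sum>k<n. \<epsilon> \<omega> $ k * (\<Sum>i<p. err \<omega> i * Matrix.row (X \<omega>) k $ i)) =
        (\<Sum>k<n. \<Sum>i<p. \<epsilon> \<omega> $ k * (err \<omega> i * Matrix.row (X \<omega>) k $ i))" by (simp add: sum_distrib_left)
    also have "\<dots> = (\<Sum>i<p. \<Sum>k<n. \<epsilon> \<omega> $ k * (err \<omega> i * Matrix.row (X \<omega>) k $ i))" by (rule sum.swap)
    also have "\<dots> = (\<Sum>i<p. \<Sum>k<n. Matrix.row (X \<omega>) k $ i * \<epsilon> \<omega> $ k * err \<omega> i)"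
      by (intro sum.cong refl) (simp only: mult_ac)
    finally show ?thesis unfolding z_def sum_distrib_right .
  qed
  moreover have "(\<Sum>k<n. (\<Sum>i<p. err \<omega> i * Matrix.row (X \<omega>) k $ i)\<^sup>2) =
      real n * (\<Sum>i<p. \<Sum>j<p. err \<omega> i * H \<omega> i j * err \<omega> j)"
    using n_pos unfolding H_quadratic by (simp add: power2_eq_square)
  ultimately show ?thesis by simp
qed

lemma card_supp_le: "card {i \<in> {..<p}. \<beta> $ i \<noteq> 0} \<le> s" "card {g \<in> P. \<exists>i\<in>g. \<beta> $ i \<noteq> 0} \<le> sg"
proof -
  have "{i \<in> {..<p}. \<beta> $ i \<noteq> 0} = supp \<beta>" using \<beta>_carrier by (auto simp: supp_def)
  then show "card {i \<in> {..<p}. \<beta> $ i \<noteq> 0} \<le> s" using \<beta>_sparse by (simp add: sparse_def norm_0_def)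
  show "card {g \<in> P. \<exists>i\<in>g. \<beta> $ i \<noteq> 0} \<le> sg" using \<beta>_sparse by (simp add: sparse_def norm_0_2_def)
qed

lemma err_cone:
  assumes \<omega>: "\<omega> \<in> noise_event 1"
  shows "cone 8 (err \<omega>)"
proof -
  have \<omega>': "\<omega> \<in> space M" using \<omega> by (simp add: noise_event_def)
  have A: "0 \<le> real n * (\<Sum>i<p. \<Sum>j<p. err \<omega> i * H \<omega> i j * err \<omega> j)"
    unfolding H_quadratic by (simp add: sum_nonneg)
  note * = lasso_cone[OF _ part lam_pos s_pos sg_pos card_supp_le _ A lamg_eq lasso_basic[OF \<omega>', unfolded pen_def]
      noise_inner_bound[OF \<omega> zero_le_one, of "err \<omega>", unfolded pen_def]]
  have "\<beta>hat \<omega> $ i = \<beta> $ i + err \<omega> i" for i by (simp add: err_def)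
  from *[OF finite_lessThan this] show ?thesis unfolding cone_def by simp
qed

text \<open>The cone is a hypothesis because its source differs: the basic inequality for
  \<open>q = 1\<close>, a bounded dimension otherwise. With \<open>\<mu> = n * cmin / 2\<close> the
  factor \<open>n\<close> in \<open>lam\<^sup>2\<close> cancels.\<close>

lemma err_pen_bound:
  assumes \<omega>: "\<omega> \<in> noise_event q" "\<omega> \<in> RE_event L" and q: "0 \<le> q" and L: "0 \<le> L" and c: "cone L (err \<omega>)"
  shows "pen (err \<omega>) \<le> (q / 2 + 1) * 8 * L\<^sup>2 * (C\<^sup>2 * \<sigma>\<^sup>2 * cplx) / cmin"
proof -
  have \<omega>': "\<omega> \<in> space M" using \<omega> by (simp add: noise_event_def)
  have "real n * (cmin / 2 * (L2_set (err \<omega>) {..<p})\<^sup>2) \<le> real n * (\<Sum>i<p. \<Sum>j<p. err \<omega> i * H \<omega> i j * err \<omega> j)"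
    by (intro mult_left_mono H_cone_bounds(1)[OF \<omega>(2) L c]) simp
  then have A: "(real n * (cmin / 2)) * (L2_set (err \<omega>) {..<p})\<^sup>2 \<le> real n * (\<Sum>i<p. \<Sum>j<p. err \<omega> i * H \<omega> i j * err \<omega> j)"
    by (simp only: mult.assoc)
  have "pen (err \<omega>) \<le> (q / 2 + 1) * 4 * lam\<^sup>2 * L\<^sup>2 * real s / (real n * (cmin / 2))"
    unfolding pen_def
  proof (rule lasso_rate[OF _ part lam_pos s_pos sg_pos _ lamg_eq lasso_basic[OF \<omega>', unfolded pen_def]
        noise_inner_bound[OF \<omega>(1) q, unfolded pen_def] q L _ _ A])
    show "\<beta>hat \<omega> $ i = \<beta> $ i + err \<omega> i" for i by (simp add: err_def)
  qed (use c n_pos const_pos in \<open>auto simp: cone_def\<close>)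
  also have "\<dots> = (q / 2 + 1) * 4 * L\<^sup>2 * (lam\<^sup>2 * real s) / (real n * (cmin / 2))" by (simp only: mult_ac)
  also have "\<dots> = (q / 2 + 1) * 8 * L\<^sup>2 * (C\<^sup>2 * \<sigma>\<^sup>2 * cplx) / cmin"
    unfolding lam_sq using n_pos by simp
  finally show ?thesis .
qed

section \<open>Debiased estimator: Gaussian part and remainder\<close>

definition W :: "'a \<Rightarrow> real Matrix.vec" where
  "W \<omega> = (1 / sqrt (real n)) \<cdot>\<^sub>v (debias_mat mhat (X \<omega>) *\<^sub>v (transpose_mat (X \<omega>) *\<^sub>v \<epsilon> \<omega>))"

definition dev :: "'a \<Rightarrow> real Matrix.vec" where
  "dev \<omega> = sqrt (real n) \<cdot>\<^sub>v (debiased (debias_mat mhat (X \<omega>)) (X \<omega>) (Y \<omega>) (\<beta>hat \<omega>) - \<beta>)"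

lemma debias_mat_carrier: "A \<in> carrier_mat n p \<Longrightarrow> debias_mat mhat A \<in> carrier_mat p p"
  and debias_mat_row: "A \<in> carrier_mat n p \<Longrightarrow> i < p \<Longrightarrow> Matrix.row (debias_mat mhat A) i = mhat A i"
proof -
  assume A: "A \<in> carrier_mat n p"
  show "debias_mat mhat A \<in> carrier_mat p p" using A by (simp add: debias_mat_def mat_of_rows_def)
  assume i: "i < p"
  have "mhat A i \<in> carrier_vec p" using measurable_space[OF mhat_meas[OF i]] A by (simp add: space_vec_borel space_mat_borel)
  then show "Matrix.row (debias_mat mhat A) i = mhat A i" using A i by (simp add: debias_mat_def)
qed

lemma W_carrier: "\<omega> \<in> space M \<Longrightarrow> W \<omega> \<in> carrier_vec p"
  and dev_carrier: "\<omega> \<in> space M \<Longrightarrow> dev \<omega> \<in> carrier_vec p"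
proof -
  assume \<omega>: "\<omega> \<in> space M"
  show "W \<omega> \<in> carrier_vec p" unfolding W_def
    using debias_mat_carrier[OF X_carrier[OF \<omega>]] by (intro carrier_vecI) simp
  show "dev \<omega> \<in> carrier_vec p" unfolding dev_def using \<beta>_carrier by (intro carrier_vecI) simp
qed

lemma transpose_design_nth:
  assumes \<omega>: "\<omega> \<in> space M" and v: "v \<in> carrier_vec n" and l: "l < p"
  shows "(transpose_mat (X \<omega>) *\<^sub>v v) $ l = (\<Sum>k<n. Matrix.row (X \<omega>) k $ l * v $ k)"
  using X_carrier[OF \<omega>] v l by (auto simp: scalar_prod_def atLeast0LessThan intro!: sum.cong)

lemma W_nth:
  assumes \<omega>: "\<omega> \<in> space M" and i: "i < p"
  shows "W \<omega> $ i = (\<Sum>l<p. mhat (X \<omega>) i $ l * z \<omega> l) / sqrt (real n)"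
proof -
  note c = X_carrier[OF \<omega>] \<epsilon>_carrier[OF \<omega>] debias_mat_carrier[OF X_carrier[OF \<omega>]]
  have "W \<omega> $ i = (mhat (X \<omega>) i \<bullet> (transpose_mat (X \<omega>) *\<^sub>v \<epsilon> \<omega>)) / sqrt (real n)"
    using c i by (simp add: W_def debias_mat_row)
  also have "mhat (X \<omega>) i \<bullet> (transpose_mat (X \<omega>) *\<^sub>v \<epsilon> \<omega>) = (\<Sum>l<p. mhat (X \<omega>) i $ l * z \<omega> l)"
    using c by (auto simp: scalar_prod_def[of "mhat (X \<omega>) i"] atLeast0LessThan transpose_design_nth[OF \<omega>] z_def intro!: sum.cong
        simp del: index_mult_mat_vec)
  finally show ?thesis .
qed

text \<open>The Lasso residual is the noise minus the design applied to \<open>err\<close>, and its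
  noise part reproduces \<open>W\<close>. What remains is \<open>sqrt n\<close> times
  \<open>err\<close> minus the debiased sample covariance applied to \<open>err\<close>; by symmetry
  of the sample covariance, entry \<open>i\<close> pairs the constraint residual of the
  \<open>i\<close>-th program with \<open>err\<close>.\<close>

lemma remainder_eq:
  assumes \<omega>: "\<omega> \<in> space M" and i: "i < p"
  shows "dev \<omega> $ i - W \<omega> $ i = - sqrt (real n) * (\<Sum>j<p. (sample_cov (X \<omega>) *\<^sub>v mhat (X \<omega>) i - unit_vec p i) $ j * err \<omega> j)"
proof -
  note c = X_carrier[OF \<omega>] \<epsilon>_carrier[OF \<omega>] debias_mat_carrier[OF X_carrier[OF \<omega>]] \<beta>_carrier \<beta>hat_carrier[OF \<omega>]
    mhat_carrier[OF \<omega> i] sample_cov_carrier[OF \<omega>]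
  define m where "m l = mhat (X \<omega>) i $ l" for l
  have res: "Y \<omega> - X \<omega> *\<^sub>v \<beta>hat \<omega> \<in> carrier_vec n" using c by (simp add: Y_eq[OF \<omega>])
  have grad: "(transpose_mat (X \<omega>) *\<^sub>v (Y \<omega> - X \<omega> *\<^sub>v \<beta>hat \<omega>)) $ l = z \<omega> l - real n * (\<Sum>j<p. H \<omega> l j * err \<omega> j)"
    if l: "l < p" for l
  proof -
    have "(transpose_mat (X \<omega>) *\<^sub>v (Y \<omega> - X \<omega> *\<^sub>v \<beta>hat \<omega>)) $ l =
        (\<Sum>k<n. Matrix.row (X \<omega>) k $ l * (\<epsilon> \<omega> $ k - (\<Sum>j<p. err \<omega> j * Matrix.row (X \<omega>) k $ j)))"
      unfolding transpose_design_nth[OF \<omega> res l] err_def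
      by (rule sum.cong[OF refl], subst residual_nth[OF \<omega>]) (use c in auto)
    also have "\<dots> = z \<omega> l - (\<Sum>k<n. \<Sum>j<p. Matrix.row (X \<omega>) k $ l * Matrix.row (X \<omega>) k $ j * err \<omega> j)"
      by (simp add: z_def right_diff_distrib sum_subtractf sum_distrib_left mult_ac)
    also have "(\<Sum>k<n. \<Sum>j<p. Matrix.row (X \<omega>) k $ l * Matrix.row (X \<omega>) k $ j * err \<omega> j) =
        (\<Sum>j<p. \<Sum>k<n. Matrix.row (X \<omega>) k $ l * Matrix.row (X \<omega>) k $ j * err \<omega> j)" by (rule sum.swap)
    also have "\<dots> = real n * (\<Sum>j<p. H \<omega> l j * err \<omega> j)"
    proof -
      have "real n * H \<omega> l j = (\<Sum>k<n. Matrix.row (X \<omega>) k $ l * Matrix.row (X \<omega>) k $ j)" for j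
        using n_pos by (simp add: H_def)
      then show ?thesis by (simp add: sum_distrib_left flip: sum_distrib_right mult.assoc)
    qed
    finally show ?thesis .
  qed
  have "dev \<omega> $ i = sqrt (real n) * (err \<omega> i + (mhat (X \<omega>) i \<bullet> (transpose_mat (X \<omega>) *\<^sub>v (Y \<omega> - X \<omega> *\<^sub>v \<beta>hat \<omega>))) / real n)"
    using c i by (simp add: dev_def debiased_def debias_mat_row err_def)
  also have "mhat (X \<omega>) i \<bullet> (transpose_mat (X \<omega>) *\<^sub>v (Y \<omega> - X \<omega> *\<^sub>v \<beta>hat \<omega>)) =
     (\<Sum>l<p. m l * (z \<omega> l - real n * (\<Sum>j<p. H \<omega> l j * err \<omega> j)))"
    using c by (auto simp: scalar_prod_def[of "mhat (X \<omega>) i"] atLeast0LessThan grad m_def intro!: sum.cong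
        simp del: index_mult_mat_vec)
  also have "\<dots> = (\<Sum>l<p. m l * z \<omega> l) - real n * (\<Sum>l<p. \<Sum>j<p. m l * H \<omega> l j * err \<omega> j)"
    by (simp add: right_diff_distrib sum_subtractf sum_distrib_left mult_ac)
  finally have dev_i: "dev \<omega> $ i = sqrt (real n) * (err \<omega> i +
     ((\<Sum>l<p. m l * z \<omega> l) - real n * (\<Sum>l<p. \<Sum>j<p. m l * H \<omega> l j * err \<omega> j)) / real n)" .
  have "t * (e + (x - t * t * y) / (t * t)) - x / t = t * (e - y)" if "0 < t" for t e x y :: real
    using that by (simp add: field_simps)
  from this[of "sqrt (real n)"]
  have 1: "dev \<omega> $ i - W \<omega> $ i = sqrt (real n) * (err \<omega> i - (\<Sum>l<p. \<Sum>j<p. m l * H \<omega> l j * err \<omega> j))"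
    using n_pos unfolding dev_i W_nth[OF \<omega> i] m_def by simp
  have "(\<Sum>j<p. (sample_cov (X \<omega>) *\<^sub>v mhat (X \<omega>) i - unit_vec p i) $ j * err \<omega> j) =
      (\<Sum>j<p. (\<Sum>l<p. m l * H \<omega> l j) * err \<omega> j - (if j = i then err \<omega> j else 0))"
  proof (rule sum.cong[OF refl])
    fix j assume "j \<in> {..<p}"
    then have j: "j < p" by simp
    have "(sample_cov (X \<omega>) *\<^sub>v mhat (X \<omega>) i) $ j = (\<Sum>l<p. H \<omega> j l * m l)"
      using c j by (auto simp: scalar_prod_def atLeast0LessThan H_eq_sample_cov[OF \<omega>] m_def intro!: sum.cong)
    also have "\<dots> = (\<Sum>l<p. m l * H \<omega> l j)" by (simp add: H_def mult.commute)
    finally show "(sample_cov (X \<omega>) *\<^sub>v mhat (X \<omega>) i - unit_vec p i) $ j * err \<omega> j =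
      (\<Sum>l<p. m l * H \<omega> l j) * err \<omega> j - (if j = i then err \<omega> j else 0)"
      using j i by (simp add: left_diff_distrib)
  qed
  also have "\<dots> = (\<Sum>l<p. \<Sum>j<p. m l * H \<omega> l j * err \<omega> j) - err \<omega> i"
    using i by (simp add: sum_subtractf) (subst sum_swap_bilinear, simp)
  finally have 2: "(\<Sum>j<p. (sample_cov (X \<omega>) *\<^sub>v mhat (X \<omega>) i - unit_vec p i) $ j * err \<omega> j) =
      (\<Sum>l<p. \<Sum>j<p. m l * H \<omega> l j * err \<omega> j) - err \<omega> i" .
  show ?thesis unfolding 1 2 by (simp add: right_diff_distrib)
qed

text \<open>\<open>\<alpha>\<close> and \<open>\<gamma>\<close> are \<open>lam\<close> and
  \<open>lamg\<close> divided by \<open>n * \<sigma>\<close>, so duality turns the constraint into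
  the penalty of the error over \<open>n * \<sigma>\<close>, and \<open>err_pen_bound\<close>
  applies.\<close>

lemma remainder_bound:
  assumes \<omega>: "\<omega> \<in> noise_event q" "\<omega> \<in> RE_event L" and q: "0 \<le> q" and L: "0 \<le> L" and c: "cone L (err \<omega>)"
    and i: "i < p" and feas: "debias_feasible P \<alpha> \<gamma> (X \<omega>) i (mhat (X \<omega>) i)"
  shows "\<bar>dev \<omega> $ i - W \<omega> $ i\<bar> \<le> (q / 2 + 1) * 8 * L\<^sup>2 * C\<^sup>2 / cmin * (\<sigma> * cplx / sqrt (real n))"
proof -
  have \<omega>': "\<omega> \<in> space M" using \<omega> by (simp add: noise_event_def)
  let ?u = "sample_cov (X \<omega>) *\<^sub>v mhat (X \<omega>) i - unit_vec p i"
  have dimX: "dim_col (X \<omega>) = p" using X_carrier[OF \<omega>'] by simp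
  have "L2_set (\<lambda>j. soft_threshold \<alpha> (?u $ j)) g \<le> \<gamma>" if g: "g \<in> P" for g
  proof -
    have "L2_set (\<lambda>j. soft_threshold \<alpha> (?u $ j)) g = L2_set (\<lambda>j. map_vec (soft_threshold \<alpha>) ?u $ j) g"
      using group_subset[OF g] sample_cov_carrier[OF \<omega>'] by (intro L2_set_cong) auto
    also have "\<dots> \<le> norm_inf_2 P (map_vec (soft_threshold \<alpha>) ?u)"
      unfolding norm_inf_2_def using finite_P g by (intro Max_ge) auto
    also have "\<dots> \<le> \<gamma>" using feas dimX by (simp add: debias_feasible_def)
    finally show ?thesis .
  qed
  then have "\<bar>\<Sum>j<p. ?u $ j * err \<omega> j\<bar> \<le> \<alpha> * (\<Sum>j<p. \<bar>err \<omega> j\<bar>) + \<gamma> * (\<Sum>g\<in>P. L2_set (err \<omega>) g)"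
    using part \<alpha>_pos by (intro threshold_dual_bound_abs) auto
  also have "\<dots> = pen (err \<omega>) / (real n * \<sigma>)" by (simp add: pen_def \<alpha>_eq \<gamma>_eq2 add_divide_distrib)
  also have "\<dots> \<le> ((q / 2 + 1) * 8 * L\<^sup>2 * (C\<^sup>2 * \<sigma>\<^sup>2 * cplx) / cmin) / (real n * \<sigma>)"
    using err_pen_bound[OF \<omega> q L c] n_pos \<sigma>_pos by (intro divide_right_mono) auto
  finally have "sqrt (real n) * \<bar>\<Sum>j<p. ?u $ j * err \<omega> j\<bar> \<le>
      sqrt (real n) * (((q / 2 + 1) * 8 * L\<^sup>2 * (C\<^sup>2 * \<sigma>\<^sup>2 * cplx) / cmin) / (real n * \<sigma>))"
    by (intro mult_left_mono) auto
  also have "\<dots> = (q / 2 + 1) * 8 * L\<^sup>2 * C\<^sup>2 / cmin * (\<sigma> * cplx * (sqrt (real n) / real n))"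
    using \<sigma>_pos by (simp add: power2_eq_square)
  also have "sqrt (real n) / real n = 1 / sqrt (real n)" by (simp add: real_div_sqrt sqrt_divide_self_eq inverse_eq_divide)
  finally show ?thesis unfolding remainder_eq[OF \<omega>' i] by (simp add: abs_mult)
qed

text \<open>Feasibility keeps entry \<open>i\<close> of the sample covariance times \<open>m\<close>
  within \<open>\<alpha> + \<gamma>\<close> of one, hence at least \<open>1 / 2\<close>. By
  Cauchy-Schwarz against the unit vector \<open>e\<close>, the product of the forms at
  \<open>e\<close> and at \<open>m\<close> is at least \<open>1 / 4\<close>; and \<open>e\<close>,
  an integer direction in one group, has form at most \<open>2 * Cmax\<close>.\<close>

lemma variance_lower_bound:
  assumes \<omega>: "\<omega> \<in> RE_event L" and L: "2 \<le> L" and i: "i < p"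
    and feas: "debias_feasible P \<alpha> \<gamma> (X \<omega>) i (mhat (X \<omega>) i)" and small: "\<alpha> + \<gamma> \<le> 1 / 2"
  shows "1 / (8 * Cmax) \<le> mhat (X \<omega>) i \<bullet> (sample_cov (X \<omega>) *\<^sub>v mhat (X \<omega>) i)"
proof -
  have \<omega>': "\<omega> \<in> space M" using \<omega> by (simp add: RE_event_def)
  define m where "m = mhat (X \<omega>) i"
  have m: "m \<in> carrier_vec p" unfolding m_def by (rule mhat_carrier[OF \<omega>' i])
  note SC = sample_cov_carrier[OF \<omega>']
  let ?u = "sample_cov (X \<omega>) *\<^sub>v m - unit_vec p i"
  have dimX: "dim_col (X \<omega>) = p" using X_carrier[OF \<omega>'] by simp
  obtain g where g: "g \<in> P" "i \<in> g" using Union_P i by blast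
  have "\<bar>soft_threshold \<alpha> (?u $ i)\<bar> \<le> L2_set (\<lambda>j. soft_threshold \<alpha> (?u $ j)) g"
    using member_le_L2_set[OF finite_group[OF g(1)] g(2), of "\<lambda>j. \<bar>soft_threshold \<alpha> (?u $ j)\<bar>"] by (simp add: L2_set_def)
  also have "\<dots> = L2_set (\<lambda>j. map_vec (soft_threshold \<alpha>) ?u $ j) g"
    using group_subset[OF g(1)] SC by (intro L2_set_cong) auto
  also have "\<dots> \<le> norm_inf_2 P (map_vec (soft_threshold \<alpha>) ?u)"
    unfolding norm_inf_2_def using finite_P g by (intro Max_ge) auto
  also have "\<dots> \<le> \<gamma>" using feas dimX by (simp add: debias_feasible_def m_def)
  finally have "\<bar>?u $ i\<bar> \<le> \<alpha> + \<gamma>" using clip_soft_threshold[of \<alpha> "?u $ i"] \<alpha>_pos by linarith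
  moreover have "?u $ i = (sample_cov (X \<omega>) *\<^sub>v m) $ i - 1" using SC i by simp
  ultimately have h: "1 / 2 \<le> (sample_cov (X \<omega>) *\<^sub>v m) $ i" using small by linarith
  have qf: "v \<bullet> (sample_cov (X \<omega>) *\<^sub>v v) = (\<Sum>i<p. \<Sum>j<p. v $ i * H \<omega> i j * v $ j)" if "v \<in> carrier_vec p" for v
    unfolding scalar_prod_mult_mat_vec[OF SC that that] by (intro sum.cong refl) (simp add: H_eq_sample_cov[OF \<omega>'])
  have psd: "0 \<le> v \<bullet> (sample_cov (X \<omega>) *\<^sub>v v)" if "v \<in> carrier_vec p" for v
    unfolding qf[OF that] H_quadratic by (simp add: sum_nonneg)
  have sym: "transpose_mat (sample_cov (X \<omega>)) = sample_cov (X \<omega>)"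
    using SC by (intro eq_matI) (auto simp flip: H_eq_sample_cov[OF \<omega>'] simp: H_def mult.commute)
  define e :: "real Matrix.vec" where "e = unit_vec p i"
  have e: "e \<in> carrier_vec p" by (simp add: e_def)
  have "(1 / 2)\<^sup>2 \<le> (e \<bullet> (sample_cov (X \<omega>) *\<^sub>v m))\<^sup>2"
    using h SC m i by (intro power_mono) (auto simp: e_def)
  also have "\<dots> \<le> (e \<bullet> (sample_cov (X \<omega>) *\<^sub>v e)) * (m \<bullet> (sample_cov (X \<omega>) *\<^sub>v m))"
    by (rule psd_cauchy_schwarz[OF SC sym psd e m])
  also have "\<dots> \<le> (2 * Cmax) * (m \<bullet> (sample_cov (X \<omega>) *\<^sub>v m))"
  proof (rule mult_right_mono[OF _ psd[OF m]])
    define w :: "nat \<Rightarrow> int" where "w j = (if j = i then 1 else 0)" for j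
    have w: "real_of_int (w j) = e $ j" if "j < p" for j using that i by (simp add: w_def e_def)
    have sq: "(\<Sum>j\<in>A. (real_of_int (w j))\<^sup>2) = 1" if "finite A" "i \<in> A" for A
    proof -
      have "(\<Sum>j\<in>A. (real_of_int (w j))\<^sup>2) = (\<Sum>j\<in>A. if j = i then 1 else 0)" by (intro sum.cong) (auto simp: w_def)
      then show ?thesis using that by simp
    qed
    have "w \<in> gvecs g" using sq[OF finite_group[OF g(1)] g(2)] g r_ge1 by (auto simp: gvecs_def w_def)
    then have "cone L (\<lambda>j. real_of_int (w j))" by (intro gvecs_cone[OF g(1) _ L])
    from H_cone_bounds(2)[OF \<omega> _ this]
    have "(\<Sum>i<p. \<Sum>j<p. real_of_int (w i) * H \<omega> i j * real_of_int (w j)) \<le> 2 * Cmax"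
      using L sq[of "{..<p}"] i by (simp add: L2_set_def)
    then show "e \<bullet> (sample_cov (X \<omega>) *\<^sub>v e) \<le> 2 * Cmax" unfolding qf[OF e] by (simp add: w)
  qed
  finally show ?thesis using const_pos by (simp add: m_def power2_eq_square field_simps)
qed

end

text \<open>\<open>Z\<close> follows \<open>\<nu>\<close> only relative to the event
  \<open>A\<close>, which is large because it contains \<open>G\<close>. Upwards one
  \<open>\<eta>\<close> is lost outside \<open>G\<close>; downwards a second one is lost because
  \<open>prob A\<close> may fall short of one.\<close>

lemma (in prob_space) cdf_sandwich:
  assumes T[measurable]: "T \<in> borel_measurable M" and Z[measurable]: "Z \<in> borel_measurable M"
    and A[measurable]: "A \<in> events" and G[measurable]: "G \<in> events" "G \<subseteq> A"
    and law: "\<And>B. B \<in> sets borel \<Longrightarrow> prob {\<omega> \<in> A. Z \<omega> \<in> B} = prob A * measure \<nu> B" and \<nu>: "prob_space \<nu>" "sets \<nu> = sets borel"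
    and close: "\<And>\<omega>. \<omega> \<in> G \<Longrightarrow> \<bar>T \<omega> - Z \<omega>\<bar> \<le> \<zeta>" and pG: "1 - \<eta> \<le> prob G"
  shows "cdf (distr M borel T) x \<le> cdf \<nu> (x + \<zeta>) + \<eta>" "cdf \<nu> (x - \<zeta>) - 2 * \<eta> \<le> cdf (distr M borel T) x"
proof -
  interpret N: prob_space \<nu> by fact
  have cT: "cdf (distr M borel T) x = prob {\<omega> \<in> space M. T \<omega> \<le> x}"
    unfolding cdf_def by (subst measure_distr) (auto intro!: arg_cong[of _ _ prob])
  have AM: "A \<subseteq> space M" "G \<subseteq> space M" using A G sets.sets_into_space by blast+
  have Zle: "prob {\<omega> \<in> A. Z \<omega> \<le> y} = prob A * cdf \<nu> y" for y
    using law[of "{..y}"] by (simp add: cdf_def)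
  have co: "prob (space M - G) \<le> \<eta>" using pG prob_compl[OF G(1)] by simp
  have m1: "{\<omega> \<in> A. Z \<omega> \<le> y} \<in> events" for y
  proof -
    have "{\<omega> \<in> A. Z \<omega> \<le> y} = A \<inter> {\<omega> \<in> space M. Z \<omega> \<le> y}" using AM by auto
    then show ?thesis by simp
  qed
  have "{\<omega> \<in> space M. T \<omega> \<le> x} \<subseteq> {\<omega> \<in> A. Z \<omega> \<le> x + \<zeta>} \<union> (space M - G)"
    using close G(2) by (fastforce simp: abs_le_iff)
  then have "prob {\<omega> \<in> space M. T \<omega> \<le> x} \<le> prob ({\<omega> \<in> A. Z \<omega> \<le> x + \<zeta>} \<union> (space M - G))"
    using m1 by (intro finite_measure_mono) auto
  also have "\<dots> \<le> prob {\<omega> \<in> A. Z \<omega> \<le> x + \<zeta>} + prob (space M - G)" using m1 by (intro measure_Un_le) auto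
  also have "\<dots> \<le> 1 * cdf \<nu> (x + \<zeta>) + \<eta>"
    unfolding Zle using co by (intro add_mono mult_right_mono) (auto simp: cdf_def)
  finally show "cdf (distr M borel T) x \<le> cdf \<nu> (x + \<zeta>) + \<eta>" by (simp add: cT)
  have c01: "0 \<le> cdf \<nu> (x - \<zeta>)" "cdf \<nu> (x - \<zeta>) \<le> 1" by (auto simp: cdf_def)
  have pA: "1 - \<eta> \<le> prob A" using pG finite_measure_mono[OF G(2) A] by simp
  have "\<eta> \<ge> 0" using pG prob_le_1[of G] by linarith
  then have "cdf \<nu> (x - \<zeta>) - \<eta> \<le> (1 - \<eta>) * cdf \<nu> (x - \<zeta>)"
    using c01 mult_left_mono[OF c01(2), of \<eta>] by (simp add: algebra_simps)
  also have "\<dots> \<le> prob A * cdf \<nu> (x - \<zeta>)" using pA c01 by (intro mult_right_mono)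
  also have "\<dots> = prob {\<omega> \<in> A. Z \<omega> \<le> x - \<zeta>}" by (simp add: Zle)
  also have "\<dots> \<le> prob ({\<omega> \<in> space M. T \<omega> \<le> x} \<union> (space M - G))"
    using close AM by (intro finite_measure_mono) (fastforce simp: abs_le_iff)+
  also have "\<dots> \<le> prob {\<omega> \<in> space M. T \<omega> \<le> x} + prob (space M - G)" by (intro measure_Un_le) auto
  finally show "cdf \<nu> (x - \<zeta>) - 2 * \<eta> \<le> cdf (distr M borel T) x" using co by (simp add: cT)
qed

lemma smult_mat_mult_vec:
  fixes A :: "real mat"
  assumes "A \<in> carrier_mat nr nc" "v \<in> carrier_vec nc"
  shows "(c \<cdot>\<^sub>m A) *\<^sub>v v = c \<cdot>\<^sub>v (A *\<^sub>v v)"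
  using assms by (intro eq_vecI) (auto simp: scalar_prod_def sum_distrib_left mult.assoc)

context sgl
begin

subsection \<open>The Gaussian part\<close>

text \<open>\<open>W\<close> as a function of design and noise separately, as needed to freeze the
  design.\<close>

definition Wf :: "real mat \<Rightarrow> real Matrix.vec \<Rightarrow> real Matrix.vec" where
  "Wf A e = (1 / sqrt (real n)) \<cdot>\<^sub>v (debias_mat mhat A *\<^sub>v (transpose_mat A *\<^sub>v e))"

lemma mhat_nth_meas: "i < p \<Longrightarrow> l < p \<Longrightarrow> (\<lambda>A. mhat A i $ l) \<in> borel_measurable (mat_borel n p)"
  by (rule measurable_compose[OF mhat_meas measurable_vec_nth])

lemma Wf_carrier: "A \<in> carrier_mat n p \<Longrightarrow> Wf A e \<in> carrier_vec p"
  unfolding Wf_def using debias_mat_carrier[of A] by (intro carrier_vecI) simp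

lemma Wf_meas: "(\<lambda>(A, e). Wf A e) \<in> mat_borel n p \<Otimes>\<^sub>M vec_borel n \<rightarrow>\<^sub>M vec_borel p"
proof (rule measurable_vec_borelI)
  fix x assume "x \<in> space (mat_borel n p \<Otimes>\<^sub>M vec_borel n)"
  then show "(case x of (A, e) \<Rightarrow> Wf A e) \<in> carrier_vec p"
    by (auto simp: space_pair_measure space_mat_borel Wf_carrier)
next
  fix i assume i: "i < p"
  have "(\<lambda>x. (\<Sum>l<p. mhat (fst x) i $ l * (\<Sum>k<n. fst x $$ (k, l) * snd x $ k)) / sqrt (real n))
     \<in> borel_measurable (mat_borel n p \<Otimes>\<^sub>M vec_borel n)"
    by (intro borel_measurable_sum borel_measurable_times borel_measurable_divide borel_measurable_const
        measurable_compose[OF measurable_fst mhat_nth_meas] measurable_compose[OF measurable_fst measurable_mat_nth]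
        measurable_compose[OF measurable_snd measurable_vec_nth]) (use i in auto)
  moreover have "(case x of (A, e) \<Rightarrow> Wf A e) $ i = (\<Sum>l<p. mhat (fst x) i $ l * (\<Sum>k<n. fst x $$ (k, l) * snd x $ k)) / sqrt (real n)"
    if xs: "x \<in> space (mat_borel n p \<Otimes>\<^sub>M vec_borel n)" for x
  proof -
    obtain A e where x: "x = (A, e)" "A \<in> carrier_mat n p" "e \<in> carrier_vec n"
      using xs by (auto simp: space_pair_measure space_mat_borel space_vec_borel)
    have "Wf A e $ i = (mhat A i \<bullet> (transpose_mat A *\<^sub>v e)) / sqrt (real n)"
      using x i debias_mat_carrier[OF x(2)] by (simp add: Wf_def debias_mat_row)
    also have "mhat A i \<bullet> (transpose_mat A *\<^sub>v e) = (\<Sum>l<p. mhat A i $ l * (\<Sum>k<n. A $$ (k, l) * e $ k))"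
      using x by (auto simp: scalar_prod_def atLeast0LessThan intro!: sum.cong)
    finally show ?thesis by (simp add: x)
  qed
  ultimately show "(\<lambda>x. (case x of (A, e) \<Rightarrow> Wf A e) $ i) \<in> borel_measurable (mat_borel n p \<Otimes>\<^sub>M vec_borel n)"
    by (rule measurable_cong[THEN iffD2, rotated])
qed

lemma W_eq_Wf: "W \<omega> = Wf (X \<omega>) (\<epsilon> \<omega>)" by (simp add: W_def Wf_def)

lemma W_meas: "W \<in> M \<rightarrow>\<^sub>M vec_borel p"
proof -
  have "(\<lambda>\<omega>. (X \<omega>, \<epsilon> \<omega>)) \<in> M \<rightarrow>\<^sub>M mat_borel n p \<Otimes>\<^sub>M vec_borel n"
    using X_meas \<epsilon>_meas by (rule measurable_Pair)
  from measurable_compose[OF this Wf_meas] show ?thesis by (simp add: W_eq_Wf[abs_def])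
qed

abbreviation noise_dist :: "real Matrix.vec measure" where "noise_dist \<equiv> distr M (vec_borel n) \<epsilon>"

text \<open>The functional \<open>v\<close> of \<open>Wf A e\<close> is the noise combined with
  coefficients \<open>y / sqrt n\<close>, where \<open>y\<close> is \<open>A\<close> times the
  transposed debiasing matrix times \<open>v\<close>. The squared norm of these coefficients is the
  required quadratic form at \<open>v\<close>, up to \<open>\<sigma>\<^sup>2\<close>.\<close>

lemma Wf_law:
  assumes A: "A \<in> carrier_mat n p"
  shows "centered_normal_vec p (\<sigma>\<^sup>2 \<cdot>\<^sub>m (debias_mat mhat A * sample_cov A * transpose_mat (debias_mat mhat A)))
     (distr noise_dist (vec_borel p) (Wf A))"
  unfolding centered_normal_vec_def
proof (intro conjI ballI)
  have A': "A \<in> space (mat_borel n p)" using A by (simp add: space_mat_borel)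
  have m: "Wf A \<in> vec_borel n \<rightarrow>\<^sub>M vec_borel p" using measurable_Pair2[OF Wf_meas A'] by simp
  interpret E: prob_space noise_dist by (rule prob_space_distr[OF \<epsilon>_meas])
  show "prob_space (distr noise_dist (vec_borel p) (Wf A))" using m by (intro E.prob_space_distr) simp
  show "sets (distr noise_dist (vec_borel p) (Wf A)) = sets (vec_borel p)" by simp
  fix v :: "real Matrix.vec" assume v: "v \<in> carrier_vec p"
  define D where "D = debias_mat mhat A"
  have D: "D \<in> carrier_mat p p" unfolding D_def by (rule debias_mat_carrier[OF A])
  define u where "u = transpose_mat D *\<^sub>v v"
  have u: "u \<in> carrier_vec p" using D v by (auto simp: u_def)
  define y where "y = A *\<^sub>v u"
  have y: "y \<in> carrier_vec n" using A u by (auto simp: y_def)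
  have lin: "v \<bullet> Wf A e = (\<Sum>k<n. y $ k / sqrt (real n) * e $ k)" if e: "e \<in> carrier_vec n" for e
  proof -
    have Ae: "transpose_mat A *\<^sub>v e \<in> carrier_vec p" using A e by auto
    have "v \<bullet> Wf A e = (v \<bullet> (D *\<^sub>v (transpose_mat A *\<^sub>v e))) / sqrt (real n)"
      unfolding Wf_def D_def[symmetric] using v D Ae by simp
    also have "v \<bullet> (D *\<^sub>v (transpose_mat A *\<^sub>v e)) = u \<bullet> (transpose_mat A *\<^sub>v e)"
      using transpose_vec_mult_scalar[OF D Ae v] by (simp add: u_def)
    also have "\<dots> = (transpose_mat A *\<^sub>v e) \<bullet> u" by (rule comm_scalar_prod[OF u Ae])
    also have "\<dots> = e \<bullet> y" unfolding y_def by (rule transpose_vec_mult_scalar[OF A u e])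
    also have "\<dots> = (\<Sum>k<n. e $ k * y $ k)" using y by (simp add: scalar_prod_def atLeast0LessThan)
    finally show ?thesis by (simp add: sum_divide_distrib mult.commute)
  qed
  have var: "v \<bullet> ((\<sigma>\<^sup>2 \<cdot>\<^sub>m (D * sample_cov A * transpose_mat D)) *\<^sub>v v) = \<sigma>\<^sup>2 * (\<Sum>k<n. (y $ k / sqrt (real n))\<^sup>2)"
  proof -
    have SC: "sample_cov A \<in> carrier_mat p p" using A by (simp add: sample_cov_def)
    have DS: "D * sample_cov A \<in> carrier_mat p p" using D SC by simp
    have SCu: "sample_cov A *\<^sub>v u = (1 / real n) \<cdot>\<^sub>v (transpose_mat A *\<^sub>v y)"
    proof -
      have AA: "transpose_mat A * A \<in> carrier_mat p p" using A by simp
      have "sample_cov A *\<^sub>v u = (1 / real n) \<cdot>\<^sub>v ((transpose_mat A * A) *\<^sub>v u)"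
        unfolding sample_cov_def using A AA u by (subst smult_mat_mult_vec[of _ p p]) auto
      also have "(transpose_mat A * A) *\<^sub>v u = transpose_mat A *\<^sub>v y"
        unfolding y_def by (rule assoc_mult_mat_vec[of _ p n _ p]) (use A u in auto)
      finally show ?thesis .
    qed
    have Ay: "transpose_mat A *\<^sub>v y \<in> carrier_vec p" using A y by auto
    have "(D * sample_cov A * transpose_mat D) *\<^sub>v v = (D * sample_cov A) *\<^sub>v u"
      unfolding u_def by (rule assoc_mult_mat_vec[of _ p p _ p]) (use D DS v in auto)
    also have "\<dots> = D *\<^sub>v (sample_cov A *\<^sub>v u)" by (rule assoc_mult_mat_vec[OF D SC u])
    finally have "(D * sample_cov A * transpose_mat D) *\<^sub>v v = D *\<^sub>v (sample_cov A *\<^sub>v u)" .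
    then have "v \<bullet> ((\<sigma>\<^sup>2 \<cdot>\<^sub>m (D * sample_cov A * transpose_mat D)) *\<^sub>v v) = \<sigma>\<^sup>2 * (v \<bullet> (D *\<^sub>v (sample_cov A *\<^sub>v u)))"
      using D SC v by (subst smult_mat_mult_vec[of _ p p]) auto
    also have "v \<bullet> (D *\<^sub>v (sample_cov A *\<^sub>v u)) = u \<bullet> (sample_cov A *\<^sub>v u)"
      unfolding u_def using SC u by (intro transpose_vec_mult_scalar[symmetric, OF D _ v]) (auto simp: u_def)
    also have "\<dots> = (u \<bullet> (transpose_mat A *\<^sub>v y)) / real n" unfolding SCu using u Ay by simp
    also have "u \<bullet> (transpose_mat A *\<^sub>v y) = (transpose_mat A *\<^sub>v y) \<bullet> u" by (rule comm_scalar_prod[OF u Ay])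
    also have "\<dots> = y \<bullet> y" using transpose_vec_mult_scalar[OF A u y] by (simp add: y_def)
    also have "\<dots> = (\<Sum>k<n. (y $ k)\<^sup>2)" by (rule scalar_prod_self(1)[OF y])
    finally show ?thesis by (simp add: power_divide flip: sum_divide_distrib)
  qed
  have vm: "(\<lambda>x. v \<bullet> x) \<in> borel_measurable (vec_borel p)"
  proof -
    have "(\<lambda>x. \<Sum>i<p. v $ i * x $ i) \<in> borel_measurable (vec_borel p)"
      by (intro borel_measurable_sum borel_measurable_times borel_measurable_const measurable_vec_nth) auto
    then show ?thesis
      by (rule measurable_cong[THEN iffD1, rotated]) (auto simp: space_vec_borel scalar_prod_def atLeast0LessThan)
  qed
  have "distr (distr noise_dist (vec_borel p) (Wf A)) borel (\<lambda>x. v \<bullet> x) = distr M borel (\<lambda>\<omega>. v \<bullet> Wf A (\<epsilon> \<omega>))"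
    using m vm \<epsilon>_meas by (simp add: distr_distr measurable_compose[OF m vm] comp_def)
  also have "\<dots> = distr M borel (\<lambda>\<omega>. \<Sum>k<n. y $ k / sqrt (real n) * \<epsilon> \<omega> $ k)"
    by (rule distr_cong) (auto simp: lin[OF \<epsilon>_carrier])
  also have "\<dots> = centered_normal (\<sigma>\<^sup>2 * (\<Sum>k<n. (y $ k / sqrt (real n))\<^sup>2))" by (rule noise_law)
  finally show "distr (distr noise_dist (vec_borel p) (Wf A)) borel (\<lambda>x. v \<bullet> x) =
     centered_normal (v \<bullet> ((\<sigma>\<^sup>2 \<cdot>\<^sub>m (debias_mat mhat A * sample_cov A * transpose_mat (debias_mat mhat A))) *\<^sub>v v))"
    by (simp only: var D_def[symmetric])
qed

text \<open>The kernel is the law of \<open>Wf A\<close> under the noise, with the design frozen at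
  \<open>A\<close>.\<close>

lemma W_cond_normal:
  "cond_centered_normal M (mat_borel n p) X p W
     (\<lambda>A. \<sigma>\<^sup>2 \<cdot>\<^sub>m (debias_mat mhat A * sample_cov A * transpose_mat (debias_mat mhat A)))"
  unfolding cond_centered_normal_def
proof (intro conjI X_meas W_meas bexI[of _ "\<lambda>A. distr noise_dist (vec_borel p) (Wf A)"] ballI)
  fix A assume "A \<in> space (mat_borel n p)"
  then show "centered_normal_vec p (\<sigma>\<^sup>2 \<cdot>\<^sub>m (debias_mat mhat A * sample_cov A * transpose_mat (debias_mat mhat A)))
       (distr noise_dist (vec_borel p) (Wf A))"
    by (intro Wf_law) (simp add: space_mat_borel)
next
  fix A B assume "A \<in> sets (mat_borel n p)" "B \<in> sets (vec_borel p)"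
  from indep_kernel_formula[OF X_meas \<epsilon>_meas indep_design_noise Wf_meas this]
  show "emeasure M {\<omega> \<in> space M. X \<omega> \<in> A \<and> W \<omega> \<in> B} =
      (\<integral>\<^sup>+x\<in>A. emeasure (distr noise_dist (vec_borel p) (Wf x)) B \<partial>distr M (mat_borel n p) X)"
    by (simp add: W_eq_Wf)
next
  have "noise_dist \<in> space (prob_algebra (vec_borel n))"
    using prob_space_distr[OF \<epsilon>_meas] by (simp add: space_prob_algebra)
  then have "(\<lambda>_. noise_dist) \<in> mat_borel n p \<rightarrow>\<^sub>M prob_algebra (vec_borel n)" by (rule measurable_const)
  from measurable_distr_prob_space2[OF this Wf_meas]
  show "(\<lambda>A. distr noise_dist (vec_borel p) (Wf A)) \<in> mat_borel n p \<rightarrow>\<^sub>M prob_algebra (vec_borel p)" .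
qed

lemma meas_mhat[measurable]: "i < p \<Longrightarrow> l < p \<Longrightarrow> (\<lambda>\<omega>. mhat (X \<omega>) i $ l) \<in> borel_measurable M"
  by (rule measurable_compose[OF X_meas mhat_nth_meas])

lemma meas_W[measurable]: "i < p \<Longrightarrow> (\<lambda>\<omega>. W \<omega> $ i) \<in> borel_measurable M"
  by (rule measurable_compose[OF W_meas measurable_vec_nth])

text \<open>Read off from the closed form of the remainder, which involves only measurable
  entries.\<close>

lemma meas_remainder: "i < p \<Longrightarrow> (\<lambda>\<omega>. dev \<omega> $ i - W \<omega> $ i) \<in> borel_measurable M"
proof -
  assume i: "i < p"
  have [measurable]: "(\<lambda>\<omega>. \<beta>hat \<omega> $ j) \<in> borel_measurable M" if "j < p" for j
    using that by (rule measurable_compose[OF \<beta>hat_meas measurable_vec_nth])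
  have [measurable]: "(\<lambda>\<omega>. H \<omega> j l) \<in> borel_measurable M" if "j < p" "l < p" for j l
    unfolding H_def using that by measurable
  have "(\<lambda>\<omega>. - sqrt (real n) * (\<Sum>j<p. ((\<Sum>l<p. H \<omega> j l * mhat (X \<omega>) i $ l) - unit_vec p i $ j) * (\<beta>hat \<omega> $ j - \<beta> $ j)))
     \<in> borel_measurable M" using i by measurable
  then show ?thesis
  proof (rule measurable_cong[THEN iffD2, rotated])
    fix \<omega> assume \<omega>: "\<omega> \<in> space M"
    have "(sample_cov (X \<omega>) *\<^sub>v mhat (X \<omega>) i - unit_vec p i) $ j = (\<Sum>l<p. H \<omega> j l * mhat (X \<omega>) i $ l) - unit_vec p i $ j"
      if j: "j < p" for j
      using j sample_cov_carrier[OF \<omega>] mhat_carrier[OF \<omega> i]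
      by (auto simp: scalar_prod_def atLeast0LessThan H_eq_sample_cov[OF \<omega>] intro!: sum.cong)
    then show "dev \<omega> $ i - W \<omega> $ i = - sqrt (real n) * (\<Sum>j<p. ((\<Sum>l<p. H \<omega> j l * mhat (X \<omega>) i $ l) - unit_vec p i $ j) * (\<beta>hat \<omega> $ j - \<beta> $ j))"
      unfolding remainder_eq[OF \<omega> i] err_def by simp
  qed
qed

definition vhat :: "nat \<Rightarrow> 'a \<Rightarrow> real" where
  "vhat i \<omega> = mhat (X \<omega>) i \<bullet> (sample_cov (X \<omega>) *\<^sub>v mhat (X \<omega>) i)"

lemma vhat_eq:
  assumes \<omega>: "\<omega> \<in> space M" and i: "i < p"
  shows "vhat i \<omega> = (\<Sum>k<n. (\<Sum>l<p. mhat (X \<omega>) i $ l * X \<omega> $$ (k, l))\<^sup>2) / real n"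
proof -
  have "vhat i \<omega> = (\<Sum>l<p. \<Sum>j<p. mhat (X \<omega>) i $ l * H \<omega> l j * mhat (X \<omega>) i $ j)"
    unfolding vhat_def scalar_prod_mult_mat_vec[OF sample_cov_carrier[OF \<omega>] mhat_carrier[OF \<omega> i] mhat_carrier[OF \<omega> i]]
    by (intro sum.cong refl) (simp add: H_eq_sample_cov[OF \<omega>])
  then show ?thesis unfolding H_quadratic using \<omega> by (simp add: row_nth power2_eq_square)
qed

text \<open>Given the design, the ratio combines the noise with coefficients of unit squared sum, so
  its conditional law is the same for every design and factors out over \<open>A\<close>. Where
  \<open>vhat\<close> vanishes the quotient is zero by convention, so such designs are
  excluded.\<close>

lemma studentized_law:
  assumes i: "i < p"
  defines "A \<equiv> {\<omega> \<in> space M. 0 < vhat i \<omega>}"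
  shows "A \<in> events" "(\<lambda>\<omega>. W \<omega> $ i / sqrt (vhat i \<omega>)) \<in> borel_measurable M" "vhat i \<in> borel_measurable M"
    "B \<in> sets borel \<Longrightarrow> prob {\<omega> \<in> A. W \<omega> $ i / sqrt (vhat i \<omega>) \<in> B} = prob A * measure (centered_normal (\<sigma>\<^sup>2)) B"
proof -
  define y where "y k x = (\<Sum>l<p. mhat x i $ l * x $$ (k, l))" for k and x :: "real mat"
  define v where "v x = (\<Sum>k<n. (y k x)\<^sup>2) / real n" for x
  define a where "a k x = y k x / (sqrt (real n) * sqrt (v x))" for k x
  have ym[measurable]: "y k \<in> borel_measurable (mat_borel n p)" if "k < n" for k
    unfolding y_def by (intro borel_measurable_sum borel_measurable_times mhat_nth_meas measurable_mat_nth) (use that i in auto)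
  have vm[measurable]: "v \<in> borel_measurable (mat_borel n p)" unfolding v_def by measurable
  have am: "a k \<in> borel_measurable (mat_borel n p)" if "k < n" for k unfolding a_def using that by measurable
  have vX: "vhat i \<omega> = v (X \<omega>)" if "\<omega> \<in> space M" for \<omega> using vhat_eq[OF that i] by (simp add: v_def y_def)
  have "(\<lambda>\<omega>. v (X \<omega>)) \<in> borel_measurable M" by (rule measurable_compose[OF X_meas vm])
  then show vhm[measurable]: "vhat i \<in> borel_measurable M" by (rule measurable_cong[THEN iffD2, rotated]) (rule vX)
  show A: "A \<in> events" unfolding A_def by measurable
  show Zm: "(\<lambda>\<omega>. W \<omega> $ i / sqrt (vhat i \<omega>)) \<in> borel_measurable M" using i by measurable
  define A' where "A' = {x \<in> space (mat_borel n p). 0 < v x}"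
  have A': "A' \<in> sets (mat_borel n p)" unfolding A'_def by measurable
  have AX: "\<omega> \<in> A \<longleftrightarrow> \<omega> \<in> space M \<and> X \<omega> \<in> A'" for \<omega>
    using measurable_space[OF X_meas] by (auto simp: A_def A'_def vX)
  have Wy: "W \<omega> $ i / sqrt (vhat i \<omega>) = (\<Sum>k<n. a k (X \<omega>) * \<epsilon> \<omega> $ k)" if \<omega>: "\<omega> \<in> space M" for \<omega>
  proof -
    have "(\<Sum>l<p. mhat (X \<omega>) i $ l * z \<omega> l) = (\<Sum>l<p. \<Sum>k<n. mhat (X \<omega>) i $ l * X \<omega> $$ (k, l) * \<epsilon> \<omega> $ k)"
      using \<omega> by (simp add: z_def sum_distrib_left row_nth mult.assoc)
    also have "\<dots> = (\<Sum>k<n. \<Sum>l<p. mhat (X \<omega>) i $ l * X \<omega> $$ (k, l) * \<epsilon> \<omega> $ k)" by (rule sum.swap)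
    also have "\<dots> = (\<Sum>k<n. y k (X \<omega>) * \<epsilon> \<omega> $ k)" by (simp add: y_def sum_distrib_right)
    finally show ?thesis
      unfolding W_nth[OF \<omega> i] vX[OF \<omega>] a_def by (simp add: sum_divide_distrib)
  qed
  assume B: "B \<in> sets borel"
  have unit: "(\<Sum>k<n. (a k x)\<^sup>2) = 1" if "x \<in> A'" for x
  proof -
    have v: "0 < v x" using that by (simp add: A'_def)
    have "(\<Sum>k<n. (a k x)\<^sup>2) = (\<Sum>k<n. (y k x)\<^sup>2) / (real n * v x)"
      using v by (simp add: a_def power_divide power_mult_distrib sum_divide_distrib)
    also have "\<dots> = 1" using v n_pos by (cases "(\<Sum>k<n. (y k x)\<^sup>2) = 0") (auto simp: v_def)
    finally show ?thesis .
  qed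
  have "emeasure M {\<omega> \<in> A. W \<omega> $ i / sqrt (vhat i \<omega>) \<in> B} =
      emeasure M {\<omega> \<in> space M. X \<omega> \<in> A' \<and> (\<Sum>k<n. a k (X \<omega>) * \<epsilon> \<omega> $ k) \<in> B}"
    by (intro arg_cong[of _ _ "emeasure M"]) (auto simp: AX Wy)
  also have "\<dots> = (\<integral>\<^sup>+x\<in>A'. emeasure (centered_normal (\<sigma>\<^sup>2 * (\<Sum>k<n. (a k x)\<^sup>2))) B \<partial>distr M (mat_borel n p) X)"
    by (rule normal_given_design[OF am A' B])
  also have "\<dots> = (\<integral>\<^sup>+x. emeasure (centered_normal (\<sigma>\<^sup>2)) B * indicator A' x \<partial>distr M (mat_borel n p) X)"
    by (intro nn_integral_cong) (auto simp: unit indicator_def)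
  also have "\<dots> = emeasure (centered_normal (\<sigma>\<^sup>2)) B * emeasure M (X -` A' \<inter> space M)"
    using A' by (simp add: nn_integral_cmult_indicator emeasure_distr[OF X_meas A'])
  also have "X -` A' \<inter> space M = A" using AX by auto
  finally have *: "emeasure M {\<omega> \<in> A. W \<omega> $ i / sqrt (vhat i \<omega>) \<in> B} = emeasure (centered_normal (\<sigma>\<^sup>2)) B * emeasure M A" .
  interpret N: real_distribution "centered_normal (\<sigma>\<^sup>2)" by (rule real_distribution_centered_normal) simp
  from * show "prob {\<omega> \<in> A. W \<omega> $ i / sqrt (vhat i \<omega>) \<in> B} = prob A * measure (centered_normal (\<sigma>\<^sup>2)) B"
    by (simp add: emeasure_eq_measure N.emeasure_eq_measure mult.commute flip: ennreal_mult)
qed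


subsection \<open>Growing complexity\<close>

text \<open>The cone constant \<open>8\<close> is the one of \<open>lasso_cone\<close>. The factor
  \<open>5\<close> adds four from infeasible programs and one from the noise.\<close>

lemma good_event_growing:
  assumes C: "192 \<le> c0 * (C * cmin)\<^sup>2" "12 \<le> C\<^sup>2 / (256 * Cmax)" and n: "C\<^sup>2 * cmin\<^sup>2 * cplx \<le> real n"
  obtains G where "G \<in> events" "G \<subseteq> RE_event 8" "G \<subseteq> noise_event 1"
    "\<forall>\<omega>\<in>G. \<forall>i<p. debias_feasible P \<alpha> \<gamma> (X \<omega>) i (mhat (X \<omega>) i)"
    "1 - (4 * exp (16 * cplxe - c0 * real n * (rho 8)\<^sup>2 / 64) + 5 * exp (- (cplx / real s))) \<le> prob G"
proof -
  obtain F where F: "F \<in> events" "space M - F \<subseteq> feasible_event" "prob F \<le> 4 * exp (- (cplx / real s))"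
    using feasible_prob[OF C(1) n] .
  define G where "G = (RE_event 8 \<inter> noise_event 1) - F"
  have G: "G \<in> events" unfolding G_def using F by auto
  have GM: "G \<subseteq> space M" using G sets.sets_into_space by blast
  have "space M - G = (space M - RE_event 8) \<union> ((RE_event 8 - noise_event 1) \<union> F)"
    using F(1) sets.sets_into_space by (auto simp: G_def RE_event_def)
  then have "prob (space M - G) \<le> prob (space M - RE_event 8) + prob ((RE_event 8 - noise_event 1) \<union> F)"
    using F(1) by (simp add: measure_Un_le)
  also have "prob ((RE_event 8 - noise_event 1) \<union> F) \<le> prob (RE_event 8 - noise_event 1) + prob F"
    using F(1) by (intro measure_Un_le) auto
  also have "prob (space M - RE_event 8) \<le> 4 * exp (16 * cplxe - c0 * real n * (rho 8)\<^sup>2 / 64)" by (rule RE_prob) simp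
  also have "prob (RE_event 8 - noise_event 1) \<le> exp (- (1\<^sup>2 * (cplx / real sg)))" by (rule noise_prob[OF C(2)]) auto
  also have "\<dots> \<le> exp (- (cplx / real s))" using cplx_div_le(1) by simp
  also note F(3)
  finally have "1 - (4 * exp (16 * cplxe - c0 * real n * (rho 8)\<^sup>2 / 64) + 5 * exp (- (cplx / real s))) \<le> prob G"
    using prob_compl[OF G] by simp
  moreover have "debias_feasible P \<alpha> \<gamma> (X \<omega>) i (mhat (X \<omega>) i)" if "\<omega> \<in> G" "i < p" for \<omega> i
    using that GM F(2) by (auto simp: G_def feasible_event_def)
  ultimately show thesis using G by (intro that[of G]) (auto simp: G_def)
qed

subsection \<open>Bounded complexity\<close>

lemma s_le: "s \<le> sg * b"
proof -
  define Q where "Q = {(\<Sum>g\<in>\<Omega>. card g) |\<Omega>. \<Omega> \<subseteq> P \<and> card \<Omega> = sg}"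
  have "Q = (\<lambda>\<Omega>. \<Sum>g\<in>\<Omega>. card g) ` {\<Omega>. \<Omega> \<subseteq> P \<and> card \<Omega> = sg}" by (auto simp: Q_def)
  moreover have "finite {\<Omega>. \<Omega> \<subseteq> P \<and> card \<Omega> = sg}" using finite_P by simp
  ultimately have fin: "finite Q" by simp
  obtain \<Omega> where "\<Omega> \<subseteq> P" "card \<Omega> = sg" using obtain_subset_with_card_n[OF sg_le_d] by metis
  then have ne: "Q \<noteq> {}" by (auto simp: Q_def)
  have "x \<le> sg * b" if "x \<in> Q" for x
  proof -
    obtain \<Omega> where \<Omega>: "x = (\<Sum>g\<in>\<Omega>. card g)" "\<Omega> \<subseteq> P" "card \<Omega> = sg" using \<open>x \<in> Q\<close> by (auto simp: Q_def)
    have "x \<le> (\<Sum>g\<in>\<Omega>. b)" unfolding \<Omega>(1) using \<Omega>(2) card_group_le by (intro sum_mono) auto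
    then show ?thesis using \<Omega>(3) by simp
  qed
  then have "Max Q \<le> sg * b" using fin ne by simp
  then show ?thesis using levels by (simp add: sparsity_levels_def Q_def)
qed

text \<open>A bound on \<open>cplx / s\<close> bounds \<open>lnA\<close> and thus
  \<open>sg * b\<close>. Since \<open>s \<le> sg * b\<close>, it also bounds \<open>sg * lnd\<close>
  by \<open>K * sg * b\<close>, hence \<open>lnd\<close>; finally
  \<open>p \<le> d * b = sg * b * exp lnd\<close>.\<close>

lemma p_bounded:
  assumes K: "cplx / real s < K"
  shows "real p \<le> exp (K + K * exp K)"
proof -
  have cK: "cplx < K * real s" using K s_pos by (simp add: field_simps)
  have "real s * lnA \<le> cplx" using lnd_ge0 by (simp add: cplx_eq)
  then have "real s * lnA < real s * K" using cK by (simp add: mult.commute)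
  then have "lnA < K" using s_pos by simp
  then have "exp (ln (real sg) + ln (real b)) \<le> exp K" using lnA_ge(4) by simp
  then have sb: "real sg * real b \<le> exp K" using sg_pos b_pos by (simp add: exp_add)
  have K0: "0 < K" using \<open>lnA < K\<close> lnA_ge(1) by linarith
  have "real b \<le> real sg * real b" using sg_pos mult_right_mono[of 1 "real sg" "real b"] by simp
  then have bK: "real b \<le> exp K" using sb by simp
  have "real sg * lnd \<le> cplx" using lnA_ge(1) s_pos by (simp add: cplx_eq)
  also have "\<dots> \<le> K * real s" using cK by simp
  also have "\<dots> \<le> K * (real sg * real b)"
    using s_le K0 by (intro mult_left_mono) (metis of_nat_le_iff of_nat_mult, simp)
  finally have "real sg * lnd \<le> real sg * (K * real b)" by (simp add: mult_ac)
  then have "lnd \<le> K * real b" using sg_pos by simp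
  also have "\<dots> \<le> K * exp K" using bK K0 by (intro mult_left_mono) auto
  finally have l: "lnd \<le> K * exp K" .
  have "real d = real sg * exp lnd" using sg_pos sg_le_d by (simp add: lnd_def)
  then have "real p \<le> (real sg * real b) * exp lnd"
    using p_le by (metis (no_types, lifting) mult.assoc mult.commute of_nat_le_iff of_nat_mult)
  also have "\<dots> \<le> exp K * exp (K * exp K)" using sb l by (intro mult_mono) auto
  finally show ?thesis by (simp add: exp_add)
qed

text \<open>Cauchy-Schwarz over all \<open>p\<close> coordinates and over the
  \<open>d \<le> p\<close> groups.\<close>

lemma cone_if_p_bounded:
  assumes L: "real p \<le> L\<^sup>2" "0 \<le> L"
  shows "cone L \<delta>"
proof -
  have dp: "d \<le> p"
  proof -
    have "d = (\<Sum>g\<in>P. 1)" by simp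
    also have "\<dots> \<le> (\<Sum>g\<in>P. card g)"
    proof (rule sum_mono)
      fix g assume g: "g \<in> P"
      then have "g \<noteq> {}" using part by (auto simp: partition_on_def)
      then show "1 \<le> card g" using finite_group[OF g] by (simp add: Suc_le_eq card_gt_0_iff)
    qed
    also have "\<dots> = p" using card_Union_disjoint[of P] part finite_group
      by (simp add: partition_on_def disjoint_def pairwise_def disjnt_def)
    finally show ?thesis .
  qed
  define D where "D = L2_set \<delta> {..<p}"
  have D: "0 \<le> D" by (simp add: D_def)
  have sqL: "sqrt (real p) \<le> L" using L by (simp add: real_le_lsqrt)
  have "(\<Sum>i<p. \<bar>\<delta> i\<bar>) \<le> sqrt (real p) * D" unfolding D_def by (intro L1_le_sqrt_card_L2) auto
  also have "\<dots> \<le> L * sqrt (real s) * D"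
    using D L sqL s_pos mult_mono[of "sqrt (real p)" L 1 "sqrt (real s)"] by (intro mult_right_mono) auto
  finally have 1: "(\<Sum>i<p. \<bar>\<delta> i\<bar>) \<le> L * sqrt (real s) * D" .
  have "(\<Sum>g\<in>P. \<bar>L2_set \<delta> g\<bar>) \<le> sqrt (real p) * L2_set (L2_set \<delta>) P"
    using finite_P dp by (intro L1_le_sqrt_card_L2) auto
  also have "L2_set (L2_set \<delta>) P = D" using sum_squares_groups[OF _ part] by (simp add: D_def L2_set_def)
  also have "sqrt (real p) * D \<le> L * sqrt (real sg) * D"
    using D L sqL sg_pos mult_mono[of "sqrt (real p)" L 1 "sqrt (real sg)"] by (intro mult_right_mono) auto
  finally show ?thesis using 1 by (simp add: cone_def D_def)
qed

lemma feasible_if_invertible: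
  assumes \<omega>: "\<omega> \<in> RE_event L" and L: "real p \<le> L\<^sup>2" "0 \<le> L" and i: "i < p"
  shows "debias_feasible P \<alpha> \<gamma> (X \<omega>) i (mhat (X \<omega>) i)"
proof -
  have \<omega>': "\<omega> \<in> space M" using \<omega> by (simp add: RE_event_def)
  note SC = sample_cov_carrier[OF \<omega>']
  have dimX: "dim_col (X \<omega>) = p" using X_carrier[OF \<omega>'] by simp
  have "det (sample_cov (X \<omega>)) \<noteq> 0"
  proof
    assume "det (sample_cov (X \<omega>)) = 0"
    then obtain v where v: "v \<in> carrier_vec p" "v \<noteq> 0\<^sub>v p" "sample_cov (X \<omega>) *\<^sub>v v = 0\<^sub>v p"
      using det_0_iff_vec_prod_zero_field[OF SC] by auto
    have "cmin / 2 * (L2_set (\<lambda>j. v $ j) {..<p})\<^sup>2 \<le> (\<Sum>i<p. \<Sum>j<p. v $ i * H \<omega> i j * v $ j)"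
      by (rule H_cone_bounds(1)[OF \<omega> L(2) cone_if_p_bounded[OF L]])
    also have "\<dots> = v \<bullet> (sample_cov (X \<omega>) *\<^sub>v v)"
      unfolding scalar_prod_mult_mat_vec[OF SC v(1) v(1)] by (intro sum.cong refl) (simp add: H_eq_sample_cov[OF \<omega>'])
    also have "\<dots> = 0" using v by simp
    finally have "v \<bullet> v \<le> 0"
      using const_pos scalar_prod_self(1)[OF v(1)] by (simp add: L2_set_def sum_nonneg mult_le_0_iff)
    then show False using scalar_prod_self(2,3)[OF v(1)] v(2) by simp
  qed
  from det_non_zero_imp_unit[OF SC this, of "()"]
  obtain B where B: "B \<in> carrier_mat p p" "sample_cov (X \<omega>) * B = 1\<^sub>m p" by (auto simp: Units_def ring_mat_simps)
  define m where "m = B *\<^sub>v unit_vec p i"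
  have m: "m \<in> carrier_vec p" using B by (auto simp: m_def)
  have "sample_cov (X \<omega>) *\<^sub>v m = (sample_cov (X \<omega>) * B) *\<^sub>v unit_vec p i"
    unfolding m_def by (rule assoc_mult_mat_vec[symmetric, of _ p p _ p]) (use SC B in auto)
  then have eq: "sample_cov (X \<omega>) *\<^sub>v m = unit_vec p i" by (simp add: B(2))
  have "L2_set (\<lambda>k. map_vec (soft_threshold \<alpha>) (sample_cov (X \<omega>) *\<^sub>v m - unit_vec p i) $ k) g \<le> \<gamma>" if g: "g \<in> P" for g
  proof -
    have "L2_set (\<lambda>k. map_vec (soft_threshold \<alpha>) (sample_cov (X \<omega>) *\<^sub>v m - unit_vec p i) $ k) g = L2_set (\<lambda>_. 0) g"
      using group_subset[OF g] by (intro L2_set_cong) (auto simp: eq soft_threshold_def)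
    then show ?thesis using \<alpha>_pos r_ge1 by (simp add: \<gamma>_eq L2_set_def)
  qed
  then have "norm_inf_2 P (map_vec (soft_threshold \<alpha>) (sample_cov (X \<omega>) *\<^sub>v m - unit_vec p i)) \<le> \<gamma>"
    unfolding norm_inf_2_def using finite_P P_nonempty by (subst Max_le_iff) auto
  then have "debias_feasible P \<alpha> \<gamma> (X \<omega>) i m" using m dimX by (simp add: debias_feasible_def)
  then show ?thesis using mhat[OF \<omega>' i] by (auto simp: is_debias_solution_def is_arg_min_def)
qed

text \<open>From \<open>cplx / sg \<ge> 1\<close> alone, the noise failure is made small through
  \<open>q\<close> instead of through a growing complexity.\<close>

lemma good_event_bounded:
  assumes C: "12 \<le> C\<^sup>2 / (256 * Cmax)" and L: "2 \<le> L" and q: "1 \<le> q"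
  obtains G where "G \<in> events" "G \<subseteq> RE_event L" "G \<subseteq> noise_event q"
    "1 - (4 * exp (16 * cplxe - c0 * real n * (rho L)\<^sup>2 / 64) + exp (- q\<^sup>2)) \<le> prob G"
proof -
  define G where "G = RE_event L \<inter> noise_event q"
  have G: "G \<in> events" unfolding G_def by simp
  have "space M - G = (space M - RE_event L) \<union> (RE_event L - noise_event q)"
    by (auto simp: G_def RE_event_def)
  then have "prob (space M - G) \<le> prob (space M - RE_event L) + prob (RE_event L - noise_event q)"
    by (simp add: measure_Un_le)
  also have "prob (space M - RE_event L) \<le> 4 * exp (16 * cplxe - c0 * real n * (rho L)\<^sup>2 / 64)" using L by (intro RE_prob) simp
  also have "prob (RE_event L - noise_event q) \<le> exp (- (q\<^sup>2 * (cplx / real sg)))" by (rule noise_prob[OF C L q])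
  also have "\<dots> \<le> exp (- q\<^sup>2)" using cplx_div_le(3) mult_left_mono[of 1 "cplx / real sg" "q\<^sup>2"] by simp
  finally have "1 - (4 * exp (16 * cplxe - c0 * real n * (rho L)\<^sup>2 / 64) + exp (- q\<^sup>2)) \<le> prob G"
    using prob_compl[OF G] by simp
  then show thesis using G by (intro that[of G]) (auto simp: G_def)
qed

subsection \<open>Decomposition and normal approximation\<close>

lemma decomposition:
  assumes C: "192 \<le> c0 * (C * cmin)\<^sup>2" "12 \<le> C\<^sup>2 / (256 * Cmax)"
    and n: "C\<^sup>2 * cmin\<^sup>2 * cplxe \<le> real n" "1088 / (c0 * (rho 8)\<^sup>2) * cplxe \<le> real n"
  shows "(\<lambda>\<omega>. dev \<omega> - W \<omega>) \<in> M \<rightarrow>\<^sub>M vec_borel p"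
    "1 - 9 * exp (- 1 * (cplx / real s)) \<le>
      prob {\<omega> \<in> space M. norm_inf (dev \<omega> - W \<omega>) \<le> 768 * C\<^sup>2 / cmin * cplxe / sqrt (real n) * \<sigma>}"
proof -
  have nth: "(dev \<omega> - W \<omega>) $ i = dev \<omega> $ i - W \<omega> $ i" if "\<omega> \<in> space M" "i < p" for \<omega> i
    using W_carrier[OF that(1)] that(2) by simp
  show meas: "(\<lambda>\<omega>. dev \<omega> - W \<omega>) \<in> M \<rightarrow>\<^sub>M vec_borel p"
  proof (rule measurable_vec_borelI)
    fix i assume i: "i < p"
    show "(\<lambda>\<omega>. (dev \<omega> - W \<omega>) $ i) \<in> borel_measurable M"
      by (rule measurable_cong[THEN iffD2, OF _ meas_remainder[OF i]]) (simp add: nth i)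
  qed (use dev_carrier W_carrier in auto)
  define T where "T = 768 * C\<^sup>2 / cmin * cplxe / sqrt (real n) * \<sigma>"
  have "C\<^sup>2 * cmin\<^sup>2 * cplx \<le> C\<^sup>2 * cmin\<^sup>2 * cplxe" using cplx_le_cplxe by (intro mult_left_mono) auto
  then have n1: "C\<^sup>2 * cmin\<^sup>2 * cplx \<le> real n" using n(1) by linarith
  obtain G where G: "G \<in> events" "G \<subseteq> RE_event 8" "G \<subseteq> noise_event 1"
    "\<forall>\<omega>\<in>G. \<forall>i<p. debias_feasible P \<alpha> \<gamma> (X \<omega>) i (mhat (X \<omega>) i)"
    "1 - (4 * exp (16 * cplxe - c0 * real n * (rho 8)\<^sup>2 / 64) + 5 * exp (- (cplx / real s))) \<le> prob G"
    using good_event_growing[OF C n1] .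
  have ni: "norm_inf (dev \<omega> - W \<omega>) \<le> y \<longleftrightarrow> (\<forall>i<p. \<bar>dev \<omega> $ i - W \<omega> $ i\<bar> \<le> y)" if \<omega>: "\<omega> \<in> space M" for \<omega> y
  proof -
    have "dim_vec (dev \<omega> - W \<omega>) = p" using W_carrier[OF \<omega>] by simp
    then show ?thesis using p_pos nth[OF \<omega>] unfolding norm_inf_def by (subst Max_le_iff) auto
  qed
  have S: "{\<omega> \<in> space M. norm_inf (dev \<omega> - W \<omega>) \<le> T} \<in> events"
  proof -
    have [measurable]: "(\<lambda>\<omega>. dev \<omega> $ i - W \<omega> $ i) \<in> borel_measurable M" if "i < p" for i
      using that by (rule meas_remainder)
    have "{\<omega> \<in> space M. \<forall>i\<in>{..<p}. \<bar>dev \<omega> $ i - W \<omega> $ i\<bar> \<le> T} \<in> events" by measurable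
    moreover have "{\<omega> \<in> space M. norm_inf (dev \<omega> - W \<omega>) \<le> T} = {\<omega> \<in> space M. \<forall>i\<in>{..<p}. \<bar>dev \<omega> $ i - W \<omega> $ i\<bar> \<le> T}"
      by (auto simp: ni)
    ultimately show ?thesis by simp
  qed
  have "G \<subseteq> {\<omega> \<in> space M. norm_inf (dev \<omega> - W \<omega>) \<le> T}"
  proof
    fix \<omega> assume \<omega>: "\<omega> \<in> G"
    then have \<omega>': "\<omega> \<in> space M" using G(1) sets.sets_into_space by blast
    have "\<bar>dev \<omega> $ i - W \<omega> $ i\<bar> \<le> T" if i: "i < p" for i
    proof -
      \<comment> \<open>\<open>q = 1\<close> and \<open>L = 8\<close> make the constant
        \<open>(3 / 2) * 8 * 64 = 768\<close>.\<close>
      have "\<bar>dev \<omega> $ i - W \<omega> $ i\<bar> \<le> (1 / 2 + 1) * 8 * 8\<^sup>2 * C\<^sup>2 / cmin * (\<sigma> * cplx / sqrt (real n))"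
        using \<omega> G i by (intro remainder_bound err_cone) auto
      also have "\<dots> \<le> (1 / 2 + 1) * 8 * 8\<^sup>2 * C\<^sup>2 / cmin * (\<sigma> * cplxe / sqrt (real n))"
        using cplx_le_cplxe \<sigma>_pos const_pos by (intro mult_left_mono divide_right_mono) auto
      also have "\<dots> = T" by (simp add: T_def)
      finally show ?thesis .
    qed
    then show "\<omega> \<in> {\<omega> \<in> space M. norm_inf (dev \<omega> - W \<omega>) \<le> T}" using \<omega>' by (simp add: ni)
  qed
  then have "prob G \<le> prob {\<omega> \<in> space M. norm_inf (dev \<omega> - W \<omega>) \<le> T}" using S by (rule finite_measure_mono)
  moreover have "exp (16 * cplxe - c0 * real n * (rho 8)\<^sup>2 / 64) \<le> exp (- (cplx / real s))"
  proof -
    have "0 < c0 * (rho 8)\<^sup>2" using c0_pos rho_bounds(1)[of 8] by simp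
    \<comment> \<open>\<open>1088 = 17 * 64\<close>: sixteen pay for the pairs of net vectors, and
      one leaves \<open>exp (- cplxe)\<close>, which is at most
      \<open>exp (- (cplx / s))\<close>.\<close>
    then have "17 * cplxe \<le> c0 * real n * (rho 8)\<^sup>2 / 64" using n(2) by (simp add: field_simps)
    then have "16 * cplxe - c0 * real n * (rho 8)\<^sup>2 / 64 \<le> - (cplx / real s)" using cplx_div_le(2) by linarith
    then show ?thesis by simp
  qed
  ultimately have "1 - 9 * exp (- (cplx / real s)) \<le> prob {\<omega> \<in> space M. norm_inf (dev \<omega> - W \<omega>) \<le> T}"
    using G(5) by linarith
  then show "1 - 9 * exp (- 1 * (cplx / real s)) \<le> prob {\<omega> \<in> space M. norm_inf (dev \<omega> - W \<omega>) \<le> 768 * C\<^sup>2 / cmin * cplxe / sqrt (real n) * \<sigma>}"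
    by (simp add: T_def)
qed

definition student :: "nat \<Rightarrow> 'a \<Rightarrow> real" where
  "student i \<omega> = sqrt (real n) * (debiased (debias_mat mhat (X \<omega>)) (X \<omega>) (Y \<omega>) (\<beta>hat \<omega>) $ i - \<beta> $ i) /
     sqrt (mhat (X \<omega>) i \<bullet> (sample_cov (X \<omega>) *\<^sub>v mhat (X \<omega>) i))"

text \<open>On \<open>G\<close> the variance is at least \<open>1 / (8 * Cmax)\<close>, so
  studentizing magnifies the remainder by at most \<open>sqrt (8 * Cmax)\<close>.\<close>

lemma student_cdf_sandwich:
  assumes i: "i < p" and G: "G \<in> events" "G \<subseteq> RE_event L" and L: "2 \<le> L" and small: "\<alpha> + \<gamma> \<le> 1 / 2"
    and feas: "\<And>\<omega>. \<omega> \<in> G \<Longrightarrow> debias_feasible P \<alpha> \<gamma> (X \<omega>) i (mhat (X \<omega>) i)"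
    and rem: "\<And>\<omega>. \<omega> \<in> G \<Longrightarrow> \<bar>dev \<omega> $ i - W \<omega> $ i\<bar> * sqrt (8 * Cmax) \<le> \<zeta>" and pG: "1 - \<eta> \<le> prob G"
  shows "cdf (distr M borel (student i)) x \<le> cdf (centered_normal (\<sigma>\<^sup>2)) (x + \<zeta>) + \<eta>"
    "cdf (centered_normal (\<sigma>\<^sup>2)) (x - \<zeta>) - 2 * \<eta> \<le> cdf (distr M borel (student i)) x"
proof -
  note law = studentized_law[OF i]
  have GM: "G \<subseteq> space M" using G sets.sets_into_space by blast
  have st: "student i \<omega> = dev \<omega> $ i / sqrt (vhat i \<omega>)" if \<omega>: "\<omega> \<in> space M" for \<omega>
    using \<beta>_carrier i by (simp add: student_def dev_def vhat_def)
  have v: "1 / (8 * Cmax) \<le> vhat i \<omega>" if "\<omega> \<in> G" for \<omega>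
    unfolding vhat_def using that G by (intro variance_lower_bound[OF _ L i _ small] feas) auto
  have v0: "0 < vhat i \<omega>" if "\<omega> \<in> G" for \<omega>
    by (rule less_le_trans[OF _ v[OF that]]) (use const_pos in simp)
  have Tm: "student i \<in> borel_measurable M"
  proof (rule measurable_cong[THEN iffD2])
    show "student i \<omega> = ((dev \<omega> $ i - W \<omega> $ i) + W \<omega> $ i) / sqrt (vhat i \<omega>)" if "\<omega> \<in> space M" for \<omega>
      using st[OF that] by simp
    have [measurable]: "(\<lambda>\<omega>. dev \<omega> $ i - W \<omega> $ i) \<in> borel_measurable M" by (rule meas_remainder[OF i])
    show "(\<lambda>\<omega>. ((dev \<omega> $ i - W \<omega> $ i) + W \<omega> $ i) / sqrt (vhat i \<omega>)) \<in> borel_measurable M"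
      using law(3) i by measurable
  qed
  interpret N: real_distribution "centered_normal (\<sigma>\<^sup>2)" by (rule real_distribution_centered_normal) simp
  have close: "\<bar>student i \<omega> - W \<omega> $ i / sqrt (vhat i \<omega>)\<bar> \<le> \<zeta>" if \<omega>: "\<omega> \<in> G" for \<omega>
  proof -
    have "\<bar>student i \<omega> - W \<omega> $ i / sqrt (vhat i \<omega>)\<bar> = \<bar>dev \<omega> $ i - W \<omega> $ i\<bar> * (1 / sqrt (vhat i \<omega>))"
      using st[of \<omega>] \<omega> GM v0[OF \<omega>] by (auto simp flip: diff_divide_distrib)
    also have "1 / sqrt (vhat i \<omega>) \<le> sqrt (8 * Cmax)"
    proof -
      have "1 / vhat i \<omega> \<le> 8 * Cmax" using v[OF \<omega>] v0[OF \<omega>] const_pos by (simp add: field_simps)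
      then have "sqrt (1 / vhat i \<omega>) \<le> sqrt (8 * Cmax)" by (rule real_sqrt_le_mono)
      then show ?thesis by (simp add: real_sqrt_divide)
    qed
    finally have "\<bar>student i \<omega> - W \<omega> $ i / sqrt (vhat i \<omega>)\<bar> \<le> \<bar>dev \<omega> $ i - W \<omega> $ i\<bar> * sqrt (8 * Cmax)"
      by (simp add: mult_left_mono)
    then show ?thesis using rem[OF \<omega>] by linarith
  qed
  note sandwich = cdf_sandwich[OF Tm law(2) law(1) G(1) _ law(4) N.prob_space_axioms N.events_eq_borel close pG]
  show "cdf (distr M borel (student i)) x \<le> cdf (centered_normal (\<sigma>\<^sup>2)) (x + \<zeta>) + \<eta>"
    "cdf (centered_normal (\<sigma>\<^sup>2)) (x - \<zeta>) - 2 * \<eta> \<le> cdf (distr M borel (student i)) x"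
    using v0 GM by (auto intro!: sandwich)
qed


text \<open>All requirements on \<open>n\<close> are collected in
  \<open>Q * cplxe \<le> sqrt n\<close>. Of the bounds on \<open>Q\<close>, the first two make the
  restricted eigenvalue failure small for the cone constants \<open>8\<close> and \<open>L\<close>,
  the third serves feasibility, the fourth gives \<open>\<alpha> + \<gamma> \<le> 1 / 2\<close>, and
  the last two shrink the remainder. \<open>K\<close> separates the two regimes.\<close>

lemma student_cdf_approx:
  assumes C: "192 \<le> c0 * (C * cmin)\<^sup>2" "12 \<le> C\<^sup>2 / (256 * Cmax)" and \<zeta>: "0 < \<zeta>"
    and K: "5 * exp (- K) \<le> \<eta> / 2" and L: "2 \<le> L" "exp (K + K * exp K) \<le> L\<^sup>2" and q: "1 \<le> q" "exp (- q\<^sup>2) \<le> \<eta> / 2"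
    and m: "4 * exp (- m) \<le> \<eta> / 2" "0 \<le> m"
    and Q: "16 + m \<le> c0 * (rho 8)\<^sup>2 / 64 * Q" "16 + m \<le> c0 * (rho L)\<^sup>2 / 64 * Q"
      "C\<^sup>2 * cmin\<^sup>2 \<le> Q" "4 * C \<le> Q" "1 \<le> Q"
      "(1 / 2 + 1) * 8 * 8\<^sup>2 * C\<^sup>2 / cmin * \<sigma> * sqrt (8 * Cmax) \<le> \<zeta> * Q"
      "(q / 2 + 1) * 8 * L\<^sup>2 * C\<^sup>2 / cmin * \<sigma> * sqrt (8 * Cmax) \<le> \<zeta> * Q"
    and n: "Q * cplxe \<le> sqrt (real n)" and i: "i < p"
  shows "cdf (distr M borel (student i)) x \<le> cdf (centered_normal (\<sigma>\<^sup>2)) (x + \<zeta>) + \<eta>"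
    "cdf (centered_normal (\<sigma>\<^sup>2)) (x - \<zeta>) - 2 * \<eta> \<le> cdf (distr M borel (student i)) x"
proof -
  define y where "y = cplxe"
  have y1: "1 \<le> y" "cplx \<le> y" using cplxe_ge1 cplx_le_cplxe by (simp_all add: y_def)
  have Qy1: "1 \<le> Q * y" using mult_mono[OF Q(5) y1(1)] Q(5) by simp
  have n2: "(Q * y)\<^sup>2 \<le> real n" using n Qy1 power_mono[of "Q * y" "sqrt (real n)" 2] by (simp add: y_def)
  have n1: "Q * y \<le> real n" using n2 Qy1 mult_left_mono[OF Qy1, of "Q * y"] by (simp add: power2_eq_square)
  have tail: "4 * exp (16 * cplxe - c0 * real n * (rho L')\<^sup>2 / 64) \<le> \<eta> / 2"
    if L': "16 + m \<le> c0 * (rho L')\<^sup>2 / 64 * Q" for L'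
  proof -
    have "(16 + m) * y \<le> c0 * (rho L')\<^sup>2 / 64 * Q * y" using L' y1 by (intro mult_right_mono) auto
    also have "\<dots> = c0 * (rho L')\<^sup>2 / 64 * (Q * y)" by simp
    also have "\<dots> \<le> c0 * (rho L')\<^sup>2 / 64 * real n" using n1 c0_pos by (intro mult_left_mono) auto
    finally have "16 * y - c0 * (rho L')\<^sup>2 / 64 * real n \<le> - (m * y)" by (simp add: distrib_right)
    also have "\<dots> \<le> - m" using mult_left_mono[OF y1(1) m(2)] by simp
    finally have "exp (16 * cplxe - c0 * real n * (rho L')\<^sup>2 / 64) \<le> exp (- m)" by (simp add: y_def mult_ac)
    then show ?thesis using m(1) by linarith
  qed
  \<comment> \<open>\<open>n * \<gamma>\<^sup>2 = C\<^sup>2 * (cplx / sg)\<close> is at most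
    \<open>C\<^sup>2 * y\<^sup>2\<close>, while \<open>n\<close> is at least
    \<open>(Q * y)\<^sup>2\<close>; so \<open>\<gamma> \<le> C / Q \<le> 1 / 4\<close>, and
    \<open>\<alpha> \<le> \<gamma>\<close>.\<close>
  have small: "\<alpha> + \<gamma> \<le> 1 / 2"
  proof -
    have "cplx / real sg \<le> y"
    proof -
      have "cplx / real sg \<le> cplx / 1" using sg_pos cplx_pos by (intro divide_left_mono) auto
      then show ?thesis using y1 by simp
    qed
    then have "C\<^sup>2 * (cplx / real sg) \<le> C\<^sup>2 * y" by (rule mult_left_mono) simp
    moreover have "real n * \<gamma>\<^sup>2 = real n * (r * \<alpha>\<^sup>2)" using r_ge1 by (simp add: \<gamma>_eq power_mult_distrib)
    ultimately have "real n * \<gamma>\<^sup>2 \<le> C\<^sup>2 * y" unfolding \<alpha>_sq by simp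
    also have "\<dots> \<le> C\<^sup>2 * (y * y)" using y1 by (intro mult_left_mono) auto
    finally have 1: "real n * \<gamma>\<^sup>2 \<le> C\<^sup>2 * (y * y)" .
    have "(Q * y)\<^sup>2 * \<gamma>\<^sup>2 \<le> real n * \<gamma>\<^sup>2" using n2 by (intro mult_right_mono) auto
    with 1 have "(y * y) * (Q\<^sup>2 * \<gamma>\<^sup>2) \<le> (y * y) * C\<^sup>2" by (simp add: power_mult_distrib power2_eq_square mult_ac)
    then have "(Q * \<gamma>)\<^sup>2 \<le> C\<^sup>2" using y1 by (simp add: power_mult_distrib)
    then have "Q * \<gamma> \<le> C" by (rule power2_le_imp_le) (use const_pos in simp)
    moreover have g0: "0 \<le> \<gamma>" using \<alpha>_pos r_ge1 by (simp add: \<gamma>_eq)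
    then have "4 * C * \<gamma> \<le> Q * \<gamma>" using Q(4) by (intro mult_right_mono) auto
    ultimately have "C * (4 * \<gamma>) \<le> C * 1" by simp
    then have "\<gamma> \<le> 1 / 4" using const_pos by simp
    moreover have "\<alpha> \<le> \<gamma>" using \<alpha>_pos r_ge1 mult_right_mono[of 1 "sqrt r" \<alpha>] by (simp add: \<gamma>_eq)
    ultimately show ?thesis by simp
  qed
  have rate: "k * (\<sigma> * cplx / sqrt (real n)) * sqrt (8 * Cmax) \<le> \<zeta>"
    if k: "0 \<le> k" "k * \<sigma> * sqrt (8 * Cmax) \<le> \<zeta> * Q" for k
  proof -
    have "Q * cplx \<le> Q * y" using y1 Q(5) by (intro mult_left_mono) auto
    then have "Q * cplx \<le> sqrt (real n)" using n by (simp add: y_def)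
    then have le: "cplx / sqrt (real n) \<le> 1 / Q" using n_pos Q(5) by (simp add: field_simps)
    have "k * (\<sigma> * cplx / sqrt (real n)) * sqrt (8 * Cmax) = (k * \<sigma> * sqrt (8 * Cmax)) * (cplx / sqrt (real n))" by simp
    also have "\<dots> \<le> (k * \<sigma> * sqrt (8 * Cmax)) * (1 / Q)"
      using le k(1) \<sigma>_pos const_pos by (intro mult_left_mono mult_nonneg_nonneg) auto
    also have "\<dots> \<le> \<zeta> * Q * (1 / Q)" using k(2) Q(5) by (intro mult_right_mono) auto
    also have "\<dots> = \<zeta>" using Q(5) by simp
    finally show ?thesis .
  qed
  show "cdf (distr M borel (student i)) x \<le> cdf (centered_normal (\<sigma>\<^sup>2)) (x + \<zeta>) + \<eta>"
    "cdf (centered_normal (\<sigma>\<^sup>2)) (x - \<zeta>) - 2 * \<eta> \<le> cdf (distr M borel (student i)) x"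
  proof (atomize (full), cases "K \<le> cplx / real s")
    case True
    have "C\<^sup>2 * cmin\<^sup>2 * cplx \<le> Q * y" using Q(3,5) y1 cplx_pos by (intro mult_mono) auto
    then have n3: "C\<^sup>2 * cmin\<^sup>2 * cplx \<le> real n" using n1 by linarith
    obtain G where G: "G \<in> events" "G \<subseteq> RE_event 8" "G \<subseteq> noise_event 1"
      "\<forall>\<omega>\<in>G. \<forall>i<p. debias_feasible P \<alpha> \<gamma> (X \<omega>) i (mhat (X \<omega>) i)"
      "1 - (4 * exp (16 * cplxe - c0 * real n * (rho 8)\<^sup>2 / 64) + 5 * exp (- (cplx / real s))) \<le> prob G"
      using good_event_growing[OF C n3] .
    have "exp (- (cplx / real s)) \<le> exp (- K)" using True by simp
    then have pG: "1 - \<eta> \<le> prob G" using G(5) tail[OF Q(1)] K by linarith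
    have "\<bar>dev \<omega> $ i - W \<omega> $ i\<bar> * sqrt (8 * Cmax) \<le> \<zeta>" if \<omega>: "\<omega> \<in> G" for \<omega>
    proof -
      have "\<bar>dev \<omega> $ i - W \<omega> $ i\<bar> \<le> (1 / 2 + 1) * 8 * 8\<^sup>2 * C\<^sup>2 / cmin * (\<sigma> * cplx / sqrt (real n))"
        using \<omega> G i by (intro remainder_bound err_cone) auto
      then have "\<bar>dev \<omega> $ i - W \<omega> $ i\<bar> * sqrt (8 * Cmax) \<le>
          (1 / 2 + 1) * 8 * 8\<^sup>2 * C\<^sup>2 / cmin * (\<sigma> * cplx / sqrt (real n)) * sqrt (8 * Cmax)"
        using const_pos by (intro mult_right_mono) auto
      also have "\<dots> \<le> \<zeta>" using const_pos by (intro rate Q(6)) auto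
      finally show ?thesis .
    qed
    from student_cdf_sandwich[OF i G(1,2) _ small _ this pG] G(4) i
    show "cdf (distr M borel (student i)) x \<le> cdf (centered_normal (\<sigma>\<^sup>2)) (x + \<zeta>) + \<eta> \<and>
       cdf (centered_normal (\<sigma>\<^sup>2)) (x - \<zeta>) - 2 * \<eta> \<le> cdf (distr M borel (student i)) x" by simp
  next
    case False
    then have pL: "real p \<le> L\<^sup>2" using p_bounded[of K] L(2) by simp
    have L0: "0 \<le> L" using L(1) by simp
    obtain G where G: "G \<in> events" "G \<subseteq> RE_event L" "G \<subseteq> noise_event q"
      "1 - (4 * exp (16 * cplxe - c0 * real n * (rho L)\<^sup>2 / 64) + exp (- q\<^sup>2)) \<le> prob G"
      using good_event_bounded[OF C(2) L(1) q(1)] .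
    have pG: "1 - \<eta> \<le> prob G" using G(4) tail[OF Q(2)] q(2) by linarith
    have feas: "debias_feasible P \<alpha> \<gamma> (X \<omega>) i (mhat (X \<omega>) i)" if "\<omega> \<in> G" for \<omega>
      using that G(2) by (intro feasible_if_invertible[OF _ pL L0 i]) auto
    have "\<bar>dev \<omega> $ i - W \<omega> $ i\<bar> * sqrt (8 * Cmax) \<le> \<zeta>" if \<omega>: "\<omega> \<in> G" for \<omega>
    proof -
      have "\<bar>dev \<omega> $ i - W \<omega> $ i\<bar> \<le> (q / 2 + 1) * 8 * L\<^sup>2 * C\<^sup>2 / cmin * (\<sigma> * cplx / sqrt (real n))"
        using \<omega> G i q(1) L0 by (intro remainder_bound cone_if_p_bounded[OF pL L0] feas) auto
      then have "\<bar>dev \<omega> $ i - W \<omega> $ i\<bar> * sqrt (8 * Cmax) \<le>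
          (q / 2 + 1) * 8 * L\<^sup>2 * C\<^sup>2 / cmin * (\<sigma> * cplx / sqrt (real n)) * sqrt (8 * Cmax)"
        using const_pos by (intro mult_right_mono) auto
      also have "\<dots> \<le> \<zeta>" using const_pos q(1) by (intro rate Q(7)) auto
      finally show ?thesis .
    qed
    from student_cdf_sandwich[OF i G(1,2) L(1) small feas this pG]
    show "cdf (distr M borel (student i)) x \<le> cdf (centered_normal (\<sigma>\<^sup>2)) (x + \<zeta>) + \<eta> \<and>
       cdf (centered_normal (\<sigma>\<^sup>2)) (x - \<zeta>) - 2 * \<eta> \<le> cdf (distr M borel (student i)) x" by simp
  qed
qed

lemma c0_eq: "c0 = bern_c (\<kappa> * sqrt Cmax) Cmax" by (simp add: c0_def \<tau>_def)

end

text \<open>\<open>Q\<close> is fixed before the model, so it depends on neither dimension nor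
  sparsity; this is what permits both to vary along a sequence.\<close>

lemma student_cdf_approx_uniform:
  fixes \<kappa> cmin Cmax c C \<sigma> \<zeta> \<eta> :: real
  assumes const_pos: "0 < \<kappa>" "0 < cmin" "cmin \<le> Cmax" "0 < C" and \<sigma>: "0 < \<sigma>"
    and C: "192 \<le> bern_c (\<kappa> * sqrt Cmax) Cmax * (C * cmin)\<^sup>2" "12 \<le> C\<^sup>2 / (256 * Cmax)"
    and \<zeta>: "0 < \<zeta>" and \<eta>: "0 < \<eta>"
  shows "\<exists>Q. \<forall>(M :: 'a measure) n p P s sg S \<beta> X \<epsilon> Y \<beta>hat mhat i x.
    sgl_model \<kappa> cmin Cmax c C M n p P s sg \<sigma> S \<beta> X \<epsilon> Y \<beta>hat mhat \<longrightarrow> Q * complexity_e P s sg \<le> sqrt (real n) \<longrightarrow> i < p \<longrightarrow>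
    (let F = cdf (distr M borel (\<lambda>\<omega>. sqrt (real n) *
              (debiased (debias_mat mhat (X \<omega>)) (X \<omega>) (Y \<omega>) (\<beta>hat \<omega>) $ i - \<beta> $ i) /
            sqrt (mhat (X \<omega>) i \<bullet> (sample_cov (X \<omega>) *\<^sub>v mhat (X \<omega>) i)))); \<Phi> = cdf (centered_normal (\<sigma>\<^sup>2))
     in F x \<le> \<Phi> (x + \<zeta>) + \<eta> \<and> \<Phi> (x - \<zeta>) - 2 * \<eta> \<le> F x)"
proof -
  \<comment> \<open>Solves \<open>5 * exp (- K) = \<eta> / 2\<close>, the failure allowed for noise
    and infeasibility in the growing regime.\<close>
  define K where "K = ln (10 / \<eta>)"
  have K: "5 * exp (- K) \<le> \<eta> / 2" using \<eta> by (simp add: K_def exp_minus)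
  define L where "L = 2 + sqrt (exp (K + K * exp K))"
  have "exp (K + K * exp K) = (sqrt (exp (K + K * exp K)))\<^sup>2" by simp
  also have "\<dots> \<le> L\<^sup>2" unfolding L_def by (intro power_mono) auto
  finally have L: "2 \<le> L" "exp (K + K * exp K) \<le> L\<^sup>2" by (auto simp: L_def)
  define q where "q = 1 + \<bar>ln (\<eta> / 2)\<bar>"
  have q1: "1 \<le> q" by (simp add: q_def)
  have "- ln (\<eta> / 2) \<le> q" by (simp add: q_def)
  also have "\<dots> \<le> q\<^sup>2" using q1 mult_left_mono[of 1 q q] by (simp add: power2_eq_square)
  finally have "exp (- q\<^sup>2) \<le> exp (ln (\<eta> / 2))" by simp
  then have q: "exp (- q\<^sup>2) \<le> \<eta> / 2" using \<eta> by simp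
  define m where "m = \<bar>ln (\<eta> / 8)\<bar>"
  have "exp (- m) \<le> exp (ln (\<eta> / 8))" by (simp add: m_def)
  then have m: "4 * exp (- m) \<le> \<eta> / 2" "0 \<le> m" using \<eta> by (auto simp: m_def)
  define e where "e = bern_c (\<kappa> * sqrt Cmax) Cmax"
  have e: "0 < e" unfolding e_def using const_pos by (intro bern_pos) auto
  define \<rho> where "\<rho> L = min 1 (cmin / (2 * (1 + 2 * L)\<^sup>2))" for L
  have \<rho>: "0 < \<rho> 8" "0 < \<rho> L" using const_pos L by (auto simp: \<rho>_def)
  \<comment> \<open>The sum of all lower bounds required of \<open>Q\<close>; every summand is
    nonnegative, so each is dominated.\<close>
  define Q where "Q = (16 + m) / (e * (\<rho> 8)\<^sup>2 / 64) + (16 + m) / (e * (\<rho> L)\<^sup>2 / 64) + C\<^sup>2 * cmin\<^sup>2 + 4 * C + 1 +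
    (1 / 2 + 1) * 8 * 8\<^sup>2 * C\<^sup>2 / cmin * \<sigma> * sqrt (8 * Cmax) / \<zeta> + (q / 2 + 1) * 8 * L\<^sup>2 * C\<^sup>2 / cmin * \<sigma> * sqrt (8 * Cmax) / \<zeta>"
  have nn: "0 \<le> (16 + m) / (e * (\<rho> 8)\<^sup>2 / 64)" "0 \<le> (16 + m) / (e * (\<rho> L)\<^sup>2 / 64)" "0 \<le> C\<^sup>2 * cmin\<^sup>2" "0 \<le> 4 * C"
    "0 \<le> (1 / 2 + 1) * 8 * 8\<^sup>2 * C\<^sup>2 / cmin * \<sigma> * sqrt (8 * Cmax) / \<zeta>"
    "0 \<le> (q / 2 + 1) * 8 * L\<^sup>2 * C\<^sup>2 / cmin * \<sigma> * sqrt (8 * Cmax) / \<zeta>"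
    using m e \<rho> const_pos \<sigma> \<zeta> q1 by auto
  have Q: "(16 + m) / (e * (\<rho> 8)\<^sup>2 / 64) \<le> Q" "(16 + m) / (e * (\<rho> L)\<^sup>2 / 64) \<le> Q" "C\<^sup>2 * cmin\<^sup>2 \<le> Q" "4 * C \<le> Q" "1 \<le> Q"
    "(1 / 2 + 1) * 8 * 8\<^sup>2 * C\<^sup>2 / cmin * \<sigma> * sqrt (8 * Cmax) / \<zeta> \<le> Q"
    "(q / 2 + 1) * 8 * L\<^sup>2 * C\<^sup>2 / cmin * \<sigma> * sqrt (8 * Cmax) / \<zeta> \<le> Q"
    using nn unfolding Q_def by linarith+
  have Q12: "16 + m \<le> e * (\<rho> 8)\<^sup>2 / 64 * Q" "16 + m \<le> e * (\<rho> L)\<^sup>2 / 64 * Q"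
    using Q(1,2) e \<rho> by (simp_all add: field_simps)
  have Q67: "(1 / 2 + 1) * 8 * 8\<^sup>2 * C\<^sup>2 / cmin * \<sigma> * sqrt (8 * Cmax) \<le> \<zeta> * Q"
    "(q / 2 + 1) * 8 * L\<^sup>2 * C\<^sup>2 / cmin * \<sigma> * sqrt (8 * Cmax) \<le> \<zeta> * Q"
    using Q(6,7) \<zeta> by (simp_all only: pos_divide_le_eq mult.commute)
  show ?thesis
  proof (intro exI[of _ Q] allI impI)
    fix M :: "'a measure" and n p P s sg S \<beta> X \<epsilon> Y \<beta>hat mhat i x
    assume "sgl_model \<kappa> cmin Cmax c C M n p P s sg \<sigma> S \<beta> X \<epsilon> Y \<beta>hat mhat"
      and n: "Q * complexity_e P s sg \<le> sqrt (real n)" and i: "i < p"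
    then interpret sgl \<kappa> cmin Cmax c C M n p P s sg \<sigma> S \<beta> X \<epsilon> Y \<beta>hat mhat
      using const_pos by unfold_locales
    have c0e: "c0 = e" by (simp add: c0_eq e_def)
    have re: "rho l = \<rho> l" for l by (simp add: rho_def \<rho>_def)
    have st: "student i = (\<lambda>\<omega>. sqrt (real n) *
              (debiased (debias_mat mhat (X \<omega>)) (X \<omega>) (Y \<omega>) (\<beta>hat \<omega>) $ i - \<beta> $ i) /
            sqrt (mhat (X \<omega>) i \<bullet> (sample_cov (X \<omega>) *\<^sub>v mhat (X \<omega>) i)))"
      by (simp add: student_def fun_eq_iff)
    note * = student_cdf_approx[OF _ C(2) \<zeta> K L q1 q m _ _ Q(3-5) Q67 n i, unfolded c0e re, folded e_def, OF C(1)[folded e_def] Q12]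
    show "let F = cdf (distr M borel (\<lambda>\<omega>. sqrt (real n) *
              (debiased (debias_mat mhat (X \<omega>)) (X \<omega>) (Y \<omega>) (\<beta>hat \<omega>) $ i - \<beta> $ i) /
            sqrt (mhat (X \<omega>) i \<bullet> (sample_cov (X \<omega>) *\<^sub>v mhat (X \<omega>) i)))); \<Phi> = cdf (centered_normal (\<sigma>\<^sup>2))
     in F x \<le> \<Phi> (x + \<zeta>) + \<eta> \<and> \<Phi> (x - \<zeta>) - 2 * \<eta> \<le> F x"
      unfolding st[symmetric] Let_def using * by blast
  qed
qed

text \<open>Spells out the constants outside the locale, where they can be chosen before the model;
  the minimum in the bound on \<open>n\<close> is \<open>rho 8\<close>.\<close>

lemma debiased_decomposition:
  fixes M :: "'a measure"
  assumes const_pos: "0 < \<kappa>" "0 < cmin" "cmin \<le> Cmax" "0 < C"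
    and C: "192 \<le> bern_c (\<kappa> * sqrt Cmax) Cmax * (C * cmin)\<^sup>2" "12 \<le> C\<^sup>2 / (256 * Cmax)"
    and model: "sgl_model \<kappa> cmin Cmax c C M n p P s sg \<sigma> S \<beta> X \<epsilon> Y \<beta>hat mhat"
    and n: "real n \<ge> (C\<^sup>2 * cmin\<^sup>2 + 1088 / (bern_c (\<kappa> * sqrt Cmax) Cmax * (min 1 (cmin / (2 * (1 + 2 * 8)\<^sup>2)))\<^sup>2)) *
              complexity_e P s sg"
  shows "\<exists>\<Delta> w. \<Delta> \<in> M \<rightarrow>\<^sub>M vec_borel p \<and>
          (\<forall>\<omega>\<in>space M.
             sqrt (real n) \<cdot>\<^sub>v (debiased (debias_mat mhat (X \<omega>)) (X \<omega>) (Y \<omega>) (\<beta>hat \<omega>) - \<beta>) = \<Delta> \<omega> + w \<omega>) \<and>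
          cond_centered_normal M (mat_borel n p) X p w
            (\<lambda>A. \<sigma>\<^sup>2 \<cdot>\<^sub>m (debias_mat mhat A * sample_cov A * transpose_mat (debias_mat mhat A))) \<and>
          measure M {\<omega> \<in> space M. norm_inf (\<Delta> \<omega>) \<le> 768 * C\<^sup>2 / cmin * complexity_e P s sg / sqrt (real n) * \<sigma>}
            \<ge> 1 - 9 * exp (- 1 * (complexity P s sg / real s))"
proof -
  interpret sgl \<kappa> cmin Cmax c C M n p P s sg \<sigma> S \<beta> X \<epsilon> Y \<beta>hat mhat
    using model const_pos by unfold_locales
  note n' = n[folded c0_eq, folded rho_def]
  have "0 \<le> C\<^sup>2 * cmin\<^sup>2 * cplxe" "0 \<le> 1088 / (c0 * (rho 8)\<^sup>2) * cplxe"
    using cplxe_ge1 c0_pos by auto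
  with n' have n12: "C\<^sup>2 * cmin\<^sup>2 * cplxe \<le> real n" "1088 / (c0 * (rho 8)\<^sup>2) * cplxe \<le> real n"
    unfolding distrib_right by linarith+
  note dec = decomposition[OF C(1)[folded c0_eq] C(2) n12]
  show ?thesis
  proof (rule exI[of _ "\<lambda>\<omega>. dev \<omega> - W \<omega>"], rule exI[of _ W], intro conjI ballI dec W_cond_normal)
    fix \<omega> assume \<omega>: "\<omega> \<in> space M"
    show "sqrt (real n) \<cdot>\<^sub>v (debiased (debias_mat mhat (X \<omega>)) (X \<omega>) (Y \<omega>) (\<beta>hat \<omega>) - \<beta>) = dev \<omega> - W \<omega> + W \<omega>"
      using dev_carrier[OF \<omega>] W_carrier[OF \<omega>] unfolding dev_def[symmetric] by (intro eq_vecI) auto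
  qed
qed

lemma debiased_asymptotically_normal:
  fixes M :: "nat \<Rightarrow> 'a measure"
  assumes const_pos: "0 < \<kappa>" "0 < cmin" "cmin \<le> Cmax" "0 < C"
    and C: "192 \<le> bern_c (\<kappa> * sqrt Cmax) Cmax * (C * cmin)\<^sup>2" "12 \<le> C\<^sup>2 / (256 * Cmax)"
    and model: "\<And>k. sgl_model \<kappa> cmin Cmax c C (M k) (n k) (p k) (P k) (s k) (sg k) \<sigma> (S k) (\<beta> k)
              (X k) (\<epsilon> k) (Y k) (\<beta>hat k) (mhat k)"
    and lim: "filterlim (\<lambda>k. sqrt (real (n k)) / complexity_e (P k) (s k) (sg k)) at_top sequentially"
    and i: "\<And>k. i k < p k"
  shows "weak_conv_m
         (\<lambda>k. distr (M k) borel (\<lambda>\<omega>.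
            sqrt (real (n k)) *
              (debiased (debias_mat (mhat k) (X k \<omega>)) (X k \<omega>) (Y k \<omega>) (\<beta>hat k \<omega>) $ i k - \<beta> k $ i k) /
            sqrt (mhat k (X k \<omega>) (i k) \<bullet> (sample_cov (X k \<omega>) *\<^sub>v mhat k (X k \<omega>) (i k)))))
         (density lborel (normal_density 0 \<sigma>))"
proof -
  have sgl: "sgl \<kappa> cmin Cmax c C (M k) (n k) (p k) (P k) (s k) (sg k) \<sigma> (S k) (\<beta> k)
        (X k) (\<epsilon> k) (Y k) (\<beta>hat k) (mhat k)" for k
    using model const_pos by (intro sgl.intro) auto
  have \<sigma>: "0 < \<sigma>" using sgl.\<sigma>_pos[OF sgl] .
  define \<nu> where "\<nu> k = distr (M k) borel (\<lambda>\<omega>.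
            sqrt (real (n k)) *
              (debiased (debias_mat (mhat k) (X k \<omega>)) (X k \<omega>) (Y k \<omega>) (\<beta>hat k \<omega>) $ i k - \<beta> k $ i k) /
            sqrt (mhat k (X k \<omega>) (i k) \<bullet> (sample_cov (X k \<omega>) *\<^sub>v mhat k (X k \<omega>) (i k))))" for k
  define \<Phi> where "\<Phi> = cdf (centered_normal (\<sigma>\<^sup>2))"
  have conv: "(\<lambda>k. cdf (\<nu> k) x) \<longlonglongrightarrow> \<Phi> x" if cont: "isCont \<Phi> x" for x
  proof (rule tendstoI)
    fix t :: real assume t: "0 < t"
    then have "\<exists>d>0. \<forall>y. dist y x < d \<longrightarrow> dist (\<Phi> y) (\<Phi> x) < t / 2"
      using cont half_gt_zero[OF t] unfolding continuous_at_eps_delta by blast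
    then obtain d where d: "0 < d" "\<And>y. dist y x < d \<Longrightarrow> dist (\<Phi> y) (\<Phi> x) < t / 2" by blast
    \<comment> \<open>The limit law is reached only up to a shift by \<open>\<zeta>\<close>, which
      continuity of \<open>\<Phi>\<close> at \<open>x\<close> absorbs into \<open>t / 2\<close>; the
      probability loss, taken as \<open>t / 8\<close>, adds at most \<open>t / 4\<close>.\<close>
    define \<zeta> where "\<zeta> = d / 2"
    have \<zeta>: "0 < \<zeta>" using d by (simp add: \<zeta>_def)
    have "dist (x + \<zeta>) x < d" "dist (x - \<zeta>) x < d" using d(1) by (auto simp: \<zeta>_def dist_real_def)
    from this[THEN d(2)] have near: "\<Phi> (x + \<zeta>) < \<Phi> x + t / 2" "\<Phi> x - t / 2 < \<Phi> (x - \<zeta>)"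
      unfolding dist_real_def by linarith+
    have t8: "0 < t / 8" using t by simp
    note approx = student_cdf_approx_uniform[OF const_pos \<sigma> C \<zeta> t8, where c=c and 'a='a]
    then obtain Q where Q: "\<And>k. Q * complexity_e (P k) (s k) (sg k) \<le> sqrt (real (n k)) \<Longrightarrow>
       cdf (\<nu> k) x \<le> \<Phi> (x + \<zeta>) + t / 8 \<and> \<Phi> (x - \<zeta>) - 2 * (t / 8) \<le> cdf (\<nu> k) x"
      unfolding Let_def \<nu>_def \<Phi>_def
    proof (elim exE, goal_cases)
      case (1 Q)
      show ?case by (rule 1(1)[of Q], rule 1(2)[rule_format, OF model _ i])
    qed
    have "\<forall>\<^sub>F k in sequentially. Q \<le> sqrt (real (n k)) / complexity_e (P k) (s k) (sg k)"
      using lim by (auto simp: filterlim_at_top)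
    then show "\<forall>\<^sub>F k in sequentially. dist (cdf (\<nu> k) x) (\<Phi> x) < t"
    proof (rule eventually_mono)
      fix k assume k: "Q \<le> sqrt (real (n k)) / complexity_e (P k) (s k) (sg k)"
      have "1 \<le> complexity_e (P k) (s k) (sg k)" by (rule sgl.cplxe_ge1[OF sgl])
      then have "Q * complexity_e (P k) (s k) (sg k) \<le> sqrt (real (n k))" using k by (simp add: field_simps)
      from Q[OF this] show "dist (cdf (\<nu> k) x) (\<Phi> x) < t" using near t unfolding dist_real_def by linarith
    qed
  qed
  show ?thesis
    unfolding weak_conv_m_def weak_conv_def centered_normal_square[OF \<sigma>, symmetric]
    using conv unfolding \<nu>_def \<Phi>_def by blast
qed

theorem theorem6:
  fixes \<kappa> cmin Cmax :: real
  assumes "0 < \<kappa>" and "0 < cmin" and "cmin \<le> Cmax"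
  shows "\<exists>Clarge c. 0 < Clarge \<and> 0 < c \<and> (\<forall>C\<ge>Clarge. \<exists>C0 C1 C2 C3. 0 < C0 \<and> 0 < C1 \<and> 0 < C2 \<and> 0 < C3 \<and>
    (\<forall>(M :: 'a measure) n p P s sg \<sigma> S \<beta> X \<epsilon> Y \<beta>hat mhat.
       sgl_model \<kappa> cmin Cmax c C M n p P s sg \<sigma> S \<beta> X \<epsilon> Y \<beta>hat mhat \<longrightarrow>
       real n \<ge> C0 * complexity_e P s sg \<longrightarrow>
       (\<exists>\<Delta> w. \<Delta> \<in> M \<rightarrow>\<^sub>M vec_borel p \<and>
          (\<forall>\<omega>\<in>space M.
             sqrt (real n) \<cdot>\<^sub>v (debiased (debias_mat mhat (X \<omega>)) (X \<omega>) (Y \<omega>) (\<beta>hat \<omega>) - \<beta>) = \<Delta> \<omega> + w \<omega>) \<and>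
          cond_centered_normal M (mat_borel n p) X p w
            (\<lambda>A. \<sigma>\<^sup>2 \<cdot>\<^sub>m (debias_mat mhat A * sample_cov A * transpose_mat (debias_mat mhat A))) \<and>
          measure M {\<omega> \<in> space M. norm_inf (\<Delta> \<omega>) \<le> C3 * complexity_e P s sg / sqrt (real n) * \<sigma>}
            \<ge> 1 - C1 * exp (- C2 * (complexity P s sg / real s)))) \<and>
    (\<forall>(M :: nat \<Rightarrow> 'a measure) n p P s sg \<sigma> S \<beta> X \<epsilon> Y \<beta>hat mhat i.
       (\<forall>k. sgl_model \<kappa> cmin Cmax c C (M k) (n k) (p k) (P k) (s k) (sg k) \<sigma> (S k) (\<beta> k)
              (X k) (\<epsilon> k) (Y k) (\<beta>hat k) (mhat k)) \<longrightarrow>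
       filterlim (\<lambda>k. sqrt (real (n k)) / complexity_e (P k) (s k) (sg k)) at_top sequentially \<longrightarrow>
       (\<forall>k. i k < p k) \<longrightarrow>
       weak_conv_m
         (\<lambda>k. distr (M k) borel (\<lambda>\<omega>.
            sqrt (real (n k)) *
              (debiased (debias_mat (mhat k) (X k \<omega>)) (X k \<omega>) (Y k \<omega>) (\<beta>hat k \<omega>) $ i k - \<beta> k $ i k) /
            sqrt (mhat k (X k \<omega>) (i k) \<bullet> (sample_cov (X k \<omega>) *\<^sub>v mhat k (X k \<omega>) (i k)))))
         (density lborel (normal_density 0 \<sigma>))))"
proof -
  define e where "e = bern_c (\<kappa> * sqrt Cmax) Cmax"
  have e: "0 < e" unfolding e_def using assms by (intro bern_pos) auto
  \<comment> \<open>The summands enforce \<open>192 \<le> e * (C * cmin)\<^sup>2\<close> and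
    \<open>12 \<le> C\<^sup>2 / (256 * Cmax)\<close>, with \<open>3072 = 12 * 256\<close>. The
    leading \<open>1\<close> ensures \<open>C \<le> C\<^sup>2\<close>, so that a lower bound on
    \<open>C\<close> is one on \<open>C\<^sup>2\<close>.\<close>
  define Clarge where "Clarge = 1 + 192 / (e * cmin\<^sup>2) + 3072 * Cmax"
  have "0 \<le> 192 / (e * cmin\<^sup>2)" "0 \<le> 3072 * Cmax" using assms e by auto
  then have Cl: "1 \<le> Clarge" "192 / (e * cmin\<^sup>2) \<le> Clarge" "3072 * Cmax \<le> Clarge"
    unfolding Clarge_def by linarith+
  show ?thesis
  proof (rule exI[of _ Clarge], rule exI[of _ 1], intro conjI allI impI, goal_cases)
    case 1
    show ?case using Cl by simp
  next
    case 2
    show ?case by simp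
  next
    case (3 C)
    have C1: "1 \<le> C" using Cl 3 by simp
    then have C0: "0 < C" by simp
    have CC: "Clarge \<le> C\<^sup>2" using 3 C1 mult_left_mono[of 1 C C] unfolding power2_eq_square by linarith
    have Ca: "192 \<le> bern_c (\<kappa> * sqrt Cmax) Cmax * (C * cmin)\<^sup>2"
      using order_trans[OF Cl(2) CC] e assms unfolding e_def[symmetric] by (simp add: field_simps power_mult_distrib)
    have Cb: "12 \<le> C\<^sup>2 / (256 * Cmax)" using order_trans[OF Cl(3) CC] assms by (simp add: field_simps)
    define C0 where "C0 = C\<^sup>2 * cmin\<^sup>2 + 1088 / (e * (min 1 (cmin / (2 * (1 + 2 * 8)\<^sup>2)))\<^sup>2)"
    show ?case
    proof (rule exI[of _ C0], rule exI[of _ 9], rule exI[of _ 1], rule exI[of _ "768 * C\<^sup>2 / cmin"],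
        intro conjI allI impI, goal_cases)
      case 1
      show ?case unfolding C0_def using C1 e assms by (intro add_pos_nonneg) auto
    next
      case 2
      show ?case by simp
    next
      case 3
      show ?case by simp
    next
      case 4
      show ?case using C1 assms by simp
    next
      case 5
      then show ?case
        using debiased_decomposition[OF assms \<open>0 < C\<close> Ca Cb] unfolding C0_def e_def by blast
    next
      case 6
      then show ?case
        by (intro debiased_asymptotically_normal[OF assms \<open>0 < C\<close> Ca Cb]) auto
    qed
  qed
qed

end
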